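(* Let $G$ be a finite $p$-group, $p$ a prime, let $\nabla=\nabla_G(\mathbb{Z})$ be the destriction algebra of $G$ over $\mathbb{Z}$, let $\Pi=\mathrm{c}_1^+\nabla\mathrm{c}_1^+$ where $\mathrm{c}_1^+=\sum_{H\le G}\mathrm{c}_{H/H}$, let $B^*$ denote the $p$-biset functor of super class functions (the dual of the Burnside ring functor), regarded as a $\nabla$-module, and let $Z$ be the $\Pi$-module $\prod_{H\le G}\mathbb{Z}$ with the trivial $\Pi$-action. Then: 1. $B^*\cong\mathrm{Coind}_\Pi^\nabla Z$ as $\nabla$-modules. 2. $\mathrm{Ext}^1_\nabla(J,B^* )=0$.
   Context: A section of $G$ is a pair $(U,V)$ with $V\trianglelefteq U\le G$; $(U,V)\preceq(M,L)$ means $L\le V\le U\le M$. Let $\mathcal{D}_G$ be the category with objects the sections of $G$, morphisms $\mathrm{Hom}((U,V),(M,L))=\{Mg:g\in G,\ {}^g(U,V)\preceq(M,L)\}$ and composition $Nh\circ Mg=Nhg$. The destriction algebra $\nabla_G(\mathbb{Z})$ is (isomorphic to) the category algebra of $\mathcal{D}_G^{\mathrm{op}}$ over $\mathbb{Z}$; thus $\nabla$-modules are the same as contravariant functors $F$ from $\mathcal{D}_G$ to abelian groups, $F(U/V):=F((U,V))$. For a section $(U,V)$, $\mathrm{c}_{U/V}\in\nabla$ is the idempotent given by the identity of $(U,V)$; for $(U,V)\preceq(M,L)$, $\mathrm{Des}^{M/L}_{U/V}$ is the element given by the morphism $M\cdot1$. $\Pi$ is spanned by the conjugations $\mathrm{c}^g:H/H\to{}^gH/{}^gH$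 ($g\in G$, $H\le G$) between the sections $(H,H)$. The trivial $\Pi$-module $Z=\prod_{H\le G}\mathbb{Z}$ has $\mathrm{c}_{H/H}Z=\mathbb{Z}$ for each $H$ and every conjugation $(H,H)\to({}^gH,{}^gH)$ acting as the identity $\mathbb{Z}\to\mathbb{Z}$. $\mathrm{Coind}_\Pi^\nabla Z=\mathrm{Hom}_\Pi(\mathrm{c}_1^+\nabla,Z)$, with $\nabla$ acting through right multiplication on $\mathrm{c}_1^+\nabla$. $B^*(P)=\mathrm{Hom}_{\mathbb{Z}}(B(P),\mathbb{Z})$ is identified with the group of integer valued functions on the set of subgroups of $P$ that are constant on conjugacy classes; restriction is restriction of functions to subgroups of a subgroup, deflation is $(\mathrm{Def}^P_{P/N}f)(X/N)=f(X)$, and conjugations act by transport. $J$ is the subfunctor of the constant functor $\underline{\mathbb{Z}}$ on $\mathcal{D}_G$ with value $\mathbb{Z}$ on sections $(U,V)$ with $V\ne1$ and value $0$ on sections with $V=1$. *)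

theory Defs
  imports "HOL-Algebra.Module" "HOL-Algebra.Elementary_Groups" "HOL-Computational_Algebra.Primes"
begin

section \<open>Left modules over a (not necessarily commutative) ring\<close>

text \<open>
  The locale \<^locale>\<open>module\<close> of the library requires a commutative ring of scalars; we reuse its
  record type. The ring multiplication and unit of such a record play no role for a module.
\<close>

locale left_module = R?: ring R + M?: abelian_group M
  for R :: "('r, 'c) ring_scheme" (structure) and M :: "('r, 'm, 'd) module_scheme" (structure) +
  assumes smult_closed: "a \<in> carrier R \<Longrightarrow> x \<in> carrier M \<Longrightarrow> a \<odot>\<^bsub>M\<^esub> x \<in> carrier M"
    and smult_l_distr: "a \<in> carrier R \<Longrightarrow> b \<in> carrier R \<Longrightarrow> x \<in> carrier M \<Longrightarrow>
      (a \<oplus>\<^bsub>R\<^esub> b) \<odot>\<^bsub>M\<^esub> x = a \<odot>\<^bsub>M\<^esub> x \<oplus>\<^bsub>M\<^esub> b \<odot>\<^bsub>M\<^esub> x"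
    and smult_r_distr: "a \<in> carrier R \<Longrightarrow> x \<in> carrier M \<Longrightarrow> y \<in> carrier M \<Longrightarrow>
      a \<odot>\<^bsub>M\<^esub> (x \<oplus>\<^bsub>M\<^esub> y) = a \<odot>\<^bsub>M\<^esub> x \<oplus>\<^bsub>M\<^esub> a \<odot>\<^bsub>M\<^esub> y"
    and smult_assoc: "a \<in> carrier R \<Longrightarrow> b \<in> carrier R \<Longrightarrow> x \<in> carrier M \<Longrightarrow>
      (a \<otimes>\<^bsub>R\<^esub> b) \<odot>\<^bsub>M\<^esub> x = a \<odot>\<^bsub>M\<^esub> (b \<odot>\<^bsub>M\<^esub> x)"
    and smult_one: "x \<in> carrier M \<Longrightarrow> \<one>\<^bsub>R\<^esub> \<odot>\<^bsub>M\<^esub> x = x"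

definition mod_hom ::
  "('r, 'c) ring_scheme \<Rightarrow> ('r, 'm, 'd) module_scheme \<Rightarrow> ('r, 'n, 'e) module_scheme \<Rightarrow> ('m \<Rightarrow> 'n) set"
  where "mod_hom R M N = {f \<in> carrier M \<rightarrow>\<^sub>E carrier N.
    (\<forall>x\<in>carrier M. \<forall>y\<in>carrier M. f (x \<oplus>\<^bsub>M\<^esub> y) = f x \<oplus>\<^bsub>N\<^esub> f y) \<and>
    (\<forall>a\<in>carrier R. \<forall>x\<in>carrier M. f (a \<odot>\<^bsub>M\<^esub> x) = a \<odot>\<^bsub>N\<^esub> f x)}"

definition mod_isomorphic ::
  "('r, 'c) ring_scheme \<Rightarrow> ('r, 'm, 'd) module_scheme \<Rightarrow> ('r, 'n, 'e) module_scheme \<Rightarrow> bool"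
  where "mod_isomorphic R M N \<longleftrightarrow> (\<exists>f\<in>mod_hom R M N. bij_betw f (carrier M) (carrier N))"

definition hom_group ::
  "('r, 'c) ring_scheme \<Rightarrow> ('r, 'm, 'd) module_scheme \<Rightarrow> ('r, 'n, 'e) module_scheme \<Rightarrow> ('m \<Rightarrow> 'n) monoid"
  where "hom_group R M N =
    \<lparr>carrier = mod_hom R M N,
     monoid.mult = (\<lambda>f g. \<lambda>x\<in>carrier M. f x \<oplus>\<^bsub>N\<^esub> g x),
     one = (\<lambda>x\<in>carrier M. \<zero>\<^bsub>N\<^esub>)\<rparr>"


section \<open>The functor $\mathrm{Ext}^1$\<close>

text \<open>
  $\mathrm{Ext}^1_R(M,N)$ is the first cohomology group of $\mathrm{Hom}_R(P_\bullet,N)$, where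
  $P_\bullet\to M$ is the canonical free resolution: $P_0$ is free on the set underlying $M$, and
  $P_{n+1}$ is free on the set underlying the kernel of the previous map.
\<close>

definition free_module :: "('r, 'c) ring_scheme \<Rightarrow> 'x set \<Rightarrow> ('r, 'x \<Rightarrow> 'r) module"
  where "free_module R S =
    \<lparr>carrier = {u. (\<forall>x. u x \<in> carrier R) \<and> finite {x. u x \<noteq> \<zero>\<^bsub>R\<^esub>} \<and> {x. u x \<noteq> \<zero>\<^bsub>R\<^esub>} \<subseteq> S},
     monoid.mult = undefined, one = undefined,
     zero = (\<lambda>x. \<zero>\<^bsub>R\<^esub>),
     add = (\<lambda>u v x. u x \<oplus>\<^bsub>R\<^esub> v x),
     smult = (\<lambda>a u x. a \<otimes>\<^bsub>R\<^esub> u x)\<rparr>"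

definition free_cover :: "('r, 'c) ring_scheme \<Rightarrow> ('r, 'm, 'd) module_scheme \<Rightarrow> ('r, 'm \<Rightarrow> 'r) module"
  where "free_cover R M = free_module R (carrier M)"

definition cover_map ::
  "('r, 'c) ring_scheme \<Rightarrow> ('r, 'm, 'd) module_scheme \<Rightarrow> ('m \<Rightarrow> 'r) \<Rightarrow> 'm"
  where "cover_map R M =
    (\<lambda>u\<in>carrier (free_cover R M). \<Oplus>\<^bsub>M\<^esub>x\<in>{x. u x \<noteq> \<zero>\<^bsub>R\<^esub>}. u x \<odot>\<^bsub>M\<^esub> x)"

definition syzygy :: "('r, 'c) ring_scheme \<Rightarrow> ('r, 'm, 'd) module_scheme \<Rightarrow> ('r, 'm \<Rightarrow> 'r) module"
  where "syzygy R M =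
    (free_cover R M)\<lparr>carrier := {u \<in> carrier (free_cover R M). cover_map R M u = \<zero>\<^bsub>M\<^esub>}\<rparr>"

definition res_module0 :: "('r, 'c) ring_scheme \<Rightarrow> ('r, 'm, 'd) module_scheme \<Rightarrow> ('r, 'm \<Rightarrow> 'r) module"
  where "res_module0 R M = free_cover R M"

definition res_module1 ::
  "('r, 'c) ring_scheme \<Rightarrow> ('r, 'm, 'd) module_scheme \<Rightarrow> ('r, ('m \<Rightarrow> 'r) \<Rightarrow> 'r) module"
  where "res_module1 R M = free_cover R (syzygy R M)"

definition res_module2 ::
  "('r, 'c) ring_scheme \<Rightarrow> ('r, 'm, 'd) module_scheme \<Rightarrow> ('r, (('m \<Rightarrow> 'r) \<Rightarrow> 'r) \<Rightarrow> 'r) module"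
  where "res_module2 R M = free_cover R (syzygy R (syzygy R M))"

definition res_map1 ::
  "('r, 'c) ring_scheme \<Rightarrow> ('r, 'm, 'd) module_scheme \<Rightarrow> (('m \<Rightarrow> 'r) \<Rightarrow> 'r) \<Rightarrow> ('m \<Rightarrow> 'r)"
  where "res_map1 R M = cover_map R (syzygy R M)"

definition res_map2 ::
  "('r, 'c) ring_scheme \<Rightarrow> ('r, 'm, 'd) module_scheme \<Rightarrow>
    ((('m \<Rightarrow> 'r) \<Rightarrow> 'r) \<Rightarrow> 'r) \<Rightarrow> (('m \<Rightarrow> 'r) \<Rightarrow> 'r)"
  where "res_map2 R M = cover_map R (syzygy R (syzygy R M))"

definition Ext1 ::
  "('r, 'c) ring_scheme \<Rightarrow> ('r, 'm, 'd) module_scheme \<Rightarrow> ('r, 'n, 'e) module_scheme \<Rightarrow>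
    ((('m \<Rightarrow> 'r) \<Rightarrow> 'r) \<Rightarrow> 'n) set monoid"
  where "Ext1 R M N =
    (hom_group R (res_module1 R M) N)
      \<lparr>carrier := {\<phi> \<in> mod_hom R (res_module1 R M) N.
         compose (carrier (res_module2 R M)) \<phi> (res_map2 R M) =
           (\<lambda>x\<in>carrier (res_module2 R M). \<zero>\<^bsub>N\<^esub>)}\<rparr>
    Mod {compose (carrier (res_module1 R M)) \<psi> (res_map1 R M) | \<psi>.
         \<psi> \<in> mod_hom R (res_module0 R M) N}"


section \<open>Coinduction from a corner ring\<close>

definition corner_ring :: "('r, 'c) ring_scheme \<Rightarrow> 'r \<Rightarrow> ('r, 'c) ring_scheme"
  where "corner_ring R e = R\<lparr>carrier := {e \<otimes>\<^bsub>R\<^esub> x \<otimes>\<^bsub>R\<^esub> e | x. x \<in> carrier R}, one := e\<rparr>"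

text \<open>The left \<open>corner_ring R e\<close>-module $eR$.\<close>

definition corner_bimodule :: "('r, 'c) ring_scheme \<Rightarrow> 'r \<Rightarrow> ('r, 'r) module"
  where "corner_bimodule R e =
    \<lparr>carrier = {e \<otimes>\<^bsub>R\<^esub> x | x. x \<in> carrier R},
     monoid.mult = undefined, one = undefined,
     zero = \<zero>\<^bsub>R\<^esub>, add = (\<oplus>\<^bsub>R\<^esub>), smult = (\<otimes>\<^bsub>R\<^esub>)\<rparr>"

definition coind_module ::
  "('r, 'c) ring_scheme \<Rightarrow> 'r \<Rightarrow> ('r, 'm, 'd) module_scheme \<Rightarrow> ('r, 'r \<Rightarrow> 'm) module"
  where "coind_module R e Z =
    \<lparr>carrier = mod_hom (corner_ring R e) (corner_bimodule R e) Z,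
     monoid.mult = undefined, one = undefined,
     zero = (\<lambda>x\<in>carrier (corner_bimodule R e). \<zero>\<^bsub>Z\<^esub>),
     add = (\<lambda>\<phi> \<psi>. \<lambda>x\<in>carrier (corner_bimodule R e). \<phi> x \<oplus>\<^bsub>Z\<^esub> \<psi> x),
     smult = (\<lambda>a \<phi>. \<lambda>x\<in>carrier (corner_bimodule R e). \<phi> (x \<otimes>\<^bsub>R\<^esub> a))\<rparr>"


section \<open>The category of sections\<close>

type_synonym 'a sec = "'a set \<times> 'a set"

definition sections :: "('a, 'b) monoid_scheme \<Rightarrow> 'a sec set"
  where "sections G = {(U, V). subgroup U G \<and> V \<lhd> (G\<lparr>carrier := U\<rparr>)}"

definition below :: "'a sec \<Rightarrow> 'a sec \<Rightarrow> bool"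
  where "below s t \<longleftrightarrow> snd t \<subseteq> snd s \<and> snd s \<subseteq> fst s \<and> fst s \<subseteq> fst t"

definition conj_set :: "('a, 'b) monoid_scheme \<Rightarrow> 'a \<Rightarrow> 'a set \<Rightarrow> 'a set"
  where "conj_set G g X = (\<lambda>x. g \<otimes>\<^bsub>G\<^esub> x \<otimes>\<^bsub>G\<^esub> inv\<^bsub>G\<^esub> g) ` X"

definition conj_sec :: "('a, 'b) monoid_scheme \<Rightarrow> 'a \<Rightarrow> 'a sec \<Rightarrow> 'a sec"
  where "conj_sec G g s = (conj_set G g (fst s), conj_set G g (snd s))"

text \<open>
  The same coset can be a morphism between several pairs of sections, so a morphism
  $(U,V)\to(M,L)$ is the triple of its source, its target and its coset $Mg$.
\<close>

type_synonym 'a mor = "'a sec \<times> 'a sec \<times> 'a set"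

abbreviation src :: "'a mor \<Rightarrow> 'a sec" where "src f \<equiv> fst f"
abbreviation tgt :: "'a mor \<Rightarrow> 'a sec" where "tgt f \<equiv> fst (snd f)"
abbreviation coset_of :: "'a mor \<Rightarrow> 'a set" where "coset_of f \<equiv> snd (snd f)"

definition mors :: "('a, 'b) monoid_scheme \<Rightarrow> 'a mor set"
  where "mors G = {(s, t, fst t #>\<^bsub>G\<^esub> g) | s t g.
    s \<in> sections G \<and> t \<in> sections G \<and> g \<in> carrier G \<and> below (conj_sec G g s) t}"

text \<open>
  \<open>mor_comp G f' f\<close> is $f'\circ f$, to be used when the target of \<open>f\<close> is the source of \<open>f'\<close>.
  The product set $(Nh)(Mg)$ is the coset $Nhg$, see \<open>mor_comp_cosets\<close> below.
\<close>

definition mor_comp :: "('a, 'b) monoid_scheme \<Rightarrow> 'a mor \<Rightarrow> 'a mor \<Rightarrow> 'a mor"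
  where "mor_comp G f' f = (src f, tgt f', coset_of f' <#>\<^bsub>G\<^esub> coset_of f)"

definition mor_id :: "'a sec \<Rightarrow> 'a mor"
  where "mor_id s = (s, s, fst s)"


section \<open>The destriction algebra\<close>

text \<open>
  The category algebra over the integers of the \<^emph>\<open>opposite\<close> of the category of sections: the
  product of basis elements \<open>f\<close> and \<open>f'\<close> is $f'\circ f$ if this is defined and $0$ otherwise.
  For finite groups there are finitely many morphisms, so no support condition is needed.
\<close>

definition destriction_algebra :: "('a, 'b) monoid_scheme \<Rightarrow> ('a mor \<Rightarrow> int) ring"
  where "destriction_algebra G =
    \<lparr>carrier = {a. \<forall>f. f \<notin> mors G \<longrightarrow> a f = 0},
     monoid.mult = (\<lambda>a b h. \<Sum>(f, f') | f \<in> mors G \<and> f' \<in> mors G \<and> tgt f = src f' \<and> mor_comp G f' f = h.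
       a f * b f'),
     one = (\<lambda>h. if h \<in> mor_id ` sections G then 1 else 0),
     zero = (\<lambda>h. 0),
     add = (\<lambda>a b h. a h + b h)\<rparr>"

definition c_idem :: "'a sec \<Rightarrow> 'a mor \<Rightarrow> int"
  where "c_idem s = (\<lambda>h. if h = mor_id s then 1 else 0)"

definition c1_plus :: "('a, 'b) monoid_scheme \<Rightarrow> 'a mor \<Rightarrow> int"
  where "c1_plus G = (\<lambda>h. \<Sum>H | subgroup H G. c_idem (H, H) h)"

text \<open>
  The product over all subgroups \<open>H\<close> of the integers, with \<open>c_idem (H, H)\<close> projecting to the
  factor at \<open>H\<close>. In the opposite category a conjugation \<open>f\<close> leads from \<open>tgt f\<close> to \<open>src f\<close>; it acts
  as the identity from the factor at \<open>tgt f\<close> to the factor at \<open>src f\<close>.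
\<close>

definition trivial_module :: "('a, 'b) monoid_scheme \<Rightarrow> ('a mor \<Rightarrow> int, 'a set \<Rightarrow> int) module"
  where "trivial_module G =
    \<lparr>carrier = {z. \<forall>H. \<not> subgroup H G \<longrightarrow> z H = 0},
     monoid.mult = undefined, one = undefined,
     zero = (\<lambda>H. 0),
     add = (\<lambda>z w H. z H + w H),
     smult = (\<lambda>a z H. \<Sum>(f, K) | f \<in> mors G \<and> src f = (H, H) \<and> tgt f = (K, K). a f * z K)\<rparr>"


section \<open>Functors as modules\<close>

text \<open>
  The module of a contravariant functor $F$ is $\prod_s F(s)$ over all sections $s$; a basis element
  \<open>f\<close> acts through the map $F(\mathtt{tgt}\,f)\to F(\mathtt{src}\,f)$.
\<close>

subsection \<open>The constant functor and its subfunctor $J$\<close>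

definition const_module :: "('a, 'b) monoid_scheme \<Rightarrow> ('a mor \<Rightarrow> int, 'a sec \<Rightarrow> int) module"
  where "const_module G =
    \<lparr>carrier = {m. \<forall>s. s \<notin> sections G \<longrightarrow> m s = 0},
     monoid.mult = undefined, one = undefined,
     zero = (\<lambda>s. 0),
     add = (\<lambda>m n s. m s + n s),
     smult = (\<lambda>a m s. \<Sum>f | f \<in> mors G \<and> src f = s. a f * m (tgt f))\<rparr>"

definition J_module :: "('a, 'b) monoid_scheme \<Rightarrow> ('a mor \<Rightarrow> int, 'a sec \<Rightarrow> int) module"
  where "J_module G = (const_module G)
    \<lparr>carrier := {m \<in> carrier (const_module G). \<forall>s\<in>sections G. snd s = {\<one>\<^bsub>G\<^esub>} \<longrightarrow> m s = 0}\<rparr>"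

subsection \<open>Super class functions\<close>

definition superclass_functions :: "('x, 'b) monoid_scheme \<Rightarrow> ('x set \<Rightarrow> int) set"
  where "superclass_functions P = {f.
    (\<forall>X. \<not> subgroup X P \<longrightarrow> f X = 0) \<and>
    (\<forall>X x. subgroup X P \<longrightarrow> x \<in> carrier P \<longrightarrow> f (conj_set P x X) = f X)}"

definition sec_quot :: "('a, 'b) monoid_scheme \<Rightarrow> 'a sec \<Rightarrow> 'a set monoid"
  where "sec_quot G s = G\<lparr>carrier := fst s\<rparr> Mod snd s"

text \<open>
  A subgroup $X/V$ of $U/V$ is a set \<open>W\<close> of cosets of $V$, with $X=\bigcup W$. Restriction from
  \<open>t\<close> to \<open>s\<close> is meant for \<open>snd s = snd t\<close>, and deflation from \<open>t\<close> to \<open>s\<close> for \<open>fst s = fst t\<close>;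
  the latter sends $f$ to $X/V\mapsto f(X/L)$, where $t=(U,L)$ and $s=(U,V)$, and $U/V$ is
  identified with $(U/L)/(V/L)$.
\<close>

definition res_sc :: "('a, 'b) monoid_scheme \<Rightarrow> 'a sec \<Rightarrow> ('a set set \<Rightarrow> int) \<Rightarrow> 'a set set \<Rightarrow> int"
  where "res_sc G s f W = (if subgroup W (sec_quot G s) then f W else 0)"

definition def_sc ::
  "('a, 'b) monoid_scheme \<Rightarrow> 'a sec \<Rightarrow> 'a sec \<Rightarrow> ('a set set \<Rightarrow> int) \<Rightarrow> 'a set set \<Rightarrow> int"
  where "def_sc G t s f W =
    (if subgroup W (sec_quot G s) then f (rcosets\<^bsub>G\<lparr>carrier := \<Union>W\<rparr>\<^esub> (snd t)) else 0)"

definition des_sc ::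
  "('a, 'b) monoid_scheme \<Rightarrow> 'a sec \<Rightarrow> 'a sec \<Rightarrow> ('a set set \<Rightarrow> int) \<Rightarrow> 'a set set \<Rightarrow> int"
  where "des_sc G t s f = def_sc G (fst s, snd t) s (res_sc G (fst s, snd t) f)"

text \<open>Transport along the conjugation from \<open>s\<close> to \<open>conj_sec G g s\<close>.\<close>

definition conj_sc ::
  "('a, 'b) monoid_scheme \<Rightarrow> 'a \<Rightarrow> 'a sec \<Rightarrow> ('a set set \<Rightarrow> int) \<Rightarrow> 'a set set \<Rightarrow> int"
  where "conj_sc G g s f W = (if subgroup W (sec_quot G s) then f (conj_set G g ` W) else 0)"

text \<open>
  The morphism $Mg:(U,V)\to(M,L)$ is the conjugation $(U,V)\to{}^g(U,V)$ followed by
  $M1:{}^g(U,V)\to(M,L)$. The choice of \<open>g\<close> does not matter on super class functions, see \<open>act_eq\<close> below.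
\<close>

definition superclass_act ::
  "('a, 'b) monoid_scheme \<Rightarrow> 'a mor \<Rightarrow> ('a set set \<Rightarrow> int) \<Rightarrow> 'a set set \<Rightarrow> int"
  where "superclass_act G f \<beta> =
    (let g = SOME g. g \<in> coset_of f
     in conj_sc G g (src f) (des_sc G (tgt f) (conj_sec G g (src f)) \<beta>))"

definition superclass_module ::
  "('a, 'b) monoid_scheme \<Rightarrow> ('a mor \<Rightarrow> int, 'a sec \<Rightarrow> 'a set set \<Rightarrow> int) module"
  where "superclass_module G =
    \<lparr>carrier = {m. \<forall>s. (s \<in> sections G \<longrightarrow> m s \<in> superclass_functions (sec_quot G s)) \<and>
                       (s \<notin> sections G \<longrightarrow> m s = (\<lambda>W. 0))},
     monoid.mult = undefined, one = undefined,
     zero = (\<lambda>s W. 0),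
     add = (\<lambda>m n s W. m s W + n s W),
     smult = (\<lambda>a m s W. \<Sum>f | f \<in> mors G \<and> src f = s. a f * superclass_act G f (m (tgt f)) W)\<rparr>"


section \<open>Well-definedness\<close>

text \<open>
  The algebra is a ring, and \<open>trivial_module\<close>, \<open>const_module\<close>, \<open>J_module\<close>, \<open>superclass_module\<close>
  and coinduced modules are left modules over the rings intended.
\<close>

definition diag :: "'a sec \<Rightarrow> bool"
  where "diag s \<longleftrightarrow> fst s = snd s"

definition coset_set :: "('a, 'b) monoid_scheme \<Rightarrow> 'a set \<Rightarrow> 'a set \<Rightarrow> 'a set set"
  where "coset_set G X V = (\<lambda>x. V #>\<^bsub>G\<^esub> x) ` X"

context group
begin

lemma conj_set_comp:
  assumes "X \<subseteq> carrier G" "g \<in> carrier G" "h \<in> carrier G"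
  shows "conj_set G h (conj_set G g X) = conj_set G (h \<otimes> g) X"
proof -
  have "h \<otimes> (g \<otimes> x \<otimes> inv g) \<otimes> inv h = h \<otimes> g \<otimes> x \<otimes> inv (h \<otimes> g)" if "x \<in> X" for x
    using assms that by (simp add: inv_mult_group m_assoc subset_iff)
  then show ?thesis by (auto simp: conj_set_def image_image)
qed

lemma conj_set_one: "X \<subseteq> carrier G \<Longrightarrow> conj_set G \<one> X = X"
  by (force simp: conj_set_def subset_iff)

lemma conj_set_closed: "X \<subseteq> carrier G \<Longrightarrow> g \<in> carrier G \<Longrightarrow> conj_set G g X \<subseteq> carrier G"
  by (auto simp: conj_set_def)

lemma conj_set_mono: "X \<subseteq> Y \<Longrightarrow> conj_set G g X \<subseteq> conj_set G g Y"
  by (auto simp: conj_set_def)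

lemma conj_set_subgroup:
  assumes "subgroup H G" "g \<in> carrier G" shows "subgroup (conj_set G g H) G"
proof -
  have *: "inv (g \<otimes> x \<otimes> inv g) = g \<otimes> inv x \<otimes> inv g" if "x \<in> carrier G" for x
    using assms that by (simp add: inv_mult_group m_assoc)
  have **: "g \<otimes> x \<otimes> inv g \<otimes> (g \<otimes> y \<otimes> inv g) = g \<otimes> (x \<otimes> y) \<otimes> inv g"
    if "x \<in> carrier G" "y \<in> carrier G" for x y
  proof -
    have "g \<otimes> x \<otimes> inv g \<otimes> (g \<otimes> y \<otimes> inv g) = g \<otimes> x \<otimes> (inv g \<otimes> (g \<otimes> (y \<otimes> inv g)))"
      using assms that by (simp add: m_assoc)
    also have "\<dots> = g \<otimes> (x \<otimes> y) \<otimes> inv g"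
      using assms that by (simp add: m_assoc[symmetric])
    finally show ?thesis .
  qed
  have sub: "H \<subseteq> carrier G" using assms subgroup.subset by blast
  have 1: "conj_set G g H \<subseteq> carrier G" using sub assms by (simp add: conj_set_closed)
  have 2: "conj_set G g H \<noteq> {}" using assms subgroup.one_closed by (fastforce simp: conj_set_def)
  have 3: "inv a \<in> conj_set G g H" if "a \<in> conj_set G g H" for a
    using that sub * subgroup.m_inv_closed[OF assms(1)] unfolding conj_set_def by (auto simp: image_iff subset_iff)
  have 4: "a \<otimes> b \<in> conj_set G g H" if "a \<in> conj_set G g H" "b \<in> conj_set G g H" for a b
    using that sub ** subgroup.m_closed[OF assms(1)] unfolding conj_set_def
    by (auto simp: image_iff subset_iff)
  show ?thesis using 1 2 3 4 by (auto intro: subgroupI)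
qed

lemma conj_set_self:
  assumes "subgroup M G" "m \<in> M" shows "conj_set G m M = M"
proof -
  have mc: "m \<in> carrier G" "M \<subseteq> carrier G" using assms subgroup.subset by blast+
  have a: "conj_set G m M \<subseteq> M" if "m \<in> M" for m
    using that assms(1) by (auto simp: conj_set_def subgroup.m_closed subgroup.m_inv_closed)
  have "conj_set G (inv m) M \<subseteq> M"
    using a[of "inv m"] assms by (simp add: subgroup.m_inv_closed)
  from conj_set_mono[OF this, of m] have "M \<subseteq> conj_set G m M"
    using mc by (simp add: conj_set_comp conj_set_one)
  then show ?thesis using a assms by auto
qed

lemma sectionsD:
  assumes "(U, V) \<in> sections G"
  shows "subgroup U G" "subgroup V G" "V \<subseteq> U" "U \<subseteq> carrier G" "V \<subseteq> carrier G"
    "normal V (G\<lparr>carrier := U\<rparr>)" "u \<in> U \<Longrightarrow> conj_set G u V = V"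
proof -
  show U: "subgroup U G" and n: "normal V (G\<lparr>carrier := U\<rparr>)" using assms by (auto simp: sections_def)
  then show VU: "V \<subseteq> U" using normal_imp_subgroup subgroup.subset by fastforce
  show V: "subgroup V G" using n U incl_subgroup normal_imp_subgroup by blast
  show Uc: "U \<subseteq> carrier G" and Vc: "V \<subseteq> carrier G" using U V subgroup.subset by auto
  have a: "conj_set G u V \<subseteq> V" if "u \<in> U" for u
    using that normal.inv_op_closed2[OF n] m_inv_consistent[OF U] by (auto simp: conj_set_def)
  show "conj_set G u V = V" if u: "u \<in> U"
  proof
    show "conj_set G u V \<subseteq> V" by (rule a[OF u])
    have "conj_set G (inv u) V \<subseteq> V"
      using a[of "inv u"] u U by (simp add: subgroup.m_inv_closed)
    from conj_set_mono[OF this, of u] show "V \<subseteq> conj_set G u V"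
      using Uc Vc u by (simp add: conj_set_comp conj_set_one subset_iff)
  qed
qed

lemma mor_comp_simps [simp]: "src (mor_comp G f' f) = src f" "tgt (mor_comp G f' f) = tgt f'"
  by (simp_all add: mor_comp_def)

lemma morsE:
  assumes "f \<in> mors G"
  obtains U V M L g where "f = ((U,V),(M,L), M #> g)" "(U,V) \<in> sections G" "(M,L) \<in> sections G"
    "g \<in> carrier G" "L \<subseteq> conj_set G g V" "conj_set G g V \<subseteq> conj_set G g U" "conj_set G g U \<subseteq> M"
  using assms by (auto simp: mors_def below_def conj_sec_def)

lemma mor_comp_cosets:
  assumes "subgroup M G" "subgroup N G" "g \<in> carrier G" "h \<in> carrier G" "conj_set G h M \<subseteq> N"
  shows "(N #> h) <#> (M #> g) = N #> (h \<otimes> g)"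
proof
  have c: "M \<subseteq> carrier G" "N \<subseteq> carrier G" using assms subgroup.subset by auto
  show "(N #> h) <#> (M #> g) \<subseteq> N #> (h \<otimes> g)"
  proof
    fix z assume "z \<in> (N #> h) <#> (M #> g)"
    then obtain n m where nm: "n \<in> N" "m \<in> M" "z = (n \<otimes> h) \<otimes> (m \<otimes> g)"
      by (auto simp: set_mult_def r_coset_def)
    have "h \<otimes> m \<otimes> inv h \<in> N" using assms nm by (auto simp: conj_set_def)
    then have "n \<otimes> (h \<otimes> m \<otimes> inv h) \<in> N" using nm assms by (simp add: subgroup.m_closed)
    moreover have "z = n \<otimes> (h \<otimes> m \<otimes> inv h) \<otimes> (h \<otimes> g)"
    proof -
      have [simp]: "n \<in> carrier G" "m \<in> carrier G" using nm c by auto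
      have "n \<otimes> (h \<otimes> m \<otimes> inv h) \<otimes> (h \<otimes> g) = n \<otimes> (h \<otimes> (m \<otimes> (inv h \<otimes> (h \<otimes> g))))"
        using assms by (simp add: m_assoc)
      also have "inv h \<otimes> (h \<otimes> g) = g" using assms by (simp add: m_assoc[symmetric])
      finally show ?thesis using assms nm(3) by (simp add: m_assoc)
    qed
    ultimately show "z \<in> N #> (h \<otimes> g)" by (auto simp: r_coset_def)
  qed
  show "N #> (h \<otimes> g) \<subseteq> (N #> h) <#> (M #> g)"
  proof
    fix z assume "z \<in> N #> (h \<otimes> g)"
    then obtain n where n: "n \<in> N" "z = n \<otimes> (h \<otimes> g)" by (auto simp: r_coset_def)
    then have "z = (n \<otimes> h) \<otimes> (\<one> \<otimes> g)" using c assms by (auto simp: m_assoc)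
    then show "z \<in> (N #> h) <#> (M #> g)"
      using n subgroup.one_closed[OF assms(1)] by (force simp: set_mult_def r_coset_def)
  qed
qed

lemma mor_comp_closed:
  assumes "f \<in> mors G" "f' \<in> mors G" "tgt f = src f'"
  shows "mor_comp G f' f \<in> mors G"
proof -
  obtain U V M L g where f: "f = ((U,V),(M,L), M #> g)" "(U,V) \<in> sections G" "(M,L) \<in> sections G"
    "g \<in> carrier G" "L \<subseteq> conj_set G g V" "conj_set G g V \<subseteq> conj_set G g U" "conj_set G g U \<subseteq> M"
    using assms morsE by metis
  obtain A B N K h where f': "f' = ((A,B),(N,K), N #> h)" "(A,B) \<in> sections G" "(N,K) \<in> sections G"
    "h \<in> carrier G" "K \<subseteq> conj_set G h B" "conj_set G h B \<subseteq> conj_set G h A" "conj_set G h A \<subseteq> N"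
    using assms morsE by metis
  have AB: "A = M" "B = L" using assms f f' by auto
  note s = sectionsD[OF f(2)] sectionsD[OF f(3)] sectionsD[OF f'(3)]
  have "(N #> h) <#> (M #> g) = N #> (h \<otimes> g)"
    using mor_comp_cosets f f' AB s by blast
  moreover have "K \<subseteq> conj_set G (h \<otimes> g) V" "conj_set G (h \<otimes> g) U \<subseteq> N"
     "conj_set G (h \<otimes> g) V \<subseteq> conj_set G (h \<otimes> g) U"
  using conj_set_mono[OF f(5), of h] conj_set_mono[OF f(6), of h] conj_set_mono[OF f(7), of h]
    f(4) f'(4-7) s by (auto simp: conj_set_comp AB)
  ultimately show ?thesis
    unfolding mors_def mor_comp_def below_def conj_sec_def using f f'
    by (auto intro!: exI[of _ "h \<otimes> g"])
qed

lemma mor_sub: assumes "f \<in> mors G" shows "coset_of f \<subseteq> carrier G" 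
proof -
  obtain U V M L g where f: "f = ((U,V),(M,L), M #> g)" "(U,V) \<in> sections G" "(M,L) \<in> sections G"
    "g \<in> carrier G" "L \<subseteq> conj_set G g V" "conj_set G g V \<subseteq> conj_set G g U" "conj_set G g U \<subseteq> M"
    using assms morsE by metis
  show ?thesis using f sectionsD[OF f(3)] r_coset_subset_G by auto
qed

lemma mor_comp_assoc:
  assumes "f \<in> mors G" "f' \<in> mors G" "f'' \<in> mors G"
  shows "mor_comp G f'' (mor_comp G f' f) = mor_comp G (mor_comp G f'' f') f"
  using assms mor_sub by (simp add: mor_comp_def set_mult_assoc)

lemma mor_id_closed: assumes "s \<in> sections G" shows "mor_id s \<in> mors G"
proof -
  obtain U V where s: "s = (U, V)" by (cases s)
  note d = sectionsD[OF assms[unfolded s]]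
  have "mor_id s = ((U,V),(U,V),U #> \<one>)" using d s by (simp add: mor_id_def)
  then show ?thesis using assms d unfolding mors_def s
    by (auto simp: conj_sec_def conj_set_one below_def intro!: exI[of _ "\<one>"])
qed

lemma mor_src: "f \<in> mors G \<Longrightarrow> src f \<in> sections G" "f \<in> mors G \<Longrightarrow> tgt f \<in> sections G"
  by (auto simp: mors_def)

lemma mor_comp_id:
  assumes "f \<in> mors G"
  shows "mor_comp G f (mor_id (src f)) = f" "mor_comp G (mor_id (tgt f)) f = f"
proof -
  obtain U V M L g where f: "f = ((U,V),(M,L), M #> g)" "(U,V) \<in> sections G" "(M,L) \<in> sections G"
    "g \<in> carrier G" "L \<subseteq> conj_set G g V" "conj_set G g V \<subseteq> conj_set G g U" "conj_set G g U \<subseteq> M"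
    using assms morsE by metis
  note s = sectionsD[OF f(2)] sectionsD[OF f(3)] 
  have "(M #> g) <#> (U #> \<one>) = M #> (g \<otimes> \<one>)" by (rule mor_comp_cosets) (use f s in auto)
  moreover have "(M #> \<one>) <#> (M #> g) = M #> (\<one> \<otimes> g)"
    by (rule mor_comp_cosets) (use f s in \<open>auto simp: conj_set_one\<close>)
  ultimately show "mor_comp G f (mor_id (src f)) = f" "mor_comp G (mor_id (tgt f)) f = f"
    using f s by (auto simp: mor_comp_def mor_id_def)
qed

lemma finite_sections: assumes "finite (carrier G)" shows "finite (sections G)"
proof (rule finite_subset)
  show "sections G \<subseteq> Pow (carrier G) \<times> Pow (carrier G)" by (clarify, auto dest: sectionsD(4,5))
qed (use assms in auto)

lemma finite_mors: assumes "finite (carrier G)" shows "finite (mors G)"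
proof -
  have "mors G \<subseteq> sections G \<times> sections G \<times> Pow (carrier G)"
  proof
    fix f assume "f \<in> mors G"
    then show "f \<in> sections G \<times> sections G \<times> Pow (carrier G)"
     using mor_src[of f] mor_sub[of f] by (cases f) auto
  qed
  then show ?thesis using assms finite_sections by (meson finite_subset finite_SigmaI finite_Pow_iff)
qed


lemma destriction_mult_eq: assumes "finite (carrier G)"
  shows "monoid.mult (destriction_algebra G) a b h =
   (\<Sum>f\<in>mors G. \<Sum>f'\<in>mors G. if tgt f = src f' \<and> mor_comp G f' f = h then a f * b f' else 0)"
proof -
  have "(\<Sum>(f, f') | f \<in> mors G \<and> f' \<in> mors G \<and> tgt f = src f' \<and> mor_comp G f' f = h. a f * b f')
    = (\<Sum>x\<in>mors G \<times> mors G. if tgt (fst x) = src (snd x) \<and> mor_comp G (snd x) (fst x) = h then a (fst x) * b (snd x) else 0)"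
    using finite_mors[OF assms]
    by (subst sum.If_cases) (auto intro!: sum.cong simp: case_prod_beta)
  then show ?thesis by (simp add: destriction_algebra_def sum.cartesian_product case_prod_beta)
qed

lemma destriction_mult_zero: assumes "finite (carrier G)" "h \<notin> mors G" shows
  "monoid.mult (destriction_algebra G) a b h = 0"
  unfolding destriction_mult_eq[OF assms(1)] using assms mor_comp_closed by (force intro!: sum.neutral)

lemma act_assoc:
  assumes fin: "finite (carrier G)"
  shows "(\<Sum>k\<in>mors G. if src k = s then monoid.mult (destriction_algebra G) a b k * \<Phi> k else 0)
    = (\<Sum>f\<in>mors G. if src f = s then a f * (\<Sum>f'\<in>mors G. if src f' = tgt f then b f' * \<Phi> (mor_comp G f' f) else 0) else 0)"
proof -
  let ?M = "mors G"
  note fM = finite_mors[OF fin]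
  have "(\<Sum>k\<in>?M. if src k = s then monoid.mult (destriction_algebra G) a b k * \<Phi> k else 0)
    = (\<Sum>k\<in>?M. \<Sum>f\<in>?M. \<Sum>f'\<in>?M. if tgt f = src f' \<and> mor_comp G f' f = k \<and> src k = s then a f * b f' * \<Phi> k else 0)"
    by (auto intro!: sum.cong simp: destriction_mult_eq[OF fin] sum_distrib_right)
  also have "\<dots> = (\<Sum>f\<in>?M. \<Sum>f'\<in>?M. \<Sum>k\<in>?M. if tgt f = src f' \<and> mor_comp G f' f = k \<and> src k = s then a f * b f' * \<Phi> k else 0)"
    by (subst sum.swap, rule sum.cong[OF refl], rule sum.swap)
  also have "\<dots> = (\<Sum>f\<in>?M. \<Sum>f'\<in>?M. if src f = s \<and> src f' = tgt f then a f * b f' * \<Phi> (mor_comp G f' f) else 0)"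
  proof (intro sum.cong refl)
    fix f f' assume m: "f \<in> ?M" "f' \<in> ?M"
    have "(\<Sum>k\<in>?M. if tgt f = src f' \<and> mor_comp G f' f = k \<and> src k = s then a f * b f' * \<Phi> k else 0)
      = (\<Sum>k\<in>?M. if k = mor_comp G f' f then (if tgt f = src f' \<and> src k = s then a f * b f' * \<Phi> k else 0) else 0)"
      by (intro sum.cong refl, rename_tac k, case_tac "k = mor_comp G f' f") simp_all
    also have "\<dots> = (if src f = s \<and> src f' = tgt f then a f * b f' * \<Phi> (mor_comp G f' f) else 0)"
      using fM mor_comp_closed[OF m] by (cases "tgt f = src f' \<and> src f = s") simp_all
    finally show "(\<Sum>k\<in>?M. if tgt f = src f' \<and> mor_comp G f' f = k \<and> src k = s then a f * b f' * \<Phi> k else 0)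
      = (if src f = s \<and> src f' = tgt f then a f * b f' * \<Phi> (mor_comp G f' f) else 0)" .
  qed
  also have "\<dots> = (\<Sum>f\<in>?M. if src f = s then a f * (\<Sum>f'\<in>?M. if src f' = tgt f then b f' * \<Phi> (mor_comp G f' f) else 0) else 0)"
    by (auto intro!: sum.cong simp: sum_distrib_left mult.assoc)
  finally show ?thesis .
qed

lemma act_one:
  assumes fin: "finite (carrier G)" and s: "s \<in> sections G"
  shows "(\<Sum>k\<in>mors G. if src k = s then one (destriction_algebra G) k * \<Phi> k else 0) = \<Phi> (mor_id s)"
proof -
  have "(\<Sum>k\<in>mors G. if src k = s then one (destriction_algebra G) k * \<Phi> k else 0)
    = (\<Sum>k\<in>mors G. if k = mor_id s then \<Phi> k else 0)"
    using s by (intro sum.cong) (auto simp: destriction_algebra_def mor_id_def)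
  then show ?thesis using s finite_mors[OF fin] mor_id_closed by (simp add: sum.delta)
qed

lemma act_assoc':
  assumes fin: "finite (carrier G)"
  shows "(\<Sum>k\<in>mors G. monoid.mult (destriction_algebra G) a b k * \<Phi> k)
    = (\<Sum>f\<in>mors G. \<Sum>f'\<in>mors G. if src f' = tgt f then a f * b f' * \<Phi> (mor_comp G f' f) else 0)"
proof -
  let ?M = "mors G"
  note fM = finite_mors[OF fin]
  have "(\<Sum>k\<in>?M. monoid.mult (destriction_algebra G) a b k * \<Phi> k)
    = (\<Sum>k\<in>?M. \<Sum>f\<in>?M. \<Sum>f'\<in>?M. if tgt f = src f' \<and> mor_comp G f' f = k then a f * b f' * \<Phi> k else 0)"
    by (auto intro!: sum.cong simp: destriction_mult_eq[OF fin] sum_distrib_right)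
  also have "\<dots> = (\<Sum>f\<in>?M. \<Sum>f'\<in>?M. \<Sum>k\<in>?M. if tgt f = src f' \<and> mor_comp G f' f = k then a f * b f' * \<Phi> k else 0)"
    by (subst sum.swap, rule sum.cong[OF refl], rule sum.swap)
  also have "\<dots> = (\<Sum>f\<in>?M. \<Sum>f'\<in>?M. if src f' = tgt f then a f * b f' * \<Phi> (mor_comp G f' f) else 0)"
  proof (intro sum.cong refl)
    fix f f' assume m: "f \<in> ?M" "f' \<in> ?M"
    have "(\<Sum>k\<in>?M. if tgt f = src f' \<and> mor_comp G f' f = k then a f * b f' * \<Phi> k else 0)
      = (\<Sum>k\<in>?M. if k = mor_comp G f' f then (if tgt f = src f' then a f * b f' * \<Phi> k else 0) else 0)"
      by (auto intro!: sum.cong)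
    also have "\<dots> = (if src f' = tgt f then a f * b f' * \<Phi> (mor_comp G f' f) else 0)"
      using fM mor_comp_closed[OF m] m by (auto simp: sum.delta)
    finally show "(\<Sum>k\<in>?M. if tgt f = src f' \<and> mor_comp G f' f = k then a f * b f' * \<Phi> k else 0)
      = (if src f' = tgt f then a f * b f' * \<Phi> (mor_comp G f' f) else 0)" .
  qed
  finally show ?thesis .
qed

lemma destriction_algebra_ring:
  assumes fin: "finite (carrier G)" shows "ring (destriction_algebra G)"
proof -
  let ?D = "destriction_algebra G" and ?M = "mors G"
  note fM = finite_mors[OF fin]
  have assoc: "monoid.mult ?D (monoid.mult ?D a b) c h = monoid.mult ?D a (monoid.mult ?D b c) h" for a b c h
  proof -
    have "monoid.mult ?D (monoid.mult ?D a b) c h = (\<Sum>f''\<in>?M. \<Sum>k\<in>?M. monoid.mult ?D a b k * 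
      (if tgt k = src f'' \<and> mor_comp G f'' k = h then c f'' else 0))"
      by (subst destriction_mult_eq[OF fin], subst sum.swap) (auto intro!: sum.cong)
    also have "\<dots> = (\<Sum>f''\<in>?M. \<Sum>f\<in>?M. \<Sum>f'\<in>?M. if src f' = tgt f then a f * b f' * (if tgt f' = src f'' \<and> mor_comp G f'' (mor_comp G f' f) = h then c f'' else 0) else 0)"
      by (subst act_assoc'[OF fin]) (simp cong: if_cong)
    also have "\<dots> = (\<Sum>f''\<in>?M. \<Sum>f\<in>?M. \<Sum>f'\<in>?M. if src f' = tgt f \<and> tgt f' = src f'' \<and> mor_comp G (mor_comp G f'' f') f = h then a f * b f' * c f'' else 0)"
      using mor_comp_assoc by (intro sum.cong refl) auto
    also have "\<dots> = (\<Sum>f\<in>?M. \<Sum>f'\<in>?M. \<Sum>f''\<in>?M. if src f' = tgt f \<and> tgt f' = src f'' \<and> mor_comp G (mor_comp G f'' f') f = h then a f * b f' * c f'' else 0)"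
      by (subst sum.swap, rule sum.cong[OF refl], rule sum.swap)
    also have "\<dots> = (\<Sum>f\<in>?M. \<Sum>k\<in>?M. monoid.mult ?D b c k * (if tgt f = src k \<and> mor_comp G k f = h then a f else 0))"
      by (subst act_assoc'[OF fin]) (auto intro!: sum.cong simp: mor_comp_def)
    also have "\<dots> = monoid.mult ?D a (monoid.mult ?D b c) h"
      by (subst (2) destriction_mult_eq[OF fin]) (auto intro!: sum.cong)
    finally show ?thesis .
  qed
  have one_l: "monoid.mult ?D (one ?D) a h = a h" if "a \<in> carrier ?D" for a h
  proof -
    have "monoid.mult ?D (one ?D) a h = (\<Sum>f'\<in>?M. \<Sum>k\<in>?M. if src k = src f' then one ?D k * (if tgt k = src f' \<and> mor_comp G f' k = h then a f' else 0) else 0)"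
      by (subst destriction_mult_eq[OF fin], subst sum.swap) (auto intro!: sum.cong simp: destriction_algebra_def mor_id_def)
    also have "\<dots> = (\<Sum>f'\<in>?M. if f' = h then a f' else 0)"
      by (intro sum.cong refl, subst act_one[OF fin], simp add: mor_src, subst mor_comp_id) (auto simp: mor_id_def)
    also have "\<dots> = a h" using that fM by (auto simp: sum.delta destriction_algebra_def simp del: split_paired_All)
    finally show ?thesis .
  qed
  have one_r: "monoid.mult ?D a (one ?D) h = a h" if "a \<in> carrier ?D" for a h
  proof -
    have "monoid.mult ?D a (one ?D) h = (\<Sum>f'\<in>?M. \<Sum>k\<in>?M. if src k = tgt f' then one ?D k * (if mor_comp G k f' = h then a f' else 0) else 0)"
      by (subst destriction_mult_eq[OF fin]) (auto intro!: sum.cong)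
    also have "\<dots> = (\<Sum>f'\<in>?M. if f' = h then a f' else 0)"
      by (intro sum.cong refl, subst act_one[OF fin]) (auto simp: mor_src mor_comp_id)
    also have "\<dots> = a h" using that fM by (auto simp: sum.delta destriction_algebra_def simp del: split_paired_All)
    finally show ?thesis .
  qed
  have one: "one ?D \<in> carrier ?D" using mor_id_closed by (auto simp: destriction_algebra_def)
  have cl: "monoid.mult ?D a b \<in> carrier ?D" for a b using destriction_mult_zero[OF fin] by (simp add: destriction_algebra_def)
  have ab: "abelian_group ?D"
  proof (rule abelian_groupI)
    fix a assume "a \<in> carrier ?D"
    then show "\<exists>y\<in>carrier ?D. y \<oplus>\<^bsub>?D\<^esub> a = \<zero>\<^bsub>?D\<^esub>"
      by (intro bexI[of _ "\<lambda>h. - a h"]) (auto simp: destriction_algebra_def)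
  qed (auto simp: destriction_algebra_def)
  have mon: "monoid ?D" by (rule monoidI) (use one cl one_l one_r assoc in \<open>auto simp: fun_eq_iff\<close>)
  show ?thesis
  proof (rule ringI[OF ab mon])
    show "(a \<oplus>\<^bsub>?D\<^esub> b) \<otimes>\<^bsub>?D\<^esub> c = a \<otimes>\<^bsub>?D\<^esub> c \<oplus>\<^bsub>?D\<^esub> b \<otimes>\<^bsub>?D\<^esub> c" for a b c
    proof
      fix h show "((a \<oplus>\<^bsub>?D\<^esub> b) \<otimes>\<^bsub>?D\<^esub> c) h = (a \<otimes>\<^bsub>?D\<^esub> c \<oplus>\<^bsub>?D\<^esub> b \<otimes>\<^bsub>?D\<^esub> c) h"
      proof -
        have "(a \<otimes>\<^bsub>?D\<^esub> c \<oplus>\<^bsub>?D\<^esub> b \<otimes>\<^bsub>?D\<^esub> c) h = (a \<otimes>\<^bsub>?D\<^esub> c) h + (b \<otimes>\<^bsub>?D\<^esub> c) h"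
          and "(a \<oplus>\<^bsub>?D\<^esub> b) = (\<lambda>h. a h + b h)"
          by (simp_all add: destriction_algebra_def)
        then show ?thesis by (auto simp: destriction_mult_eq[OF fin] sum.distrib[symmetric] distrib_right intro!: sum.cong)
      qed
    qed
    show "c \<otimes>\<^bsub>?D\<^esub> (a \<oplus>\<^bsub>?D\<^esub> b) = c \<otimes>\<^bsub>?D\<^esub> a \<oplus>\<^bsub>?D\<^esub> c \<otimes>\<^bsub>?D\<^esub> b" for a b c
    proof
      fix h show "(c \<otimes>\<^bsub>?D\<^esub> (a \<oplus>\<^bsub>?D\<^esub> b)) h = (c \<otimes>\<^bsub>?D\<^esub> a \<oplus>\<^bsub>?D\<^esub> c \<otimes>\<^bsub>?D\<^esub> b) h"
      proof -
        have "(c \<otimes>\<^bsub>?D\<^esub> a \<oplus>\<^bsub>?D\<^esub> c \<otimes>\<^bsub>?D\<^esub> b) h = (c \<otimes>\<^bsub>?D\<^esub> a) h + (c \<otimes>\<^bsub>?D\<^esub> b) h"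
          and "(a \<oplus>\<^bsub>?D\<^esub> b) = (\<lambda>h. a h + b h)"
          by (simp_all add: destriction_algebra_def)
        then show ?thesis by (auto simp: destriction_mult_eq[OF fin] sum.distrib[symmetric] distrib_left intro!: sum.cong)
      qed
    qed
  qed
qed

end

context group
begin

lemma sum_filter:
  assumes "finite (carrier G)"
  shows "(\<Sum>f | f \<in> mors G \<and> P f. g f) = (\<Sum>f\<in>mors G. if P f then g f else (0::int))"
  using finite_mors[OF assms] by (simp add: sum.inter_filter)

lemma const_left_module:
  assumes fin: "finite (carrier G)"
  shows "left_module (destriction_algebra G) (const_module G)"
proof -
  let ?M = "const_module G" and ?D = "destriction_algebra G"
  interpret ring ?D using destriction_algebra_ring fin by simp
  have ab: "abelian_group ?M"
  proof (rule abelian_groupI)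
    fix a assume "a \<in> carrier ?M"
    then show "\<exists>y\<in>carrier ?M. y \<oplus>\<^bsub>?M\<^esub> a = \<zero>\<^bsub>?M\<^esub>"
      by (intro bexI[of _ "\<lambda>h. - a h"]) (auto simp: const_module_def)
  qed (auto simp: const_module_def)
  have sm: "(a \<odot>\<^bsub>?M\<^esub> m) s = (\<Sum>f\<in>mors G. if src f = s then a f * m (tgt f) else 0)" for a m s
    by (simp add: const_module_def sum_filter[OF fin])
  have ad: "(m \<oplus>\<^bsub>?M\<^esub> n) s = m s + n s" for m n s by (simp add: const_module_def)
  have adD: "(m \<oplus>\<^bsub>?D\<^esub> n) s = m s + n s" for m n s by (simp add: destriction_algebra_def)
  have cM: "m \<in> carrier ?M \<longleftrightarrow> (\<forall>s. s \<notin> sections G \<longrightarrow> m s = 0)" for m by (simp add: const_module_def)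
  show ?thesis
    unfolding left_module_def left_module_axioms_def
  proof (intro conjI allI impI ab)
    show "ring ?D" by unfold_locales
    fix a m assume "a \<in> carrier ?D" "m \<in> carrier ?M"
    show "a \<odot>\<^bsub>?M\<^esub> m \<in> carrier ?M" unfolding cM sm using mor_src by (auto intro!: sum.neutral simp del: split_paired_All)
  next
    fix a b m assume "a \<in> carrier ?D" "b \<in> carrier ?D" "m \<in> carrier ?M"
    show "(a \<oplus>\<^bsub>?D\<^esub> b) \<odot>\<^bsub>?M\<^esub> m = a \<odot>\<^bsub>?M\<^esub> m \<oplus>\<^bsub>?M\<^esub> b \<odot>\<^bsub>?M\<^esub> m"
      by (rule ext) (simp only: sm ad adD sum.distrib[symmetric], intro sum.cong refl, simp add: distrib_right)
    show "(a \<otimes>\<^bsub>?D\<^esub> b) \<odot>\<^bsub>?M\<^esub> m = a \<odot>\<^bsub>?M\<^esub> (b \<odot>\<^bsub>?M\<^esub> m)"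
      by (rule ext, subst (1 2) sm, subst act_assoc[OF fin]) (simp add: sm cong: if_cong)
  next
    fix a m n assume "a \<in> carrier ?D" "n \<in> carrier ?M" "m \<in> carrier ?M"
    show "a \<odot>\<^bsub>?M\<^esub> (m \<oplus>\<^bsub>?M\<^esub> n) = a \<odot>\<^bsub>?M\<^esub> m \<oplus>\<^bsub>?M\<^esub> a \<odot>\<^bsub>?M\<^esub> n"
      by (rule ext, simp only: sm ad sum.distrib[symmetric], intro sum.cong refl) (simp add: distrib_left)
  next
    fix m assume m: "m \<in> carrier ?M"
    show "\<one>\<^bsub>?D\<^esub> \<odot>\<^bsub>?M\<^esub> m = m"
    proof
      fix s show "(\<one>\<^bsub>?D\<^esub> \<odot>\<^bsub>?M\<^esub> m) s = m s"
      proof (cases "s \<in> sections G")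
        case True then show ?thesis by (subst sm, subst act_one[OF fin True]) (simp add: mor_id_def)
      next
        case False then show ?thesis using m mor_src by (auto simp: cM sm intro!: sum.neutral simp del: split_paired_All)
      qed
    qed
  qed
qed

lemma J_left_module:
  assumes fin: "finite (carrier G)"
  shows "left_module (destriction_algebra G) (J_module G)"
proof -
  let ?C = "const_module G" let ?M = "J_module G" and ?D = "destriction_algebra G"
  interpret C: left_module ?D ?C by (rule const_left_module[OF fin])
  have sm: "(a \<odot>\<^bsub>?C\<^esub> m) s = (\<Sum>f\<in>mors G. if src f = s then a f * m (tgt f) else 0)" for a m s
    by (simp add: const_module_def sum_filter[OF fin])
  have ops: "add ?M = add ?C" "zero ?M = zero ?C" "smult ?M = smult ?C" by (simp_all add: J_module_def)
  have cM: "m \<in> carrier ?M \<longleftrightarrow> m \<in> carrier ?C \<and> (\<forall>s\<in>sections G. snd s = {\<one>} \<longrightarrow> m s = 0)" for m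
    by (simp add: J_module_def)
  have tr: "snd (tgt f) = {\<one>}" if f: "f \<in> mors G" "snd (src f) = {\<one>}" for f
  proof -
    obtain U V M L g where f: "f = ((U,V),(M,L), M #> g)" "(U,V) \<in> sections G" "(M,L) \<in> sections G"
    "g \<in> carrier G" "L \<subseteq> conj_set G g V" "V = {\<one>}"
    using f morsE[of f] by (metis fst_conv snd_conv)
    then have "L \<subseteq> {\<one>}" by (auto simp: conj_set_def)
    then show ?thesis using f sectionsD(2)[OF f(3)] subgroup.one_closed by fastforce
  qed
  have ab: "abelian_group ?M"
  proof (rule abelian_groupI)
    fix a assume "a \<in> carrier ?M"
    then show "\<exists>y\<in>carrier ?M. y \<oplus>\<^bsub>?M\<^esub> a = \<zero>\<^bsub>?M\<^esub>"
      by (intro bexI[of _ "\<lambda>h. - a h"]) (auto simp: J_module_def const_module_def)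
  qed (auto simp: J_module_def const_module_def)
  show ?thesis
    unfolding left_module_def left_module_axioms_def
  proof (intro conjI allI impI ab)
    show "ring ?D" by unfold_locales
    fix a m assume "a \<in> carrier ?D" "m \<in> carrier ?M"
    then show "a \<odot>\<^bsub>?M\<^esub> m \<in> carrier ?M" unfolding cM ops using C.smult_closed tr mor_src
      by (auto simp: sm intro!: sum.neutral simp del: split_paired_All)
  qed (auto simp: cM ops C.smult_l_distr C.smult_r_distr C.smult_assoc C.smult_one)
qed

lemma diag_sectionI: assumes "subgroup H G" shows "(H,H) \<in> sections G"
proof -
  interpret H: group "G\<lparr>carrier := H\<rparr>" using assms by (rule subgroup_imp_group)
  have "subgroup H (G\<lparr>carrier := H\<rparr>)" using H.subgroup_self by simp
  then have "H \<lhd> G\<lparr>carrier := H\<rparr>"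
    using assms by (subst H.normal_inv_iff) (simp add: m_inv_consistent subgroup.m_closed subgroup.m_inv_closed)
  then show ?thesis using assms by (simp add: sections_def)
qed

lemma diag_sectionD: "(H,H) \<in> sections G \<Longrightarrow> subgroup H G" by (auto simp: sections_def)

lemma c1_plus_alt:
  assumes fin: "finite (carrier G)"
  shows "c1_plus G h = (if \<exists>H. subgroup H G \<and> h = mor_id (H,H) then 1 else 0)"
proof -
  have f: "finite {H. subgroup H G}" using fin by (rule finite_subset[rotated, OF finite_Pow_iff[THEN iffD2]]) (auto dest: subgroup.subset)
  show ?thesis
  proof (cases "\<exists>H. subgroup H G \<and> h = mor_id (H,H)")
    case True
    then obtain H where H: "subgroup H G" "h = mor_id (H,H)" by auto
    have "c1_plus G h = (\<Sum>K | subgroup K G. if K = H then 1 else 0)"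
      unfolding c1_plus_def by (intro sum.cong refl) (auto simp: H c_idem_def mor_id_def)
    then show ?thesis using True f H by simp
  next
    case False
    then show ?thesis by (auto simp: c1_plus_def c_idem_def intro!: sum.neutral)
  qed
qed

lemma c1_id:
  assumes fin: "finite (carrier G)" and k: "k \<in> mors G"
  shows "c1_plus G k = (if diag (src k) then one (destriction_algebra G) k else 0)"
    "c1_plus G k = (if diag (tgt k) then one (destriction_algebra G) k else 0)"
proof -
  have "(\<exists>H. subgroup H G \<and> k = mor_id (H,H)) \<longleftrightarrow> diag (src k) \<and> k \<in> mor_id ` sections G"
  proof
    assume "diag (src k) \<and> k \<in> mor_id ` sections G"
    then obtain s where s: "s \<in> sections G" "k = mor_id s" "diag s" by (auto simp: mor_id_def)
    then have "s = (fst s, fst s)" by (simp add: diag_def prod_eq_iff)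
    then show "\<exists>H. subgroup H G \<and> k = mor_id (H,H)" using s diag_sectionD by metis
  qed (auto simp: diag_def mor_id_def diag_sectionI)
  then show "c1_plus G k = (if diag (src k) then one (destriction_algebra G) k else 0)"
    by (auto simp: c1_plus_alt[OF fin] destriction_algebra_def simp del: split_paired_Ex)
  also have "\<dots> = (if diag (tgt k) then one (destriction_algebra G) k else 0)"
    by (auto simp: destriction_algebra_def mor_id_def)
  finally show "c1_plus G k = (if diag (tgt k) then one (destriction_algebra G) k else 0)" .
qed

lemma one_nz: "one (destriction_algebra G) k \<noteq> 0 \<Longrightarrow> tgt k = src k"
  by (auto simp: destriction_algebra_def mor_id_def split: if_splits)

lemma e_left:
  assumes fin: "finite (carrier G)" and a: "a \<in> carrier (destriction_algebra G)"
  shows "monoid.mult (destriction_algebra G) (c1_plus G) a h = (if diag (src h) then a h else 0)"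
proof -
  let ?D = "destriction_algebra G" and ?M = "mors G"
  have "monoid.mult ?D (c1_plus G) a h = (\<Sum>f'\<in>?M. \<Sum>k\<in>?M. if src k = src f' then one ?D k * (if diag (src f') \<and> tgt k = src f' \<and> mor_comp G f' k = h then a f' else 0) else 0)"
    by (subst destriction_mult_eq[OF fin], subst sum.swap, intro sum.cong refl, subst c1_id(2)[OF fin],
        assumption, rename_tac f' k, case_tac "one ?D k = 0") (simp_all add: one_nz)
  also have "\<dots> = (\<Sum>f'\<in>?M. if f' = h then if diag (src f') then a f' else 0 else 0)"
    by (intro sum.cong refl, subst act_one[OF fin], simp add: mor_src, subst mor_comp_id) (auto simp: mor_id_def)
  also have "\<dots> = (if diag (src h) then a h else 0)" using a finite_mors[OF fin] by (auto simp: sum.delta destriction_algebra_def simp del: split_paired_All)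
  finally show ?thesis .
qed

lemma e_right:
  assumes fin: "finite (carrier G)" and a: "a \<in> carrier (destriction_algebra G)"
  shows "monoid.mult (destriction_algebra G) a (c1_plus G) h = (if diag (tgt h) then a h else 0)"
proof -
  let ?D = "destriction_algebra G" and ?M = "mors G"
  have "monoid.mult ?D a (c1_plus G) h = (\<Sum>f'\<in>?M. \<Sum>k\<in>?M. if src k = tgt f' then one ?D k * (if diag (tgt f') \<and> mor_comp G k f' = h then a f' else 0) else 0)"
    by (subst destriction_mult_eq[OF fin], intro sum.cong refl, subst c1_id(1)[OF fin])
      (auto simp: one_nz simp del: split_paired_All split_paired_Ex dest: one_nz)
  also have "\<dots> = (\<Sum>f'\<in>?M. if f' = h then if diag (tgt f') then a f' else 0 else 0)"
    by (intro sum.cong refl, subst act_one[OF fin], simp add: mor_src, subst mor_comp_id) (auto simp: mor_id_def)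
  also have "\<dots> = (if diag (tgt h) then a h else 0)" using a finite_mors[OF fin] by (auto simp: sum.delta destriction_algebra_def simp del: split_paired_All)
  finally show ?thesis .
qed

lemma c1_plus_closed: "finite (carrier G) \<Longrightarrow> c1_plus G \<in> carrier (destriction_algebra G)"
  by (auto simp: destriction_algebra_def c1_plus_alt mor_id_closed diag_sectionI)

lemma c1_plus_idem: "finite (carrier G) \<Longrightarrow> monoid.mult (destriction_algebra G) (c1_plus G) (c1_plus G) = c1_plus G"
  by (rule ext, subst e_left) (auto simp: c1_plus_closed, auto simp: c1_plus_alt mor_id_def diag_def)

lemma Pi_carrier:
  assumes fin: "finite (carrier G)"
  shows "carrier (corner_ring (destriction_algebra G) (c1_plus G)) =
   {a \<in> carrier (destriction_algebra G). \<forall>h. a h \<noteq> 0 \<longrightarrow> diag (src h) \<and> diag (tgt h)}" (is "?L = ?R")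
proof -
  let ?D = "destriction_algebra G"
  interpret ring ?D by (rule destriction_algebra_ring[OF fin])
  note cl = c1_plus_closed[OF fin]
  have x: "(c1_plus G \<otimes>\<^bsub>?D\<^esub> x \<otimes>\<^bsub>?D\<^esub> c1_plus G) h = (if diag (src h) \<and> diag (tgt h) then x h else 0)"
    if "x \<in> carrier ?D" for x h
    using that cl by (simp add: e_left[OF fin] e_right[OF fin])
  show ?thesis
  proof (intro equalityI subsetI)
    fix a assume "a \<in> ?L" then show "a \<in> ?R"
      using cl by (auto simp: corner_ring_def x split: if_splits simp del: split_paired_All)
  next
    fix a assume a: "a \<in> ?R"
    then have "a = c1_plus G \<otimes>\<^bsub>?D\<^esub> a \<otimes>\<^bsub>?D\<^esub> c1_plus G" by (intro ext) (auto simp: x simp del: split_paired_All)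
    then show "a \<in> ?L" using a by (auto simp: corner_ring_def simp del: split_paired_All)
  qed
qed

end

lemma corner_ring_ring:
  assumes "ring R" "e \<in> carrier R" "e \<otimes>\<^bsub>R\<^esub> e = e"
  shows "ring (corner_ring R e)"
proof -
  interpret ring R by fact
  let ?C = "corner_ring R e"
  have c: "x \<in> carrier ?C \<longleftrightarrow> x \<in> carrier R \<and> e \<otimes>\<^bsub>R\<^esub> x = x \<and> x \<otimes>\<^bsub>R\<^esub> e = x" for x
  proof
    assume "x \<in> carrier ?C"
    then obtain y where y: "y \<in> carrier R" "x = e \<otimes>\<^bsub>R\<^esub> y \<otimes>\<^bsub>R\<^esub> e" by (auto simp: corner_ring_def)
    have "e \<otimes>\<^bsub>R\<^esub> (e \<otimes>\<^bsub>R\<^esub> (y \<otimes>\<^bsub>R\<^esub> e)) = e \<otimes>\<^bsub>R\<^esub> (y \<otimes>\<^bsub>R\<^esub> e)" using y assms by (simp add: m_assoc[symmetric])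
    then show "x \<in> carrier R \<and> e \<otimes>\<^bsub>R\<^esub> x = x \<and> x \<otimes>\<^bsub>R\<^esub> e = x" using y assms by (simp add: m_assoc)
  next
    assume "x \<in> carrier R \<and> e \<otimes>\<^bsub>R\<^esub> x = x \<and> x \<otimes>\<^bsub>R\<^esub> e = x"
    then have "x = e \<otimes>\<^bsub>R\<^esub> x \<otimes>\<^bsub>R\<^esub> e" "x \<in> carrier R" by simp_all
    then show "x \<in> carrier ?C" by (auto simp: corner_ring_def)
  qed
  have ops: "add ?C = add R" "zero ?C = zero R" "monoid.mult ?C = monoid.mult R" "one ?C = e" by (simp_all add: corner_ring_def)
  have ab: "abelian_group ?C"
  proof (rule abelian_groupI)
    fix x assume "x \<in> carrier ?C" then show "\<exists>y\<in>carrier ?C. y \<oplus>\<^bsub>?C\<^esub> x = \<zero>\<^bsub>?C\<^esub>"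
      using assms by (intro bexI[of _ "\<ominus>\<^bsub>R\<^esub> x"]) (simp_all add: c ops l_neg r_minus l_minus)
  qed (use assms in \<open>simp_all add: c ops r_distr l_distr a_assoc\<close>, simp_all add: a_comm)
  have me: "x \<otimes>\<^bsub>R\<^esub> y \<otimes>\<^bsub>R\<^esub> e = x \<otimes>\<^bsub>R\<^esub> y" "e \<otimes>\<^bsub>R\<^esub> (x \<otimes>\<^bsub>R\<^esub> y) = x \<otimes>\<^bsub>R\<^esub> y" if "x \<in> carrier ?C" "y \<in> carrier ?C" for x y
  proof -
    show "x \<otimes>\<^bsub>R\<^esub> y \<otimes>\<^bsub>R\<^esub> e = x \<otimes>\<^bsub>R\<^esub> y" using that assms by (simp add: c m_assoc)
    show "e \<otimes>\<^bsub>R\<^esub> (x \<otimes>\<^bsub>R\<^esub> y) = x \<otimes>\<^bsub>R\<^esub> y" using that assms by (simp add: c m_assoc[symmetric])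
  qed
  have mon: "monoid ?C"
  proof (rule monoidI)
    show "x \<otimes>\<^bsub>?C\<^esub> y \<in> carrier ?C" if "x \<in> carrier ?C" "y \<in> carrier ?C" for x y
      using that me[OF that] by (simp add: c ops)
  qed (use assms in \<open>simp_all add: c ops m_assoc\<close>)
  show ?thesis by (rule ringI[OF ab mon]) (simp_all add: c ops l_distr r_distr)
qed

lemma coind_left_module:
  assumes "ring R" "e \<in> carrier R" "e \<otimes>\<^bsub>R\<^esub> e = e" "left_module (corner_ring R e) Z"
  shows "left_module R (coind_module R e Z)"
proof -
  interpret ring R by fact
  let ?C = "corner_ring R e" let ?B = "corner_bimodule R e" let ?M = "coind_module R e Z"
  note lm = assms(4)[unfolded left_module_def left_module_axioms_def]
  have zg: "abelian_group Z" using lm by blast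
  interpret Z: abelian_group Z by (rule zg)
  have smc: "a \<in> carrier ?C \<Longrightarrow> x \<in> carrier Z \<Longrightarrow> a \<odot>\<^bsub>Z\<^esub> x \<in> carrier Z" for a x using lm by blast
  have smd: "a \<in> carrier ?C \<Longrightarrow> x \<in> carrier Z \<Longrightarrow> y \<in> carrier Z \<Longrightarrow> a \<odot>\<^bsub>Z\<^esub> (x \<oplus>\<^bsub>Z\<^esub> y) = a \<odot>\<^bsub>Z\<^esub> x \<oplus>\<^bsub>Z\<^esub> a \<odot>\<^bsub>Z\<^esub> y" for a x y using lm by blast
  have cB: "x \<in> carrier ?B \<longleftrightarrow> x \<in> carrier R \<and> e \<otimes>\<^bsub>R\<^esub> x = x" for x
  proof
    assume "x \<in> carrier ?B"
    then obtain y where y: "y \<in> carrier R" "x = e \<otimes>\<^bsub>R\<^esub> y" by (auto simp: corner_bimodule_def)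
    have "e \<otimes>\<^bsub>R\<^esub> (e \<otimes>\<^bsub>R\<^esub> y) = e \<otimes>\<^bsub>R\<^esub> y" using y assms by (simp add: m_assoc[symmetric])
    then show "x \<in> carrier R \<and> e \<otimes>\<^bsub>R\<^esub> x = x" using y assms by simp
  next
    assume a: "x \<in> carrier R \<and> e \<otimes>\<^bsub>R\<^esub> x = x"
    then have "x = e \<otimes>\<^bsub>R\<^esub> x" by simp
    then show "x \<in> carrier ?B" using a unfolding corner_bimodule_def by (simp, metis)
  qed
  have cC: "x \<in> carrier R \<and> e \<otimes>\<^bsub>R\<^esub> x = x" if xC: "x \<in> carrier ?C" for x
  proof -
    obtain y where y: "y \<in> carrier R" "x = e \<otimes>\<^bsub>R\<^esub> y \<otimes>\<^bsub>R\<^esub> e" using xC by (auto simp: corner_ring_def)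
    have "e \<otimes>\<^bsub>R\<^esub> (e \<otimes>\<^bsub>R\<^esub> (y \<otimes>\<^bsub>R\<^esub> e)) = e \<otimes>\<^bsub>R\<^esub> (y \<otimes>\<^bsub>R\<^esub> e)" using y assms by (simp add: m_assoc[symmetric])
    then show ?thesis using y assms by (simp add: m_assoc)
  qed
  have opsB: "add ?B = add R" "zero ?B = zero R" "smult ?B = monoid.mult R" by (simp_all add: corner_bimodule_def)
  have cM: "carrier ?M = mod_hom ?C ?B Z" by (simp add: coind_module_def)
  have ad: "\<phi> \<oplus>\<^bsub>?M\<^esub> \<psi> = (\<lambda>x\<in>carrier ?B. \<phi> x \<oplus>\<^bsub>Z\<^esub> \<psi> x)" for \<phi> \<psi> by (simp add: coind_module_def)
  have ze: "\<zero>\<^bsub>?M\<^esub> = (\<lambda>x\<in>carrier ?B. \<zero>\<^bsub>Z\<^esub>)" by (simp add: coind_module_def)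
  have sm: "a \<odot>\<^bsub>?M\<^esub> \<phi> = (\<lambda>x\<in>carrier ?B. \<phi> (x \<otimes>\<^bsub>R\<^esub> a))" for a \<phi> by (simp add: coind_module_def)
  have z0: "a \<odot>\<^bsub>Z\<^esub> \<zero>\<^bsub>Z\<^esub> = \<zero>\<^bsub>Z\<^esub>" if a: "a \<in> carrier ?C" for a
  proof -
    have c: "a \<odot>\<^bsub>Z\<^esub> \<zero>\<^bsub>Z\<^esub> \<in> carrier Z" by (rule smc[OF a Z.zero_closed])
    have "a \<odot>\<^bsub>Z\<^esub> \<zero>\<^bsub>Z\<^esub> = a \<odot>\<^bsub>Z\<^esub> \<zero>\<^bsub>Z\<^esub> \<oplus>\<^bsub>Z\<^esub> a \<odot>\<^bsub>Z\<^esub> \<zero>\<^bsub>Z\<^esub>"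
      using smd[OF a Z.zero_closed Z.zero_closed] by simp
    then show ?thesis using c by simp
  qed
  have zn: "a \<odot>\<^bsub>Z\<^esub> (\<ominus>\<^bsub>Z\<^esub> x) = \<ominus>\<^bsub>Z\<^esub> (a \<odot>\<^bsub>Z\<^esub> x)" if a: "a \<in> carrier ?C" and x: "x \<in> carrier Z" for a x
  proof -
    have "a \<odot>\<^bsub>Z\<^esub> (\<ominus>\<^bsub>Z\<^esub> x) \<oplus>\<^bsub>Z\<^esub> a \<odot>\<^bsub>Z\<^esub> x = \<zero>\<^bsub>Z\<^esub>"
      using smd[OF a Z.a_inv_closed[OF x] x] x z0[OF a] by (simp add: Z.l_neg)
    then show ?thesis using smc[OF a x] smc[OF a Z.a_inv_closed[OF x]]
      by (simp add: Z.minus_equality)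
  qed
  have clB: "x \<oplus>\<^bsub>R\<^esub> y \<in> carrier ?B" if "x \<in> carrier ?B" "y \<in> carrier ?B" for x y
    using that assms by (simp add: cB r_distr)
  have clB2: "x \<otimes>\<^bsub>R\<^esub> y \<in> carrier ?B" if "x \<in> carrier ?B" "y \<in> carrier R" for x y
    using that assms by (simp add: cB m_assoc[symmetric])
  have clB3: "a \<otimes>\<^bsub>R\<^esub> y \<in> carrier ?B" if "a \<in> carrier ?C" "y \<in> carrier ?B" for a y
    using that cC[OF that(1)] assms by (simp add: cB m_assoc[symmetric])
  have BR: "x \<in> carrier R" if "x \<in> carrier ?B" for x using that by (simp add: cB)
  have CR: "x \<in> carrier R" if "x \<in> carrier ?C" for x using cC[OF that] by simp
  have homI: "\<phi> \<in> carrier ?M" if "\<phi> \<in> extensional (carrier ?B)" "\<And>x. x\<in>carrier ?B \<Longrightarrow> \<phi> x \<in> carrier Z"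
    "\<And>x y. x\<in>carrier ?B \<Longrightarrow> y\<in>carrier ?B \<Longrightarrow> \<phi> (x \<oplus>\<^bsub>R\<^esub> y) = \<phi> x \<oplus>\<^bsub>Z\<^esub> \<phi> y"
    "\<And>a x. a\<in>carrier ?C \<Longrightarrow> x\<in>carrier ?B \<Longrightarrow> \<phi> (a \<otimes>\<^bsub>R\<^esub> x) = a \<odot>\<^bsub>Z\<^esub> \<phi> x" for \<phi>
    using that by (simp add: cM mod_hom_def PiE_def Pi_def opsB)
  have homD: "\<phi> \<in> extensional (carrier ?B)" "x\<in>carrier ?B \<Longrightarrow> \<phi> x \<in> carrier Z"
    "x\<in>carrier ?B \<Longrightarrow> y\<in>carrier ?B \<Longrightarrow> \<phi> (x \<oplus>\<^bsub>R\<^esub> y) = \<phi> x \<oplus>\<^bsub>Z\<^esub> \<phi> y"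
    "a\<in>carrier ?C \<Longrightarrow> x\<in>carrier ?B \<Longrightarrow> \<phi> (a \<otimes>\<^bsub>R\<^esub> x) = a \<odot>\<^bsub>Z\<^esub> \<phi> x" if "\<phi> \<in> carrier ?M" for \<phi> x y a
    using that by (auto simp: cM mod_hom_def PiE_def Pi_def opsB)
  have ab: "abelian_group ?M"
  proof (rule abelian_groupI)
    fix \<phi> assume p: "\<phi> \<in> carrier ?M"
    note h = homD[OF p]
    show "\<exists>y\<in>carrier ?M. y \<oplus>\<^bsub>?M\<^esub> \<phi> = \<zero>\<^bsub>?M\<^esub>"
    proof (intro bexI[of _ "\<lambda>x\<in>carrier ?B. \<ominus>\<^bsub>Z\<^esub> \<phi> x"])
      show "(\<lambda>x\<in>carrier ?B. \<ominus>\<^bsub>Z\<^esub> \<phi> x) \<in> carrier ?M"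
        by (rule homI) (simp_all add: h clB clB3 Z.minus_add zn)
      show "(\<lambda>x\<in>carrier ?B. \<ominus>\<^bsub>Z\<^esub> \<phi> x) \<oplus>\<^bsub>?M\<^esub> \<phi> = \<zero>\<^bsub>?M\<^esub>"
        unfolding ad ze by (intro restrict_ext) (simp add: h Z.l_neg)
    qed
    show "\<zero>\<^bsub>?M\<^esub> \<oplus>\<^bsub>?M\<^esub> \<phi> = \<phi>"
      unfolding ad ze by (intro extensionalityI[OF _ h(1)]) (simp_all add: h)
    fix \<psi> assume q: "\<psi> \<in> carrier ?M"
    note k = homD[OF q]
    show "\<phi> \<oplus>\<^bsub>?M\<^esub> \<psi> \<in> carrier ?M" unfolding ad
      by (rule homI) (simp_all add: h k clB clB3 smd Z.a_ac)
    show "\<phi> \<oplus>\<^bsub>?M\<^esub> \<psi> = \<psi> \<oplus>\<^bsub>?M\<^esub> \<phi>" unfolding ad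
      by (intro restrict_ext) (simp add: h k Z.a_ac)
    fix \<chi> assume r: "\<chi> \<in> carrier ?M"
    note l = homD[OF r]
    show "\<phi> \<oplus>\<^bsub>?M\<^esub> \<psi> \<oplus>\<^bsub>?M\<^esub> \<chi> = \<phi> \<oplus>\<^bsub>?M\<^esub> (\<psi> \<oplus>\<^bsub>?M\<^esub> \<chi>)" unfolding ad
      by (intro restrict_ext) (simp add: h k l Z.a_ac)
  next
    show "\<zero>\<^bsub>?M\<^esub> \<in> carrier ?M" unfolding ze by (rule homI) (simp_all add: clB clB3 z0)
  qed
  show ?thesis
    unfolding left_module_def left_module_axioms_def
  proof (intro conjI allI impI ab)
    show "ring R" by fact
    fix a \<phi> assume a: "a \<in> carrier R" and p: "\<phi> \<in> carrier ?M"
    show "a \<odot>\<^bsub>?M\<^esub> \<phi> \<in> carrier ?M" unfolding sm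
      by (rule homI) (simp_all add: a homD[OF p] clB clB2 clB3 l_distr m_assoc BR CR)
  next
    fix a b \<phi> assume a: "a \<in> carrier R" "b \<in> carrier R" and p: "\<phi> \<in> carrier ?M"
    show "(a \<oplus>\<^bsub>R\<^esub> b) \<odot>\<^bsub>?M\<^esub> \<phi> = a \<odot>\<^bsub>?M\<^esub> \<phi> \<oplus>\<^bsub>?M\<^esub> b \<odot>\<^bsub>?M\<^esub> \<phi>"
      unfolding sm ad by (intro restrict_ext) (simp add: a homD[OF p] r_distr BR clB2)
    show "(a \<otimes>\<^bsub>R\<^esub> b) \<odot>\<^bsub>?M\<^esub> \<phi> = a \<odot>\<^bsub>?M\<^esub> (b \<odot>\<^bsub>?M\<^esub> \<phi>)"
      unfolding sm by (intro restrict_ext) (simp add: a m_assoc BR clB2)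
  next
    fix a \<phi> \<psi> assume a: "a \<in> carrier R" and p: "\<phi> \<in> carrier ?M" "\<psi> \<in> carrier ?M"
    show "a \<odot>\<^bsub>?M\<^esub> (\<phi> \<oplus>\<^bsub>?M\<^esub> \<psi>) = a \<odot>\<^bsub>?M\<^esub> \<phi> \<oplus>\<^bsub>?M\<^esub> a \<odot>\<^bsub>?M\<^esub> \<psi>"
      unfolding sm ad by (intro restrict_ext) (simp add: a clB2)
  next
    fix \<phi> assume p: "\<phi> \<in> carrier ?M"
    show "\<one>\<^bsub>R\<^esub> \<odot>\<^bsub>?M\<^esub> \<phi> = \<phi>"
      unfolding sm by (intro extensionalityI[OF _ homD(1)[OF p]]) (simp_all add: BR)
  qed
qed

context group begin

lemma trivial_left_module:
  assumes fin: "finite (carrier G)"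
  shows "left_module (corner_ring (destriction_algebra G) (c1_plus G)) (trivial_module G)"
proof -
  let ?D = "destriction_algebra G" let ?P = "corner_ring ?D (c1_plus G)" let ?M = "trivial_module G"
  interpret P: ring ?P by (intro corner_ring_ring destriction_algebra_ring c1_plus_closed c1_plus_idem fin)
  have opsP: "add ?P = add ?D" "zero ?P = zero ?D" "monoid.mult ?P = monoid.mult ?D" "one ?P = c1_plus G" by (simp_all add: corner_ring_def)
  have ab: "abelian_group ?M"
  proof (rule abelian_groupI)
    fix a assume "a \<in> carrier ?M"
    then show "\<exists>y\<in>carrier ?M. y \<oplus>\<^bsub>?M\<^esub> a = \<zero>\<^bsub>?M\<^esub>"
      by (intro bexI[of _ "\<lambda>h. - a h"]) (auto simp: trivial_module_def)
  qed (auto simp: trivial_module_def)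
  let ?F = "\<lambda>z k. if diag (tgt k) then z (fst (tgt k)) else 0"
  have sm: "(a \<odot>\<^bsub>?M\<^esub> z) H = (\<Sum>f\<in>mors G. if src f = (H,H) then a f * ?F z f else 0)" for a z H
  proof -
    have "(a \<odot>\<^bsub>?M\<^esub> z) H = (\<Sum>(f, K) | f \<in> mors G \<and> src f = (H, H) \<and> tgt f = (K, K). a f * z K)"
      by (simp add: trivial_module_def)
    also have "\<dots> = (\<Sum>f | f \<in> mors G \<and> src f = (H, H) \<and> diag (tgt f). a f * z (fst (tgt f)))"
      by (rule sum.reindex_bij_witness[of _ "\<lambda>f. (f, fst (tgt f))" fst]) (auto simp: diag_def prod_eq_iff)
    also have "\<dots> = (\<Sum>f\<in>mors G. if src f = (H,H) then a f * ?F z f else 0)"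
      by (subst sum_filter[OF fin]) (auto intro!: sum.cong)
    finally show ?thesis .
  qed
  have ad: "(m \<oplus>\<^bsub>?M\<^esub> n) s = m s + n s" for m n s by (simp add: trivial_module_def)
  have adD: "(m \<oplus>\<^bsub>?D\<^esub> n) s = m s + n s" for m n s by (simp add: destriction_algebra_def)
  have cM: "m \<in> carrier ?M \<longleftrightarrow> (\<forall>s. \<not> subgroup s G \<longrightarrow> m s = 0)" for m by (simp add: trivial_module_def)
  show ?thesis
    unfolding left_module_def left_module_axioms_def
  proof (intro conjI allI impI ab)
    show "ring ?P" by unfold_locales
    fix a m assume "a \<in> carrier ?P" "m \<in> carrier ?M"
    show "a \<odot>\<^bsub>?M\<^esub> m \<in> carrier ?M" unfolding cM sm using mor_src diag_sectionD
      by (auto intro!: sum.neutral simp del: split_paired_All)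
  next
    fix a b m assume a: "a \<in> carrier ?P" "b \<in> carrier ?P" "m \<in> carrier ?M"
    show "(a \<oplus>\<^bsub>?P\<^esub> b) \<odot>\<^bsub>?M\<^esub> m = a \<odot>\<^bsub>?M\<^esub> m \<oplus>\<^bsub>?M\<^esub> b \<odot>\<^bsub>?M\<^esub> m"
      by (rule ext, simp only: sm ad opsP adD sum.distrib[symmetric], intro sum.cong refl) (simp add: distrib_right)
    show "(a \<otimes>\<^bsub>?P\<^esub> b) \<odot>\<^bsub>?M\<^esub> m = a \<odot>\<^bsub>?M\<^esub> (b \<odot>\<^bsub>?M\<^esub> m)"
    proof
      fix H
      have "((a \<otimes>\<^bsub>?P\<^esub> b) \<odot>\<^bsub>?M\<^esub> m) H = (\<Sum>f\<in>mors G. if src f = (H,H) then a f * (\<Sum>f'\<in>mors G. if src f' = tgt f then b f' * ?F m (mor_comp G f' f) else 0) else 0)"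
        unfolding sm opsP by (rule act_assoc[OF fin])
      also have "\<dots> = (a \<odot>\<^bsub>?M\<^esub> (b \<odot>\<^bsub>?M\<^esub> m)) H"
      proof (subst sm, intro sum.cong refl, goal_cases)
        case (1 f)
        show ?case
        proof (cases "diag (tgt f)")
          case True
          then have "tgt f = (fst (tgt f), fst (tgt f))" by (simp add: diag_def prod_eq_iff)
          then show ?thesis using True by (simp add: sm cong: if_cong)
        next
          case False
          then show ?thesis using a(1) by (auto simp: Pi_carrier[OF fin] simp del: split_paired_All)
        qed
      qed
      finally show "((a \<otimes>\<^bsub>?P\<^esub> b) \<odot>\<^bsub>?M\<^esub> m) H = (a \<odot>\<^bsub>?M\<^esub> (b \<odot>\<^bsub>?M\<^esub> m)) H" .
    qed
  next
    fix a m n assume "a \<in> carrier ?P" "n \<in> carrier ?M" "m \<in> carrier ?M"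
    show "a \<odot>\<^bsub>?M\<^esub> (m \<oplus>\<^bsub>?M\<^esub> n) = a \<odot>\<^bsub>?M\<^esub> m \<oplus>\<^bsub>?M\<^esub> a \<odot>\<^bsub>?M\<^esub> n"
      by (rule ext, simp only: sm ad sum.distrib[symmetric], intro sum.cong refl) (simp add: distrib_left)
  next
    fix m assume m: "m \<in> carrier ?M"
    show "\<one>\<^bsub>?P\<^esub> \<odot>\<^bsub>?M\<^esub> m = m"
    proof
      fix H show "(\<one>\<^bsub>?P\<^esub> \<odot>\<^bsub>?M\<^esub> m) H = m H"
      proof (cases "subgroup H G")
        case True
        have "(\<one>\<^bsub>?P\<^esub> \<odot>\<^bsub>?M\<^esub> m) H = (\<Sum>k\<in>mors G. if src k = (H,H) then one ?D k * ?F m k else 0)"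
          by (subst sm, intro sum.cong refl) (use True in \<open>simp add: opsP(4) c1_id(1)[OF fin] diag_def\<close>)
        also have "\<dots> = m H" by (subst act_one[OF fin diag_sectionI[OF True]]) (simp add: mor_id_def diag_def)
        finally show ?thesis .
      next
        case False then show ?thesis using m mor_src diag_sectionD by (auto simp: cM sm intro!: sum.neutral simp del: split_paired_All)
      qed
    qed
  qed
qed

end

context group begin

lemma rcosets_eq_coset_set: "rcosets\<^bsub>G\<lparr>carrier := X\<rparr>\<^esub> V = coset_set G X V"
  by (auto simp: RCOSETS_def coset_set_def)

lemma secI:
  assumes "subgroup U G" "subgroup V G" "V \<subseteq> U" "\<And>u v. u \<in> U \<Longrightarrow> v \<in> V \<Longrightarrow> u \<otimes> v \<otimes> inv u \<in> V"
  shows "(U,V) \<in> sections G"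
proof -
  interpret H: group "G\<lparr>carrier := U\<rparr>" using assms(1) by (rule subgroup_imp_group)
  have "subgroup V (G\<lparr>carrier := U\<rparr>)" using assms subgroup_incl by blast
  then have "V \<lhd> G\<lparr>carrier := U\<rparr>"
    using assms by (subst H.normal_inv_iff) (simp add: m_inv_consistent)
  then show ?thesis using assms by (simp add: sections_def)
qed

lemma conj_sec_closed:
  assumes "s \<in> sections G" "g \<in> carrier G" shows "conj_sec G g s \<in> sections G"
proof -
  obtain U V where s: "s = (U,V)" by (cases s)
  note d = sectionsD[OF assms(1)[unfolded s]]
  show ?thesis unfolding s conj_sec_def fst_conv snd_conv
  proof (rule secI)
    fix u v assume "u \<in> conj_set G g U" "v \<in> conj_set G g V"
    then obtain x y where x: "x \<in> U" "u = g \<otimes> x \<otimes> inv g" and y: "y \<in> V" "v = g \<otimes> y \<otimes> inv g"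
      by (auto simp: conj_set_def)
    have xc: "x \<in> carrier G" "y \<in> carrier G" using x y d by auto
    have "conj_set G u (conj_set G g {y}) = conj_set G g (conj_set G x {y})"
      using xc assms by (subst (1 2) conj_set_comp) (auto simp: x m_assoc)
    then have "u \<otimes> v \<otimes> inv u = g \<otimes> (x \<otimes> y \<otimes> inv x) \<otimes> inv g" by (simp add: conj_set_def y)
    moreover have "x \<otimes> y \<otimes> inv x \<in> V" using d(7)[OF x(1)] y by (auto simp: conj_set_def)
    ultimately show "u \<otimes> v \<otimes> inv u \<in> conj_set G g V" by (auto simp: conj_set_def)
  qed (use d assms in \<open>simp_all add: conj_set_subgroup conj_set_mono\<close>)
qed

context
  fixes U V assumes UV: "(U,V) \<in> sections G"
begin

lemma quot_hom: "group_hom (G\<lparr>carrier := U\<rparr>) (sec_quot G (U,V)) (\<lambda>x. V #> x)"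
proof -
  note d = sectionsD[OF UV]
  interpret n: normal V "G\<lparr>carrier := U\<rparr>" by (rule d)
  show ?thesis
    unfolding group_hom_def group_hom_axioms_def sec_quot_def fst_conv snd_conv
    using n.r_coset_hom_Mod n.factorgroup_is_group n.is_group by simp
qed

lemma quot_carrier: "carrier (sec_quot G (U,V)) = coset_set G U V"
  by (auto simp: sec_quot_def FactGroup_def RCOSETS_def coset_set_def)

lemma quot_subD:
  assumes W: "subgroup W (sec_quot G (U,V))"
  shows "subgroup (\<Union>W) G" "V \<subseteq> \<Union>W" "\<Union>W \<subseteq> U" "W = coset_set G (\<Union>W) V"
proof -
  note d = sectionsD[OF UV]
  interpret n: normal V "G\<lparr>carrier := U\<rparr>" by (rule d)
  have W': "subgroup W (G\<lparr>carrier := U\<rparr> Mod V)" using W by (simp add: sec_quot_def)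
  have s: "subgroup (\<Union>W) (G\<lparr>carrier := U\<rparr>)" by (rule n.factgroup_subgroup_union_subgroup[OF W'])
  then show "subgroup (\<Union>W) G" using d incl_subgroup by blast
  show "\<Union>W \<subseteq> U" using subgroup.subset[OF s] by simp
  show "V \<subseteq> \<Union>W" using subgroup.one_closed[OF W'] by auto
  have "W = rcosets\<^bsub>G\<lparr>carrier := U, carrier := \<Union>W\<rparr>\<^esub> V" by (rule n.factgroup_subgroup_union_factor[OF W'])
  then show "W = coset_set G (\<Union>W) V" by (simp add: RCOSETS_def coset_set_def UNION_singleton_eq_range)
qed

lemma quot_subI:
  assumes X: "subgroup X G" "V \<subseteq> X" "X \<subseteq> U"
  shows "subgroup (coset_set G X V) (sec_quot G (U,V))" "\<Union>(coset_set G X V) = X"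
proof -
  note d = sectionsD[OF UV]
  interpret h: group_hom "G\<lparr>carrier := U\<rparr>" "sec_quot G (U,V)" "\<lambda>x. V #> x" by (rule quot_hom)
  have "subgroup X (G\<lparr>carrier := U\<rparr>)" using X d subgroup_incl by blast
  then show "subgroup (coset_set G X V) (sec_quot G (U,V))" unfolding coset_set_def by (rule h.subgroup_img_is_subgroup)
  show "\<Union>(coset_set G X V) = X"
  proof
    show "\<Union>(coset_set G X V) \<subseteq> X" using X by (auto simp: coset_set_def r_coset_def subgroup.m_closed subset_iff)
    show "X \<subseteq> \<Union>(coset_set G X V)" using rcos_self[OF _ d(2)] subgroup.subset[OF X(1)] by (force simp: coset_set_def)
  qed
qed

lemma quot_conj:
  assumes X: "X \<subseteq> U" "u \<in> U"
  shows "conj_set (sec_quot G (U,V)) (V #> u) (coset_set G X V) = coset_set G (conj_set G u X) V"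
proof -
  note d = sectionsD[OF UV]
  interpret h: group_hom "G\<lparr>carrier := U\<rparr>" "sec_quot G (U,V)" "\<lambda>x. V #> x" by (rule quot_hom)
  have "V #> (u \<otimes> x \<otimes> inv u) = (V #> u) \<otimes>\<^bsub>sec_quot G (U,V)\<^esub> (V #> x) \<otimes>\<^bsub>sec_quot G (U,V)\<^esub> inv\<^bsub>sec_quot G (U,V)\<^esub> (V #> u)" if "x \<in> X" for x
  proof -
    have "x \<in> U" using that X by auto
    then have "V #> (u \<otimes> x \<otimes> inv u) = (V #> u) \<otimes>\<^bsub>sec_quot G (U,V)\<^esub> (V #> x) \<otimes>\<^bsub>sec_quot G (U,V)\<^esub> (V #> inv u)"
      using h.hom_mult[of "u \<otimes> x" "inv u"] h.hom_mult[of u x] X d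
      by (simp add: subgroup.m_closed subgroup.m_inv_closed)
    moreover have "V #> inv u = inv\<^bsub>sec_quot G (U,V)\<^esub> (V #> u)" using h.hom_inv[of u] X m_inv_consistent[OF d(1)] by simp
    ultimately show ?thesis by simp
  qed
  then show ?thesis by (force simp: conj_set_def coset_set_def image_image)
qed

lemma SC_conj:
  assumes "\<beta> \<in> superclass_functions (sec_quot G (U,V))" "subgroup X G" "V \<subseteq> X" "X \<subseteq> U" "u \<in> U"
  shows "\<beta> (coset_set G (conj_set G u X) V) = \<beta> (coset_set G X V)"
proof -
  have "V #> u \<in> carrier (sec_quot G (U,V))" using assms by (auto simp: quot_carrier coset_set_def)
  moreover have "\<beta> (conj_set (sec_quot G (U,V)) x Y) = \<beta> Y"
    if "subgroup Y (sec_quot G (U,V))" "x \<in> carrier (sec_quot G (U,V))" for x Y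
    using assms(1) that unfolding superclass_functions_def by blast
  ultimately show ?thesis
    using quot_subI(1)[OF assms(2-4)] by (simp add: quot_conj[OF assms(4,5), symmetric])
qed

end

lemma conj_coset_set:
  assumes "V \<subseteq> carrier G" "X \<subseteq> carrier G" "g \<in> carrier G"
  shows "conj_set G g ` (coset_set G X V) = coset_set G (conj_set G g X) (conj_set G g V)"
proof -
  have e: "g \<otimes> (v \<otimes> x) \<otimes> inv g = (g \<otimes> v \<otimes> inv g) \<otimes> (g \<otimes> x \<otimes> inv g)" if "v \<in> V" "x \<in> X" for v x
  proof -
    have c: "v \<in> carrier G" "x \<in> carrier G" using that assms by auto
    have "(g \<otimes> v \<otimes> inv g) \<otimes> (g \<otimes> x \<otimes> inv g) = g \<otimes> v \<otimes> (inv g \<otimes> (g \<otimes> (x \<otimes> inv g)))"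
      using c assms by (simp add: m_assoc)
    also have "\<dots> = g \<otimes> (v \<otimes> x) \<otimes> inv g" using c assms by (simp add: m_assoc[symmetric])
    finally show ?thesis by simp
  qed
  have "conj_set G g (V #> x) = conj_set G g V #> (g \<otimes> x \<otimes> inv g)" if "x \<in> X" for x
    using e[OF _ that] by (force simp: conj_set_def r_coset_def)
  then show ?thesis by (auto simp: coset_set_def conj_set_def[of G g X] image_image cong: image_cong)
qed

lemma act_eq:
  assumes f: "f \<in> mors G" "f = ((U,V),(M,L),C)" and g: "g \<in> C"
    and b: "\<beta> \<in> superclass_functions (sec_quot G (M,L))"
    and X: "subgroup X G" "V \<subseteq> X" "X \<subseteq> U"
  shows "superclass_act G f \<beta> (coset_set G X V) = \<beta> (coset_set G (conj_set G g X) L)"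
proof -
  obtain g1 where f': "C = M #> g1" "(U,V) \<in> sections G" "(M,L) \<in> sections G"
    "g1 \<in> carrier G" "L \<subseteq> conj_set G g1 V" "conj_set G g1 V \<subseteq> conj_set G g1 U" "conj_set G g1 U \<subseteq> M"
    using f by (elim morsE) auto
  note d = sectionsD[OF f'(2)] and e = sectionsD[OF f'(3)]
  define g0 where "g0 = (SOME g. g \<in> C)"
  have g0: "g0 \<in> C" unfolding g0_def using g by (rule someI)
  have rep: "\<exists>m\<in>M. h = m \<otimes> g1" if "h \<in> C" for h using that f' by (auto simp: r_coset_def)
  obtain m0 where m0: "m0 \<in> M" "g0 = m0 \<otimes> g1" using rep[OF g0] by auto
  obtain m where m: "m \<in> M" "g = m \<otimes> g1" using rep[OF g] by auto
  have c: "m \<in> carrier G" "m0 \<in> carrier G" "g0 \<in> carrier G" "X \<subseteq> carrier G" using m m0 e f' X d by auto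
  have g0U: "conj_set G g0 U \<subseteq> M"
    using conj_set_mono[OF f'(7), of m0] conj_set_self[OF e(1) m0(1)] c f' d by (simp add: m0 conj_set_comp)
  have g0V: "L \<subseteq> conj_set G g0 V"
    using conj_set_mono[OF f'(5), of m0] e(7)[OF m0(1)] c f' d by (simp add: m0 conj_set_comp)
  let ?s = "(conj_set G g0 U, conj_set G g0 V)"
  have s: "?s \<in> sections G" using conj_sec_closed[OF f'(2) c(3)] by (simp add: conj_sec_def)
  note ds = sectionsD[OF s]
  have sL: "(conj_set G g0 U, L) \<in> sections G"
  proof (rule secI)
    fix u v assume "u \<in> conj_set G g0 U" "v \<in> L"
    then show "u \<otimes> v \<otimes> inv u \<in> L" using e(7)[of u] g0U by (auto simp: conj_set_def)
  qed (use ds e g0V in auto)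
  let ?Y = "conj_set G g0 X"
  have Y: "subgroup ?Y G" "conj_set G g0 V \<subseteq> ?Y" "?Y \<subseteq> conj_set G g0 U"
    using X c by (auto intro: conj_set_subgroup) (auto simp: conj_set_def)
  have 1: "subgroup (coset_set G X V) (sec_quot G (U,V))" by (rule quot_subI[OF f'(2) X])
  have 2: "conj_set G g0 ` coset_set G X V = coset_set G ?Y (conj_set G g0 V)" by (rule conj_coset_set) (use d c in auto)
  have 3: "subgroup (coset_set G ?Y (conj_set G g0 V)) (sec_quot G ?s)" "\<Union>(coset_set G ?Y (conj_set G g0 V)) = ?Y"
    by (rule quot_subI[OF s Y])+
  have 4: "subgroup (coset_set G ?Y L) (sec_quot G (conj_set G g0 U, L))" 
    by (rule quot_subI[OF sL Y(1) _ Y(3)]) (use Y g0V in auto)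
  have "superclass_act G f \<beta> (coset_set G X V) = \<beta> (coset_set G ?Y L)"
    using f by (simp add: superclass_act_def Let_def g0_def[symmetric] conj_sc_def 1 2 des_sc_def def_sc_def conj_sec_def 3 rcosets_eq_coset_set res_sc_def 4)
  also have "\<dots> = \<beta> (coset_set G (conj_set G (m \<otimes> inv m0) ?Y) L)"
  proof (rule SC_conj[OF f'(3) b Y(1), symmetric])
    show "L \<subseteq> ?Y" "?Y \<subseteq> M" using Y g0V g0U by blast+
    show "m \<otimes> inv m0 \<in> M" using m m0 e(1) by (simp add: subgroup.m_closed subgroup.m_inv_closed)
  qed
  also have "conj_set G (m \<otimes> inv m0) ?Y = conj_set G g X"
  proof -
    have "m \<otimes> inv m0 \<otimes> g0 = g" using c f' by (simp add: m m0 m_assoc) (simp add: m_assoc[symmetric])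
    then show ?thesis using c by (simp add: conj_set_comp)
  qed
  finally show ?thesis .
qed

lemma act_zero: "\<not> subgroup W (sec_quot G (src f)) \<Longrightarrow> superclass_act G f \<beta> W = 0"
  by (simp add: superclass_act_def Let_def conj_sc_def)

lemma if3: "\<exists>b Y. \<forall>\<beta>. (if P then (if Q then (if R then \<beta> Z else 0) else 0) else (0::int)) = (if b then \<beta> Y else 0)"
  by (rule exI[of _ "P \<and> Q \<and> R"], rule exI[of _ Z]) simp

lemma act_eval: "\<exists>b Y. \<forall>\<beta>. superclass_act G f \<beta> W = (if b then \<beta> Y else 0)"
  unfolding superclass_act_def Let_def conj_sc_def des_sc_def def_sc_def res_sc_def
  by (rule if3)

lemma act_closed:
  assumes f: "f \<in> mors G" and b: "\<beta> \<in> superclass_functions (sec_quot G (tgt f))"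
  shows "superclass_act G f \<beta> \<in> superclass_functions (sec_quot G (src f))"
proof -
  obtain U V M L g where f': "f = ((U,V),(M,L), M #> g)" "(U,V) \<in> sections G" "(M,L) \<in> sections G"
    "g \<in> carrier G" "L \<subseteq> conj_set G g V" "conj_set G g V \<subseteq> conj_set G g U" "conj_set G g U \<subseteq> M"
    using f morsE by metis
  note d = sectionsD[OF f'(2)] and e = sectionsD[OF f'(3)]
  have b': "\<beta> \<in> superclass_functions (sec_quot G (M,L))" using b f' by simp
  have gC: "g \<in> M #> g" using rcos_self[OF f'(4) e(1)] .
  have "superclass_act G f \<beta> (conj_set (sec_quot G (U,V)) x W) = superclass_act G f \<beta> W"
    if W: "subgroup W (sec_quot G (U,V))" and x: "x \<in> carrier (sec_quot G (U,V))" for W x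
  proof -
    note w = quot_subD[OF f'(2) W]
    obtain u where u: "u \<in> U" "x = V #> u" using x by (auto simp: quot_carrier[OF f'(2)] coset_set_def)
    have uc: "u \<in> carrier G" "\<Union>W \<subseteq> carrier G" using u d w by auto
    let ?X = "\<Union>W" let ?Z = "conj_set G u ?X" let ?h = "g \<otimes> u \<otimes> inv g"
    have Z: "subgroup ?Z G" "V \<subseteq> ?Z" "?Z \<subseteq> U"
      using conj_set_subgroup[OF w(1) uc(1)] conj_set_mono[OF w(2), of u] conj_set_mono[OF w(3), of u]
        conj_set_self[OF d(1) u(1)] d(7)[OF u(1)] by auto
    have "conj_set (sec_quot G (U,V)) x W = coset_set G ?Z V"
      by (subst w(4)) (simp only: u quot_conj[OF f'(2) w(3) u(1)])
    then have "superclass_act G f \<beta> (conj_set (sec_quot G (U,V)) x W) = \<beta> (coset_set G (conj_set G g ?Z) L)"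
      using act_eq[OF f f'(1) gC b' Z] by simp
    also have "conj_set G g ?Z = conj_set G ?h (conj_set G g ?X)"
      using f' uc by (simp add: conj_set_comp m_assoc)
    also have "\<beta> (coset_set G (conj_set G ?h (conj_set G g ?X)) L) = \<beta> (coset_set G (conj_set G g ?X) L)"
    proof (rule SC_conj[OF f'(3) b'])
      show "subgroup (conj_set G g ?X) G" using conj_set_subgroup[OF w(1)] f' by simp
      show "L \<subseteq> conj_set G g ?X" using conj_set_mono[OF w(2), of g] f' by auto
      show "conj_set G g ?X \<subseteq> M" using conj_set_mono[OF w(3), of g] f' by auto
      show "?h \<in> M" using f' u by (auto simp: conj_set_def)
    qed
    also have "\<dots> = superclass_act G f \<beta> (coset_set G ?X V)" using act_eq[OF f f'(1) gC b' w(1-3)] by simp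
    also have "\<dots> = superclass_act G f \<beta> W" using w(4) by simp
    finally show ?thesis .
  qed
  then show ?thesis using f' unfolding superclass_functions_def by (simp add: act_zero)
qed

lemma act_functor:
  assumes f: "f \<in> mors G" "f' \<in> mors G" "src f' = tgt f"
    and b: "\<beta> \<in> superclass_functions (sec_quot G (tgt f'))"
  shows "superclass_act G (mor_comp G f' f) \<beta> = superclass_act G f (superclass_act G f' \<beta>)"
proof
  fix W
  obtain U V M L g where f1: "f = ((U,V),(M,L), M #> g)" "(U,V) \<in> sections G" "(M,L) \<in> sections G"
    "g \<in> carrier G" "L \<subseteq> conj_set G g V" "conj_set G g V \<subseteq> conj_set G g U" "conj_set G g U \<subseteq> M"
    using f morsE by metis
  obtain N K h where f2: "f' = ((M,L),(N,K), N #> h)" "(N,K) \<in> sections G"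
    "h \<in> carrier G" "K \<subseteq> conj_set G h L" "conj_set G h L \<subseteq> conj_set G h M" "conj_set G h M \<subseteq> N"
    using f f1 by (elim morsE[of f']) auto
  note d = sectionsD[OF f1(2)] and e = sectionsD[OF f1(3)] and k = sectionsD[OF f2(2)]
  have comp: "mor_comp G f' f \<in> mors G" using f by (simp add: mor_comp_closed)
  have ce: "mor_comp G f' f = ((U,V),(N,K), N #> (h \<otimes> g))"
    using mor_comp_cosets[OF e(1) k(1) f1(4) f2(3,6)] f1 f2 by (simp add: mor_comp_def)
  show "superclass_act G (mor_comp G f' f) \<beta> W = superclass_act G f (superclass_act G f' \<beta>) W"
  proof (cases "subgroup W (sec_quot G (U,V))")
    case True
    note w = quot_subD[OF f1(2) True]
    have b': "\<beta> \<in> superclass_functions (sec_quot G (N,K))" using b f2 by simp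
    have b2: "superclass_act G f' \<beta> \<in> superclass_functions (sec_quot G (M,L))" using act_closed[OF f(2) b] f2 by simp
    let ?X = "\<Union>W"
    have Y: "subgroup (conj_set G g ?X) G" "L \<subseteq> conj_set G g ?X" "conj_set G g ?X \<subseteq> M"
      using conj_set_subgroup[OF w(1) f1(4)] conj_set_mono[OF w(2), of g] conj_set_mono[OF w(3), of g] f1 by auto
    have "superclass_act G (mor_comp G f' f) \<beta> (coset_set G ?X V) = \<beta> (coset_set G (conj_set G (h \<otimes> g) ?X) K)"
      by (rule act_eq[OF comp ce _ b' w(1-3)]) (use rcos_self k f1 f2 in simp)
    also have "\<dots> = \<beta> (coset_set G (conj_set G h (conj_set G g ?X)) K)"
      using w d f1 f2 by (subst conj_set_comp) auto
    also have "\<dots> = superclass_act G f' \<beta> (coset_set G (conj_set G g ?X) L)"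
      by (rule act_eq[OF f(2) f2(1) _ b' Y, symmetric]) (use rcos_self k f2 in simp)
    also have "\<dots> = superclass_act G f (superclass_act G f' \<beta>) (coset_set G ?X V)"
      by (rule act_eq[OF f(1) f1(1) _ b2 w(1-3), symmetric]) (use rcos_self e f1 in simp)
    finally show ?thesis using w(4) by simp
  next
    case False
    then show ?thesis using f1 by (simp add: act_zero)
  qed
qed

lemma act_id:
  assumes s: "s \<in> sections G" and b: "\<beta> \<in> superclass_functions (sec_quot G s)"
  shows "superclass_act G (mor_id s) \<beta> = \<beta>"
proof
  fix W
  obtain U V where UV: "s = (U,V)" by (cases s)
  note d = sectionsD[OF s[unfolded UV]]
  show "superclass_act G (mor_id s) \<beta> W = \<beta> W"
  proof (cases "subgroup W (sec_quot G (U,V))")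
    case True
    note w = quot_subD[OF s[unfolded UV] True]
    have "superclass_act G (mor_id s) \<beta> (coset_set G (\<Union>W) V) = \<beta> (coset_set G (conj_set G \<one> (\<Union>W)) V)"
      by (rule act_eq[OF mor_id_closed[OF s] _ _ _ w(1-3)]) (use b UV d subgroup.one_closed in \<open>auto simp: mor_id_def\<close>)
    then show ?thesis using w d by (simp add: conj_set_one)
  next
    case False
    then show ?thesis using b UV by (simp add: act_zero mor_id_def superclass_functions_def)
  qed
qed

lemma superclass_left_module:
  assumes fin: "finite (carrier G)"
  shows "left_module (destriction_algebra G) (superclass_module G)"
proof -
  let ?M = "superclass_module G" and ?D = "destriction_algebra G"
  let ?S = "\<lambda>s. superclass_functions (sec_quot G s)"
  have sm: "(a \<odot>\<^bsub>?M\<^esub> m) s W = (\<Sum>f\<in>mors G. if src f = s then a f * superclass_act G f (m (tgt f)) W else 0)" for a m s W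
    by (simp add: superclass_module_def sum_filter[OF fin])
  have ad: "(m \<oplus>\<^bsub>?M\<^esub> n) s W = m s W + n s W" for m n s W by (simp add: superclass_module_def)
  have adD: "(m \<oplus>\<^bsub>?D\<^esub> n) s = m s + n s" for m n s by (simp add: destriction_algebra_def)
  have cM: "m \<in> carrier ?M \<longleftrightarrow> (\<forall>s. (s \<in> sections G \<longrightarrow> m s \<in> ?S s) \<and> (s \<notin> sections G \<longrightarrow> m s = (\<lambda>W. 0)))" for m
    by (simp add: superclass_module_def)
  have ev_add: "superclass_act G f (\<lambda>W. \<beta> W + \<gamma> W) W = superclass_act G f \<beta> W + superclass_act G f \<gamma> W" for f \<beta> \<gamma> W
  proof -
    obtain b Y where "\<And>\<beta>. superclass_act G f \<beta> W = (if b then \<beta> Y else 0)" using act_eval[of f W] by auto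
    then show ?thesis by simp
  qed
  have ev_sum: "superclass_act G f (\<lambda>W. \<Sum>i\<in>I. if P i then c i * \<beta> i W else 0) W = (\<Sum>i\<in>I. if P i then c i * superclass_act G f (\<beta> i) W else 0)"
    for f W and I :: "'a mor set" and P c \<beta>
  proof -
    obtain b Y where "\<And>\<beta>. superclass_act G f \<beta> W = (if b then \<beta> Y else 0)" using act_eval[of f W] by auto
    then show ?thesis by (simp cong: if_cong)
  qed
  have ab: "abelian_group ?M"
  proof (rule abelian_groupI)
    fix a assume a: "a \<in> carrier ?M"
    have "(\<lambda>s W. - a s W) \<in> carrier ?M" using a by (simp add: cM superclass_functions_def)
    then show "\<exists>y\<in>carrier ?M. y \<oplus>\<^bsub>?M\<^esub> a = \<zero>\<^bsub>?M\<^esub>"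
      by (rule bexI[rotated]) (simp add: superclass_module_def)
  qed (simp_all add: superclass_module_def superclass_functions_def ac_simps)
  show ?thesis
    unfolding left_module_def left_module_axioms_def
  proof (intro conjI allI impI ab)
    show "ring ?D" by (rule destriction_algebra_ring[OF fin])
    fix a m assume m: "m \<in> carrier ?M"
    show "a \<odot>\<^bsub>?M\<^esub> m \<in> carrier ?M" unfolding cM
    proof (intro allI conjI impI)
      fix s assume s: "s \<in> sections G"
      have A: "superclass_act G f (m (tgt f)) \<in> ?S (src f)" if "f \<in> mors G" for f
      proof (rule act_closed[OF that])
        show "m (tgt f) \<in> ?S (tgt f)" using m mor_src(2)[OF that] unfolding cM by blast
      qed
      show "(a \<odot>\<^bsub>?M\<^esub> m) s \<in> ?S s" unfolding superclass_functions_def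
      proof (safe, goal_cases)
        case (1 X) then show ?case by (auto simp: sm act_zero intro!: sum.neutral)
      next
        case (2 X x) then show ?case using A unfolding sm superclass_functions_def by (intro sum.cong refl) auto
      qed
    next
      fix s assume "s \<notin> sections G"
      then have "(a \<odot>\<^bsub>?M\<^esub> m) s W = 0" for W using mor_src by (auto simp: sm intro!: sum.neutral simp del: split_paired_All)
      then show "(a \<odot>\<^bsub>?M\<^esub> m) s = (\<lambda>W. 0)" by blast
    qed
  next
    fix a b m assume m: "m \<in> carrier ?M"
    show "(a \<oplus>\<^bsub>?D\<^esub> b) \<odot>\<^bsub>?M\<^esub> m = a \<odot>\<^bsub>?M\<^esub> m \<oplus>\<^bsub>?M\<^esub> b \<odot>\<^bsub>?M\<^esub> m"
      by (intro ext, simp only: sm ad adD sum.distrib[symmetric], intro sum.cong refl, simp add: distrib_right)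
    show "(a \<otimes>\<^bsub>?D\<^esub> b) \<odot>\<^bsub>?M\<^esub> m = a \<odot>\<^bsub>?M\<^esub> (b \<odot>\<^bsub>?M\<^esub> m)"
    proof (intro ext)
      fix s W
      have "((a \<otimes>\<^bsub>?D\<^esub> b) \<odot>\<^bsub>?M\<^esub> m) s W = (\<Sum>f\<in>mors G. if src f = s then a f * (\<Sum>f'\<in>mors G. if src f' = tgt f then b f' * superclass_act G (mor_comp G f' f) (m (tgt (mor_comp G f' f))) W else 0) else 0)"
        unfolding sm by (rule act_assoc[OF fin])
      also have "\<dots> = (a \<odot>\<^bsub>?M\<^esub> (b \<odot>\<^bsub>?M\<^esub> m)) s W"
      proof (subst sm, intro sum.cong refl, goal_cases)
        case (1 f)
        have "(b \<odot>\<^bsub>?M\<^esub> m) (tgt f) = (\<lambda>W. \<Sum>f'\<in>mors G. if src f' = tgt f then b f' * superclass_act G f' (m (tgt f')) W else 0)"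
          by (rule ext) (rule sm)
        then have "superclass_act G f ((b \<odot>\<^bsub>?M\<^esub> m) (tgt f)) W = (\<Sum>f'\<in>mors G. if src f' = tgt f then b f' * superclass_act G f (superclass_act G f' (m (tgt f'))) W else 0)"
          by (simp only: ev_sum)
        also have "\<dots> = (\<Sum>f'\<in>mors G. if src f' = tgt f then b f' * superclass_act G (mor_comp G f' f) (m (tgt (mor_comp G f' f))) W else 0)"
        proof (intro sum.cong refl if_cong, goal_cases)
          case (1 f')
          have "m (tgt f') \<in> ?S (tgt f')" using m mor_src(2)[OF 1(1)] unfolding cM by blast
          then show ?case using act_functor[OF \<open>f \<in> mors G\<close> 1(1,2)] by simp
        qed
        finally show ?case by simp
      qed
      finally show "((a \<otimes>\<^bsub>?D\<^esub> b) \<odot>\<^bsub>?M\<^esub> m) s W = (a \<odot>\<^bsub>?M\<^esub> (b \<odot>\<^bsub>?M\<^esub> m)) s W" .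
    qed
  next
    fix a m n
    show "a \<odot>\<^bsub>?M\<^esub> (m \<oplus>\<^bsub>?M\<^esub> n) = a \<odot>\<^bsub>?M\<^esub> m \<oplus>\<^bsub>?M\<^esub> a \<odot>\<^bsub>?M\<^esub> n"
    proof (intro ext)
      fix s W
      have "(m \<oplus>\<^bsub>?M\<^esub> n) t = (\<lambda>W. m t W + n t W)" for t by (rule ext) (rule ad)
      then show "(a \<odot>\<^bsub>?M\<^esub> (m \<oplus>\<^bsub>?M\<^esub> n)) s W = (a \<odot>\<^bsub>?M\<^esub> m \<oplus>\<^bsub>?M\<^esub> a \<odot>\<^bsub>?M\<^esub> n) s W"
        by (simp only: sm ad sum.distrib[symmetric] ev_add, intro sum.cong refl) (simp add: distrib_left)
    qed
  next
    fix m assume m: "m \<in> carrier ?M"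
    show "\<one>\<^bsub>?D\<^esub> \<odot>\<^bsub>?M\<^esub> m = m"
    proof (intro ext)
      fix s W show "(\<one>\<^bsub>?D\<^esub> \<odot>\<^bsub>?M\<^esub> m) s W = m s W"
      proof (cases "s \<in> sections G")
        case True
        then have "m s \<in> ?S s" using m unfolding cM by blast
        moreover have "tgt (mor_id s) = s" by (simp add: mor_id_def)
        ultimately show ?thesis using True by (subst sm, subst act_one[OF fin True]) (simp add: act_id)
      next
        case False then show ?thesis using m mor_src by (auto simp: cM sm intro!: sum.neutral simp del: split_paired_All)
      qed
    qed
  qed
qed

end

end

theory Submission
  imports Defs
begin

text \<open>
  Part 1 is a universal property. A super class function on $U/V$ is determined by its values at the
  groups $X/V$ with $V\le X\le U$, and the value at $X/V$ is found at the trivial section $(X,X)$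
  after restricting to $X/V$ and deflating to $X/X$ (\<open>sc_eval_des\<close>). Hence a homomorphism from a
  $\nabla$-module $F$ to $B^*$ is determined by its values at the trivial sections
  (\<open>sc_eval_joint_inj\<close>). Conversely a $\Pi$-homomorphism $\theta:c_1^+F\to Z$ extends, by the
  forced formula $y\mapsto\theta(\mathrm{Des}_{X/X}\,y)$ at $X/V$: this is a super class function,
  and compatible with all morphisms, because
  restriction along $Mg$ followed by $\mathrm{Des}_{X/X}$ equals $\mathrm{Des}$ to the trivial section of
  ${}^gX$ followed by a conjugation, and conjugations act trivially on $Z$ (\<open>mor_comp_des\<close>,
  \<open>coextend_hom\<close>). So $\mathrm{Hom}_\nabla(F,B^*)\cong\mathrm{Hom}_\Pi(c_1^+F,Z)$, the property
  that characterises the coinduced module.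

  For part 2 let $A$ be the kernel of the free cover $F\to J$. The claim is that each
  $\nabla$-homomorphism $A\to B^*$ extends to $F$ (\<open>Ext1_trivialI\<close>). By the universal property
  this concerns $\Pi$-homomorphisms $c_1^+A\to Z$ only, so the obstruction lies in
  $\mathrm{Ext}^1_\Pi(c_1^+J,Z)$. Now $c_1^+J$ is the trivial module with value $\mathbb{Z}$ at each
  $H\ne1$, and that group is the product of the groups
  $H^1(N_G(H)/H,\mathbb{Z})=\mathrm{Hom}(N_G(H)/H,\mathbb{Z})$ over conjugacy classes of $H\ne1$. It
  vanishes since $G$ is finite. The explicit form of this argument is \<open>orbit_cocycle_coboundary\<close> and
  \<open>extend_hom_kernel_J\<close>.
\<close>

section \<open>Modules and homomorphisms\<close>

context left_module
begin

lemma smult_l_null [simp]: "x \<in> carrier M \<Longrightarrow> \<zero>\<^bsub>R\<^esub> \<odot>\<^bsub>M\<^esub> x = \<zero>\<^bsub>M\<^esub>"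
  using smult_l_distr[of "\<zero>\<^bsub>R\<^esub>" "\<zero>\<^bsub>R\<^esub>" x] smult_closed[of "\<zero>\<^bsub>R\<^esub>" x] by simp

lemma smult_r_null [simp]: "a \<in> carrier R \<Longrightarrow> a \<odot>\<^bsub>M\<^esub> \<zero>\<^bsub>M\<^esub> = \<zero>\<^bsub>M\<^esub>"
  using smult_r_distr[of a "\<zero>\<^bsub>M\<^esub>" "\<zero>\<^bsub>M\<^esub>"] smult_closed[of a "\<zero>\<^bsub>M\<^esub>"] by simp

end

lemma mod_homI:
  assumes "f \<in> extensional (carrier M)"
    and "\<And>x. x \<in> carrier M \<Longrightarrow> f x \<in> carrier N"
    and "\<And>x y. x \<in> carrier M \<Longrightarrow> y \<in> carrier M \<Longrightarrow> f (x \<oplus>\<^bsub>M\<^esub> y) = f x \<oplus>\<^bsub>N\<^esub> f y"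
    and "\<And>a x. a \<in> carrier R \<Longrightarrow> x \<in> carrier M \<Longrightarrow> f (a \<odot>\<^bsub>M\<^esub> x) = a \<odot>\<^bsub>N\<^esub> f x"
  shows "f \<in> mod_hom R M N"
  using assms by (simp add: mod_hom_def PiE_def Pi_def)

lemma mod_homD:
  assumes "f \<in> mod_hom R M N"
  shows "f \<in> extensional (carrier M)"
    and "x \<in> carrier M \<Longrightarrow> f x \<in> carrier N"
    and "x \<in> carrier M \<Longrightarrow> y \<in> carrier M \<Longrightarrow> f (x \<oplus>\<^bsub>M\<^esub> y) = f x \<oplus>\<^bsub>N\<^esub> f y"
    and "a \<in> carrier R \<Longrightarrow> x \<in> carrier M \<Longrightarrow> f (a \<odot>\<^bsub>M\<^esub> x) = a \<odot>\<^bsub>N\<^esub> f x"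
  using assms by (auto simp: mod_hom_def PiE_def Pi_def)

lemma mod_hom_zero:
  assumes f: "f \<in> mod_hom R M N" and "abelian_group M" "abelian_group N"
  shows "f \<zero>\<^bsub>M\<^esub> = \<zero>\<^bsub>N\<^esub>"
proof -
  interpret M: abelian_group M by fact
  interpret N: abelian_group N by fact
  show ?thesis
    using mod_homD(3)[OF f M.zero_closed M.zero_closed] mod_homD(2)[OF f M.zero_closed] by simp
qed

lemma mod_hom_neg:
  assumes f: "f \<in> mod_hom R M N" and "abelian_group M" "abelian_group N" and x: "x \<in> carrier M"
  shows "f (\<ominus>\<^bsub>M\<^esub> x) = \<ominus>\<^bsub>N\<^esub> f x"
proof -
  interpret M: abelian_group M by fact
  interpret N: abelian_group N by fact
  have "f (\<ominus>\<^bsub>M\<^esub> x) \<oplus>\<^bsub>N\<^esub> f x = \<zero>\<^bsub>N\<^esub>"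
    using mod_homD(3)[OF f M.a_inv_closed[OF x] x] mod_hom_zero[OF assms(1-3)] x
    by (simp add: M.l_neg)
  then show ?thesis
    using N.minus_equality mod_homD(2)[OF f] x by (metis M.a_inv_closed)
qed


lemma mod_hom_compose:
  assumes "f \<in> mod_hom R L M" "g \<in> mod_hom R M N" "left_module R L"
  shows "compose (carrier L) g f \<in> mod_hom R L N"
proof -
  interpret L: left_module R L by fact
  show ?thesis
    by (rule mod_homI)
      (use mod_homD[OF assms(1)] mod_homD[OF assms(2)] in \<open>simp_all add: compose_eq L.smult_closed\<close>)
qed

lemma left_module_submodule:
  assumes "left_module R M" and sub: "S \<subseteq> carrier M"
    and zero: "\<zero>\<^bsub>M\<^esub> \<in> S"
    and add: "\<And>x y. x \<in> S \<Longrightarrow> y \<in> S \<Longrightarrow> x \<oplus>\<^bsub>M\<^esub> y \<in> S"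
    and neg: "\<And>x. x \<in> S \<Longrightarrow> \<ominus>\<^bsub>M\<^esub> x \<in> S"
    and smult: "\<And>a x. a \<in> carrier R \<Longrightarrow> x \<in> S \<Longrightarrow> a \<odot>\<^bsub>M\<^esub> x \<in> S"
  shows "left_module R (M\<lparr>carrier := S\<rparr>)"
proof -
  interpret left_module R M by fact
  have S: "x \<in> S \<Longrightarrow> x \<in> carrier M" for x using sub by auto
  have "abelian_group (M\<lparr>carrier := S\<rparr>)"
  proof (rule abelian_groupI)
    fix x assume "x \<in> carrier (M\<lparr>carrier := S\<rparr>)"
    then show "\<exists>y\<in>carrier (M\<lparr>carrier := S\<rparr>). y \<oplus>\<^bsub>M\<lparr>carrier := S\<rparr>\<^esub> x = \<zero>\<^bsub>M\<lparr>carrier := S\<rparr>\<^esub>"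
      using neg S by (intro bexI[of _ "\<ominus>\<^bsub>M\<^esub> x"]) (simp_all add: M.l_neg)
  qed (simp_all add: zero add S M.a_ac)
  then show ?thesis
    unfolding left_module_def left_module_axioms_def
    by (simp add: smult S smult_l_distr smult_r_distr smult_assoc smult_one R.ring_axioms)
qed

text \<open>
  A syzygy is by definition such a kernel, so this is what makes it a module.
\<close>

lemma kernel_left_module:
  assumes M: "left_module R M" and N: "left_module R N" and f: "f \<in> mod_hom R M N"
  shows "left_module R (M\<lparr>carrier := {x \<in> carrier M. f x = \<zero>\<^bsub>N\<^esub>}\<rparr>)"
proof -
  interpret M: left_module R M by fact
  interpret N: left_module R N by fact
  note h = mod_homD[OF f] and z = mod_hom_zero[OF f M.M.abelian_group_axioms N.M.abelian_group_axioms]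
    and n = mod_hom_neg[OF f M.M.abelian_group_axioms N.M.abelian_group_axioms]
  show ?thesis
    by (rule left_module_submodule[OF M]) (simp_all add: h z n M.smult_closed)
qed

text \<open>
  The isomorphism theorem in the form used for $\mathrm{Ext}^1$: a cocycle on the free module
  $P_1$ vanishes on the kernel of $P_1\to A$ and hence is a homomorphism on the syzygy $A$.
\<close>

lemma mod_hom_factor:
  assumes P: "left_module R P" and A: "left_module R A" and N: "left_module R N"
    and p: "p \<in> mod_hom R P A" and surj: "\<And>a. a \<in> carrier A \<Longrightarrow> \<exists>u\<in>carrier P. p u = a"
    and f: "f \<in> mod_hom R P N"
    and ker: "\<And>u. u \<in> carrier P \<Longrightarrow> p u = \<zero>\<^bsub>A\<^esub> \<Longrightarrow> f u = \<zero>\<^bsub>N\<^esub>"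
  obtains g where "g \<in> mod_hom R A N" "\<And>u. u \<in> carrier P \<Longrightarrow> f u = g (p u)"
proof -
  interpret P: left_module R P by fact
  interpret A: left_module R A by fact
  interpret N: left_module R N by fact
  note ab = P.M.abelian_group_axioms A.M.abelian_group_axioms N.M.abelian_group_axioms
  note fD = mod_homD[OF f] and pD = mod_homD[OF p]
  have eq: "f u = f v" if uv: "u \<in> carrier P" "v \<in> carrier P" "p u = p v" for u v
  proof -
    have "p (u \<oplus>\<^bsub>P\<^esub> \<ominus>\<^bsub>P\<^esub> v) = \<zero>\<^bsub>A\<^esub>"
      using uv pD(2) by (simp add: pD(3) mod_hom_neg[OF p ab(1,2)] A.M.r_neg)
    then have "f (u \<oplus>\<^bsub>P\<^esub> \<ominus>\<^bsub>P\<^esub> v) = \<zero>\<^bsub>N\<^esub>" using ker uv by simp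
    then have "f u \<oplus>\<^bsub>N\<^esub> \<ominus>\<^bsub>N\<^esub> f v = \<zero>\<^bsub>N\<^esub>"
      using uv by (simp add: fD(3) mod_hom_neg[OF f ab(1,3)])
    then show ?thesis using fD(2) uv N.M.minus_equality[of "f u" "\<ominus>\<^bsub>N\<^esub> f v"] by simp
  qed
  define g where "g = (\<lambda>a\<in>carrier A. f (SOME u. u \<in> carrier P \<and> p u = a))"
  have g: "g (p u) = f u" if u: "u \<in> carrier P" for u
  proof -
    let ?v = "SOME v. v \<in> carrier P \<and> p v = p u"
    have v: "?v \<in> carrier P \<and> p ?v = p u" by (rule someI[of _ u]) (use u in simp)
    have "g (p u) = f ?v" using pD(2)[OF u] by (simp add: g_def)
    also have "\<dots> = f u" by (rule eq) (use u v in auto)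
    finally show ?thesis .
  qed
  have "g \<in> mod_hom R A N"
  proof (rule mod_homI)
    show "g \<in> extensional (carrier A)" by (simp add: g_def)
    show "g x \<in> carrier N" if "x \<in> carrier A" for x
      using surj[OF that] g fD(2) by auto
    show "g (x \<oplus>\<^bsub>A\<^esub> y) = g x \<oplus>\<^bsub>N\<^esub> g y" if xy: "x \<in> carrier A" "y \<in> carrier A" for x y
    proof -
      obtain u v where uv: "u \<in> carrier P" "v \<in> carrier P" "p u = x" "p v = y" using surj xy by metis
      have "g (x \<oplus>\<^bsub>A\<^esub> y) = g (p (u \<oplus>\<^bsub>P\<^esub> v))" using uv by (simp add: pD(3))
      also have "\<dots> = f u \<oplus>\<^bsub>N\<^esub> f v" using uv by (subst g) (simp_all add: fD(3))
      finally show ?thesis using g[OF uv(1)] g[OF uv(2)] uv(3,4) by simp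
    qed
    show "g (a \<odot>\<^bsub>A\<^esub> x) = a \<odot>\<^bsub>N\<^esub> g x" if ax: "a \<in> carrier R" "x \<in> carrier A" for a x
    proof -
      obtain u where u: "u \<in> carrier P" "p u = x" using surj ax by metis
      have "g (a \<odot>\<^bsub>A\<^esub> x) = g (p (a \<odot>\<^bsub>P\<^esub> u))" using u ax by (simp add: pD(4))
      also have "\<dots> = a \<odot>\<^bsub>N\<^esub> f u" using u ax by (subst g) (simp_all add: fD(4) P.smult_closed)
      finally show ?thesis using g[OF u(1)] u(2) by simp
    qed
  qed
  then show ?thesis using that g by metis
qed


section \<open>Vanishing of $\mathrm{Ext}^1$ by extending homomorphisms\<close>

lemma free_module_simps:
  "u \<in> carrier (free_module R S) \<longleftrightarrow>
     (\<forall>x. u x \<in> carrier R) \<and> finite {x. u x \<noteq> \<zero>\<^bsub>R\<^esub>} \<and> {x. u x \<noteq> \<zero>\<^bsub>R\<^esub>} \<subseteq> S"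
  "\<zero>\<^bsub>free_module R S\<^esub> = (\<lambda>x. \<zero>\<^bsub>R\<^esub>)"
  "u \<oplus>\<^bsub>free_module R S\<^esub> v = (\<lambda>x. u x \<oplus>\<^bsub>R\<^esub> v x)"
  "a \<odot>\<^bsub>free_module R S\<^esub> u = (\<lambda>x. a \<otimes>\<^bsub>R\<^esub> u x)"
  by (simp_all add: free_module_def)

lemma free_module_left_module:
  assumes "ring R" shows "left_module R (free_module R S)"
proof -
  interpret R: ring R by fact
  let ?F = "free_module R S"
  have sup: "u \<in> carrier ?F"
    if "\<And>x. u x \<in> carrier R" "v \<in> carrier ?F" "w \<in> carrier ?F"
      "\<And>x. v x = \<zero>\<^bsub>R\<^esub> \<Longrightarrow> w x = \<zero>\<^bsub>R\<^esub> \<Longrightarrow> u x = \<zero>\<^bsub>R\<^esub>" for u v w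
  proof -
    have "{x. u x \<noteq> \<zero>\<^bsub>R\<^esub>} \<subseteq> {x. v x \<noteq> \<zero>\<^bsub>R\<^esub>} \<union> {x. w x \<noteq> \<zero>\<^bsub>R\<^esub>}" using that(4) by auto
    then show ?thesis using that(1-3) unfolding free_module_simps
      by (meson finite_UnI finite_subset le_supI order_trans)
  qed
  have cl: "u \<in> carrier ?F \<Longrightarrow> u x \<in> carrier R" for u x by (simp add: free_module_simps)
  have "abelian_group ?F"
  proof (rule abelian_groupI)
    fix u assume u: "u \<in> carrier ?F"
    show "\<exists>v\<in>carrier ?F. v \<oplus>\<^bsub>?F\<^esub> u = \<zero>\<^bsub>?F\<^esub>"
      using sup[of "\<lambda>x. \<ominus>\<^bsub>R\<^esub> u x" u u] u
      by (intro bexI[of _ "\<lambda>x. \<ominus>\<^bsub>R\<^esub> u x"]) (simp_all add: cl free_module_simps(2,3) R.l_neg)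
    fix v assume v: "v \<in> carrier ?F"
    show "u \<oplus>\<^bsub>?F\<^esub> v \<in> carrier ?F"
      by (rule sup[of _ u v]) (use u v in \<open>simp_all add: cl free_module_simps(2,3)\<close>)
  qed (simp_all add: free_module_simps(2,3) cl R.a_ac, simp add: free_module_simps)
  moreover have "a \<odot>\<^bsub>?F\<^esub> u \<in> carrier ?F" if "a \<in> carrier R" "u \<in> carrier ?F" for a u
    by (rule sup[of _ u u]) (use that in \<open>simp_all add: cl free_module_simps(4)\<close>)
  ultimately show ?thesis
    unfolding left_module_def left_module_axioms_def
    by (simp add: R.ring_axioms free_module_simps(3,4) cl R.l_distr R.r_distr R.m_assoc)
qed

context left_module
begin

lemma free_cover_left_module: "left_module R (free_cover R M)"
  by (simp add: free_cover_def free_module_left_module R.ring_axioms)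

text \<open>
  The elements of a free module have various supports; enlarging the index set of the sum makes
  their images comparable.
\<close>

lemma cover_map_eq:
  assumes u: "u \<in> carrier (free_cover R M)" and T: "finite T" "{x. u x \<noteq> \<zero>\<^bsub>R\<^esub>} \<subseteq> T" "T \<subseteq> carrier M"
  shows "cover_map R M u = (\<Oplus>\<^bsub>M\<^esub>x\<in>T. u x \<odot>\<^bsub>M\<^esub> x)"
proof -
  have "(\<Oplus>\<^bsub>M\<^esub>x\<in>{x. u x \<noteq> \<zero>\<^bsub>R\<^esub>}. u x \<odot>\<^bsub>M\<^esub> x) = (\<Oplus>\<^bsub>M\<^esub>x\<in>T. u x \<odot>\<^bsub>M\<^esub> x)"
    using u T by (intro M.add.finprod_mono_neutral_cong_left)
      (auto simp: free_cover_def free_module_simps smult_closed)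
  then show ?thesis using u by (simp add: cover_map_def)
qed

lemma cover_map_hom: "cover_map R M \<in> mod_hom R (free_cover R M) M"
proof (rule mod_homI)
  let ?F = "free_cover R M" and ?s = "\<lambda>u. {x. u x \<noteq> \<zero>\<^bsub>R\<^esub>}"
  interpret F: left_module R ?F by (rule free_cover_left_module)
  have F: "u x \<in> carrier R" "finite (?s u)" "?s u \<subseteq> carrier M" if "u \<in> carrier ?F" for u x
    using that by (auto simp: free_cover_def free_module_simps)
  show "cover_map R M \<in> extensional (carrier ?F)" by (simp add: cover_map_def)
  show "cover_map R M u \<in> carrier M" if u: "u \<in> carrier ?F" for u
  proof -
    have "cover_map R M u = (\<Oplus>\<^bsub>M\<^esub>x\<in>?s u. u x \<odot>\<^bsub>M\<^esub> x)" using u by (simp add: cover_map_def)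
    also have "\<dots> \<in> carrier M" by (rule M.finsum_closed) (use F[OF u] in \<open>auto intro!: smult_closed\<close>)
    finally show ?thesis .
  qed
  show "cover_map R M (u \<oplus>\<^bsub>?F\<^esub> v) = cover_map R M u \<oplus>\<^bsub>M\<^esub> cover_map R M v"
    if u: "u \<in> carrier ?F" and v: "v \<in> carrier ?F" for u v
  proof -
    let ?T = "?s u \<union> ?s v"
    have T: "finite ?T" "?T \<subseteq> carrier M" using F[OF u] F[OF v] by auto
    have s: "(u \<oplus>\<^bsub>?F\<^esub> v) = (\<lambda>x. u x \<oplus>\<^bsub>R\<^esub> v x)" by (simp add: free_cover_def free_module_simps)
    have "cover_map R M (u \<oplus>\<^bsub>?F\<^esub> v) = (\<Oplus>\<^bsub>M\<^esub>x\<in>?T. (u \<oplus>\<^bsub>?F\<^esub> v) x \<odot>\<^bsub>M\<^esub> x)"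
      by (rule cover_map_eq[OF F.M.a_closed[OF u v] T(1) _ T(2)]) (auto simp: s)
    also have "\<dots> = (\<Oplus>\<^bsub>M\<^esub>x\<in>?T. u x \<odot>\<^bsub>M\<^esub> x \<oplus>\<^bsub>M\<^esub> v x \<odot>\<^bsub>M\<^esub> x)"
      using T F(1)[OF u] F(1)[OF v]
      by (intro M.finsum_cong') (auto simp: s smult_l_distr subset_iff intro!: smult_closed)
    also have "\<dots> = (\<Oplus>\<^bsub>M\<^esub>x\<in>?T. u x \<odot>\<^bsub>M\<^esub> x) \<oplus>\<^bsub>M\<^esub> (\<Oplus>\<^bsub>M\<^esub>x\<in>?T. v x \<odot>\<^bsub>M\<^esub> x)"
      using T F(1)[OF u] F(1)[OF v] by (intro M.finsum_addf) (auto simp: subset_iff intro!: smult_closed)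
    also have "\<dots> = cover_map R M u \<oplus>\<^bsub>M\<^esub> cover_map R M v"
      using cover_map_eq[OF u T(1) _ T(2)] cover_map_eq[OF v T(1) _ T(2)] by simp
    finally show ?thesis .
  qed
  show "cover_map R M (a \<odot>\<^bsub>?F\<^esub> u) = a \<odot>\<^bsub>M\<^esub> cover_map R M u"
    if a: "a \<in> carrier R" and u: "u \<in> carrier ?F" for a u
  proof -
    note f = F[OF u]
    have s: "(a \<odot>\<^bsub>?F\<^esub> u) = (\<lambda>x. a \<otimes>\<^bsub>R\<^esub> u x)" by (simp add: free_cover_def free_module_simps)
    have dist: "(\<Oplus>\<^bsub>M\<^esub>x\<in>T. a \<odot>\<^bsub>M\<^esub> (u x \<odot>\<^bsub>M\<^esub> x)) = a \<odot>\<^bsub>M\<^esub> (\<Oplus>\<^bsub>M\<^esub>x\<in>T. u x \<odot>\<^bsub>M\<^esub> x)"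
      if "finite T" "T \<subseteq> carrier M" for T
      using that
    proof (induction T rule: finite_induct)
      case (insert x T)
      have "(\<lambda>x. u x \<odot>\<^bsub>M\<^esub> x) \<in> T \<rightarrow> carrier M" "(\<lambda>x. a \<odot>\<^bsub>M\<^esub> (u x \<odot>\<^bsub>M\<^esub> x)) \<in> T \<rightarrow> carrier M"
        using insert f(1) a by (auto intro!: smult_closed)
      then show ?case using insert f(1) a
        by (simp add: smult_closed smult_r_distr M.finsum_closed)
    qed (simp add: a)
    have "cover_map R M (a \<odot>\<^bsub>?F\<^esub> u) = (\<Oplus>\<^bsub>M\<^esub>x\<in>?s u. (a \<odot>\<^bsub>?F\<^esub> u) x \<odot>\<^bsub>M\<^esub> x)"
      by (rule cover_map_eq[OF F.smult_closed[OF a u] f(2) _ f(3)]) (use a in \<open>auto simp: s\<close>)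
    also have "\<dots> = (\<Oplus>\<^bsub>M\<^esub>x\<in>?s u. a \<odot>\<^bsub>M\<^esub> (u x \<odot>\<^bsub>M\<^esub> x))"
      using f a by (intro M.finsum_cong') (auto simp: s smult_assoc subset_iff intro!: smult_closed)
    also have "\<dots> = a \<odot>\<^bsub>M\<^esub> cover_map R M u"
      by (simp only: dist[OF f(2,3)] cover_map_eq[OF u f(2) order_refl f(3)])
    finally show ?thesis .
  qed
qed

lemma cover_map_surj:
  assumes x: "x \<in> carrier M"
  shows "\<exists>u\<in>carrier (free_cover R M). cover_map R M u = x"
proof
  let ?u = "\<lambda>y. if y = x then \<one>\<^bsub>R\<^esub> else \<zero>\<^bsub>R\<^esub>"
  have "{y. ?u y \<noteq> \<zero>\<^bsub>R\<^esub>} \<subseteq> {x}" by auto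
  then show u: "?u \<in> carrier (free_cover R M)"
    using x by (auto simp: free_cover_def free_module_simps intro: finite_subset)
  show "cover_map R M ?u = x"
    using x by (subst cover_map_eq[OF u, of "{x}"]) (auto simp: smult_one)
qed

lemma syzygy_left_module: "left_module R (syzygy R M)"
  unfolding syzygy_def
  by (rule kernel_left_module[OF free_cover_left_module left_module_axioms cover_map_hom])

end

lemma hom_group_group:
  assumes M: "left_module R M" and N: "left_module R N" shows "group (hom_group R M N)"
proof -
  interpret M: left_module R M by fact
  interpret N: left_module R N by fact
  let ?H = "hom_group R M N"
  have ops: "x \<otimes>\<^bsub>?H\<^esub> y = (\<lambda>z\<in>carrier M. x z \<oplus>\<^bsub>N\<^esub> y z)" "\<one>\<^bsub>?H\<^esub> = (\<lambda>z\<in>carrier M. \<zero>\<^bsub>N\<^esub>)"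
    "carrier ?H = mod_hom R M N" for x y by (simp_all add: hom_group_def)
  show ?thesis
  proof (rule groupI)
    fix f assume "f \<in> carrier ?H"
    then have f: "f \<in> mod_hom R M N" by (simp add: ops)
    note fD = mod_homD[OF f]
    have neg: "(\<lambda>z\<in>carrier M. \<ominus>\<^bsub>N\<^esub> f z) \<in> mod_hom R M N"
    proof (rule mod_homI, goal_cases)
      case (4 a x)
      have "a \<odot>\<^bsub>N\<^esub> (\<ominus>\<^bsub>N\<^esub> f x) \<oplus>\<^bsub>N\<^esub> a \<odot>\<^bsub>N\<^esub> f x = \<zero>\<^bsub>N\<^esub>"
        using 4 fD(2) by (simp add: N.smult_r_distr[symmetric] N.M.l_neg)
      then show ?case using 4 fD(2) by (simp add: fD(4) M.smult_closed N.M.minus_equality N.smult_closed)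
    qed (simp_all add: fD N.M.minus_add)
    show "\<exists>g\<in>carrier ?H. g \<otimes>\<^bsub>?H\<^esub> f = \<one>\<^bsub>?H\<^esub>"
      using fD(2) neg by (intro bexI[OF _ neg[folded ops(3)]]) (auto simp: ops N.M.l_neg intro!: restrict_ext)
    show "\<one>\<^bsub>?H\<^esub> \<otimes>\<^bsub>?H\<^esub> f = f"
      unfolding ops by (intro extensionalityI[OF _ fD(1)]) (simp_all add: fD)
    fix g assume "g \<in> carrier ?H"
    then have g: "g \<in> mod_hom R M N" by (simp add: ops)
    note gD = mod_homD[OF g]
    show "f \<otimes>\<^bsub>?H\<^esub> g \<in> carrier ?H" unfolding ops
      by (rule mod_homI) (simp_all add: fD gD M.smult_closed N.smult_r_distr N.M.a_ac)
    fix h assume "h \<in> carrier ?H"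
    then have h: "h \<in> mod_hom R M N" by (simp add: ops)
    show "f \<otimes>\<^bsub>?H\<^esub> g \<otimes>\<^bsub>?H\<^esub> h = f \<otimes>\<^bsub>?H\<^esub> (g \<otimes>\<^bsub>?H\<^esub> h)" unfolding ops
      by (intro restrict_ext) (simp add: fD gD mod_homD[OF h] N.M.a_ac)
  next
    show "\<one>\<^bsub>?H\<^esub> \<in> carrier ?H" unfolding ops by (rule mod_homI) (simp_all add: M.smult_closed)
  qed
qed

text \<open>
  Write $A$ for the kernel of the free cover $P_0\to M$. The canonical resolution is exact at
  $P_1$, so $1$-cocycles are the homomorphisms $A\to N$, and the coboundaries are those that are
  restrictions of homomorphisms $P_0\to N$. Thus the dimension shift
  $\mathrm{Ext}^1(M,N)=\mathrm{coker}(\mathrm{Hom}(P_0,N)\to\mathrm{Hom}(A,N))$ holds by construction.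
\<close>

lemma Ext1_trivialI:
  assumes M: "left_module R M" and N: "left_module R N"
    and ext: "\<And>f. f \<in> mod_hom R (syzygy R M) N \<Longrightarrow>
      \<exists>g\<in>mod_hom R (free_cover R M) N. \<forall>x\<in>carrier (syzygy R M). g x = f x"
  shows "trivial_group (Ext1 R M N)"
proof -
  interpret M: left_module R M by fact
  interpret N: left_module R N by fact
  interpret A: left_module R "syzygy R M" by (rule M.syzygy_left_module)
  interpret A': left_module R "syzygy R (syzygy R M)" by (rule A.syzygy_left_module)
  let ?P0 = "res_module0 R M" and ?P1 = "res_module1 R M" and ?P2 = "res_module2 R M"
  let ?d1 = "res_map1 R M" and ?d2 = "res_map2 R M" and ?A = "syzygy R M"
  have P0: "left_module R ?P0" unfolding res_module0_def by (rule M.free_cover_left_module)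
  have P1: "left_module R ?P1" unfolding res_module1_def by (rule A.free_cover_left_module)
  have P2: "left_module R ?P2" unfolding res_module2_def by (rule A'.free_cover_left_module)
  have d1: "?d1 \<in> mod_hom R ?P1 ?A" unfolding res_map1_def res_module1_def by (rule A.cover_map_hom)
  have A_sub: "carrier ?A \<subseteq> carrier ?P0" "add ?A = add ?P0" "smult ?A = smult ?P0" "zero ?A = zero ?P0"
    by (auto simp: syzygy_def res_module0_def)
  have d1': "?d1 \<in> mod_hom R ?P1 ?P0"
    using mod_homD[OF d1] A_sub by (intro mod_homI) (auto simp: subset_iff)
  have d2: "?d2 u \<in> carrier ?P1 \<and> ?d1 (?d2 u) = \<zero>\<^bsub>?A\<^esub>" if "u \<in> carrier ?P2" for u
    using mod_homD(2)[OF A'.cover_map_hom] that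
    unfolding res_module2_def res_map2_def res_map1_def res_module1_def by (auto simp: syzygy_def[of R ?A])
  have d2_surj: "\<exists>u\<in>carrier ?P2. ?d2 u = v" if "v \<in> carrier ?P1" "?d1 v = \<zero>\<^bsub>?A\<^esub>" for v
    using A'.cover_map_surj[of v] that
    unfolding res_module2_def res_map2_def res_map1_def res_module1_def by (simp add: syzygy_def[of R ?A])
  let ?Z = "{\<phi> \<in> mod_hom R ?P1 N. compose (carrier ?P2) \<phi> ?d2 = (\<lambda>x\<in>carrier ?P2. \<zero>\<^bsub>N\<^esub>)}"
  let ?B = "{compose (carrier ?P1) \<psi> ?d1 | \<psi>. \<psi> \<in> mod_hom R ?P0 N}"
  have Z_iff: "\<phi> \<in> ?Z \<longleftrightarrow> \<phi> \<in> mod_hom R ?P1 N \<and> (\<forall>u\<in>carrier ?P2. \<phi> (?d2 u) = \<zero>\<^bsub>N\<^esub>)" for \<phi>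
    by (auto simp: compose_def restrict_def fun_eq_iff)
  have "?Z \<subseteq> ?B"
  proof
    fix \<phi> assume "\<phi> \<in> ?Z"
    then have \<phi>: "\<phi> \<in> mod_hom R ?P1 N" and van: "\<And>u. u \<in> carrier ?P2 \<Longrightarrow> \<phi> (?d2 u) = \<zero>\<^bsub>N\<^esub>"
      unfolding Z_iff by auto
    have "\<exists>u\<in>carrier ?P1. ?d1 u = a" if "a \<in> carrier ?A" for a
      using A.cover_map_surj[OF that] by (simp add: res_module1_def res_map1_def)
    moreover have "\<phi> u = \<zero>\<^bsub>N\<^esub>" if "u \<in> carrier ?P1" "?d1 u = \<zero>\<^bsub>?A\<^esub>" for u
      using d2_surj[OF that] van by auto
    ultimately obtain f where f: "f \<in> mod_hom R ?A N" "\<And>u. u \<in> carrier ?P1 \<Longrightarrow> \<phi> u = f (?d1 u)"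
      using mod_hom_factor[OF P1 M.syzygy_left_module N d1 _ \<phi>] by metis
    obtain \<psi> where "\<psi> \<in> mod_hom R ?P0 N" "\<And>x. x \<in> carrier ?A \<Longrightarrow> \<psi> x = f x"
      using ext[OF f(1)] unfolding res_module0_def by auto
    moreover from this have "\<phi> = compose (carrier ?P1) \<psi> ?d1"
      using mod_homD(1)[OF \<phi>] mod_homD(2)[OF d1] f(2)
      by (intro extensionalityI[OF _ compose_extensional]) (auto simp: compose_eq)
    ultimately show "\<phi> \<in> ?B" by blast
  qed
  moreover have "?B \<subseteq> ?Z"
  proof clarify
    fix \<psi> assume \<psi>: "\<psi> \<in> mod_hom R ?P0 N"
    have "\<psi> \<zero>\<^bsub>?A\<^esub> = \<zero>\<^bsub>N\<^esub>"
      using mod_hom_zero[OF \<psi> _ N.M.abelian_group_axioms] P0 A_sub(4) by (simp add: left_module_def)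
    then have "compose (carrier ?P1) \<psi> ?d1 \<in> ?Z"
      unfolding Z_iff using mod_hom_compose[OF d1' \<psi> P1] d2 by (simp add: compose_eq)
    then show "compose (carrier ?P1) \<psi> ?d1 \<in> mod_hom R ?P1 N \<and> 
      compose (carrier ?P2) (compose (carrier ?P1) \<psi> ?d1) ?d2 = (\<lambda>x\<in>carrier ?P2. \<zero>\<^bsub>N\<^esub>)" by blast
  qed
  ultimately have BZ: "?B = ?Z" by blast
  let ?H = "hom_group R ?P1 N"
  interpret H: group ?H by (rule hom_group_group[OF P1 N])
  have ops: "x \<otimes>\<^bsub>?H\<^esub> y = (\<lambda>z\<in>carrier ?P1. x z \<oplus>\<^bsub>N\<^esub> y z)" "\<one>\<^bsub>?H\<^esub> = (\<lambda>z\<in>carrier ?P1. \<zero>\<^bsub>N\<^esub>)"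
    "carrier ?H = mod_hom R ?P1 N" for x y by (simp_all add: hom_group_def)
  have mem: "?d2 u \<in> carrier ?P1" if "u \<in> carrier ?P2" for u using d2[OF that] by simp
  have "subgroup ?Z ?H"
  proof (rule H.subgroupI)
    show "?Z \<subseteq> carrier ?H" by (auto simp: ops)
    have "\<one>\<^bsub>?H\<^esub> \<in> ?Z" unfolding Z_iff using H.one_closed mem by (simp add: ops)
    then show "?Z \<noteq> {}" by blast
    fix f assume "f \<in> ?Z"
    then have f: "f \<in> carrier ?H" "\<And>u. u \<in> carrier ?P2 \<Longrightarrow> f (?d2 u) = \<zero>\<^bsub>N\<^esub>" unfolding Z_iff ops by auto
    show "inv\<^bsub>?H\<^esub> f \<in> ?Z" unfolding Z_iff
    proof (intro conjI ballI)
      show i: "inv\<^bsub>?H\<^esub> f \<in> mod_hom R ?P1 N" using H.inv_closed[OF f(1)] by (simp add: ops)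
      fix u assume u: "u \<in> carrier ?P2"
      have "(inv\<^bsub>?H\<^esub> f \<otimes>\<^bsub>?H\<^esub> f) (?d2 u) = \<zero>\<^bsub>N\<^esub>"
        using mem[OF u] by (simp add: H.l_inv[OF f(1)], simp add: ops)
      then show "(inv\<^bsub>?H\<^esub> f) (?d2 u) = \<zero>\<^bsub>N\<^esub>"
        using mem[OF u] mod_homD(2)[OF i] f(2)[OF u] by (simp add: ops)
    qed
    fix g assume "g \<in> ?Z"
    then have g: "g \<in> carrier ?H" "\<And>u. u \<in> carrier ?P2 \<Longrightarrow> g (?d2 u) = \<zero>\<^bsub>N\<^esub>" unfolding Z_iff ops by auto
    show "f \<otimes>\<^bsub>?H\<^esub> g \<in> ?Z" unfolding Z_iff
      using H.m_closed[OF f(1) g(1)] f(2) g(2) mem by (simp add: ops)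
  qed
  then interpret Zg: group "?H\<lparr>carrier := ?Z\<rparr>" by (rule H.subgroup_imp_group)
  interpret n: normal ?Z "?H\<lparr>carrier := ?Z\<rparr>" using Zg.normal_self by simp
  have E: "Ext1 R M N = ?H\<lparr>carrier := ?Z\<rparr> Mod ?Z"
    unfolding Ext1_def BZ ..
  have "carrier (?H\<lparr>carrier := ?Z\<rparr> Mod ?Z) \<subseteq> {?Z}"
    using Zg.coset_join2[OF _ n.subgroup_axioms] by (auto simp: FactGroup_def RCOSETS_def)
  then show ?thesis
    unfolding E group.trivial_group_subset[OF n.factorgroup_is_group] by (simp add: FactGroup_def)
qed


section \<open>Monomials of the destriction algebra\<close>

definition single :: "int \<Rightarrow> 'a mor \<Rightarrow> 'a mor \<Rightarrow> int"
  where "single c f = (\<lambda>h. if h = f then c else 0)"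

text \<open>
  Every morphism from a trivial section $(X,X)$ factors as a conjugation \<open>conj_mor\<close> followed by a
  morphism \<open>des_mor\<close> given by the coset of $1$. The latter corresponds to $\mathrm{Des}^{M/L}_{X/X}$.
\<close>

definition des_mor :: "'a set \<Rightarrow> 'a sec \<Rightarrow> 'a mor"
  where "des_mor X s = ((X, X), s, fst s)"

definition conj_mor :: "('a, 'b) monoid_scheme \<Rightarrow> 'a \<Rightarrow> 'a set \<Rightarrow> 'a mor"
  where "conj_mor G g X = ((X, X), (conj_set G g X, conj_set G g X), conj_set G g X #>\<^bsub>G\<^esub> g)"

lemma des_mor_simps [simp]: "src (des_mor X s) = (X, X)" "tgt (des_mor X s) = s"
  by (simp_all add: des_mor_def)

lemma conj_mor_simps [simp]:
  "src (conj_mor G g X) = (X, X)" "tgt (conj_mor G g X) = (conj_set G g X, conj_set G g X)"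
  by (simp_all add: conj_mor_def)

lemma mor_id_simps [simp]: "src (mor_id s) = s" "tgt (mor_id s) = s"
  by (simp_all add: mor_id_def)

lemma additive_int_linear:
  fixes t :: "int \<Rightarrow> int"
  assumes add: "\<And>c d. t (c + d) = t c + t d"
  shows "t c = c * t 1"
proof (induction c rule: int_induct[of _ 0])
  case base
  show ?case using add[of 0 0] by simp
next
  case (step1 i)
  then show ?case using add[of i 1] by (simp add: distrib_right)
next
  case (step2 i)
  then show ?case using add[of "i - 1" 1] by (simp add: left_diff_distrib)
qed

locale finite_group = group +
  assumes finite_carrier: "finite (carrier G)"
begin

abbreviation "Nabla \<equiv> destriction_algebra G"
abbreviation "PiAlg \<equiv> corner_ring (destriction_algebra G) (c1_plus G)"
abbreviation "SC \<equiv> superclass_module G"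
abbreviation "TZ \<equiv> trivial_module G"

sublocale D: ring Nabla by (rule destriction_algebra_ring[OF finite_carrier])

lemma algebra_carrier: "a \<in> carrier Nabla \<longleftrightarrow> (\<forall>f. f \<notin> mors G \<longrightarrow> a f = 0)"
  by (simp add: destriction_algebra_def)

lemma algebra_ops: "a \<oplus>\<^bsub>Nabla\<^esub> b = (\<lambda>h. a h + b h)" "\<zero>\<^bsub>Nabla\<^esub> = (\<lambda>h. 0)"
  by (simp_all add: destriction_algebra_def)

lemma single_closed [simp]: "f \<in> mors G \<Longrightarrow> single c f \<in> carrier Nabla"
  by (auto simp: algebra_carrier single_def)

lemma single_add: "single (c + d) f = single c f \<oplus>\<^bsub>Nabla\<^esub> single d f"
  by (auto simp: algebra_ops single_def)

lemma single_0: "single 0 f = \<zero>\<^bsub>Nabla\<^esub>"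
  by (auto simp: algebra_ops single_def)

lemma sum_single:
  fixes T :: "'a mor \<Rightarrow> int"
  assumes "f \<in> mors G"
  shows "(\<Sum>k\<in>mors G. if P k then single c f k * T k else 0) = (if P f then c * T f else 0)"
proof -
  have "(\<Sum>k\<in>mors G. if P k then single c f k * T k else 0)
      = (\<Sum>k\<in>mors G. if k = f then (if P f then c * T f else 0) else 0)"
    by (intro sum.cong) (auto simp: single_def)
  then show ?thesis using assms finite_mors[OF finite_carrier] by simp
qed

lemma single_mult:
  assumes f: "f \<in> mors G" and k: "k \<in> mors G"
  shows "single c f \<otimes>\<^bsub>Nabla\<^esub> single d k =
    (if tgt f = src k then single (c * d) (mor_comp G k f) else \<zero>\<^bsub>Nabla\<^esub>)"
proof
  fix h
  have "(single c f \<otimes>\<^bsub>Nabla\<^esub> single d k) h = (\<Sum>f'\<in>mors G. if True then single c f f' *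
     (\<Sum>k'\<in>mors G. if tgt f' = src k' \<and> mor_comp G k' f' = h then single d k k' * 1 else 0) else 0)"
    by (simp add: destriction_mult_eq[OF finite_carrier] sum_distrib_left if_distrib cong: if_cong)
  also have "\<dots> = (if tgt f = src k then single (c * d) (mor_comp G k f) else \<zero>\<^bsub>Nabla\<^esub>) h"
    by (simp only: sum_single f k) (auto simp: single_def algebra_ops)
  finally show "(single c f \<otimes>\<^bsub>Nabla\<^esub> single d k) h =
    (if tgt f = src k then single (c * d) (mor_comp G k f) else \<zero>\<^bsub>Nabla\<^esub>) h" .
qed

text \<open>
  The algebra is free as an abelian group on the morphisms. This lemma reduces the linearity of maps
  over the algebra to a check on single morphisms.
\<close>

lemma additive_eq_sum:
  fixes T :: "('a mor \<Rightarrow> int) \<Rightarrow> int"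
  assumes add: "\<And>a b. a \<in> carrier Nabla \<Longrightarrow> b \<in> carrier Nabla \<Longrightarrow> T (a \<oplus>\<^bsub>Nabla\<^esub> b) = T a + T b"
    and a: "a \<in> carrier Nabla"
  shows "T a = (\<Sum>f\<in>mors G. a f * T (single 1 f))"
proof -
  have lin: "T (single c f) = c * T (single 1 f)" if "f \<in> mors G" for c f
    by (rule additive_int_linear[of "\<lambda>c. T (single c f)"]) (simp only: single_add add single_closed that)
  have T0: "T \<zero>\<^bsub>Nabla\<^esub> = 0" using add[of "\<zero>\<^bsub>Nabla\<^esub>" "\<zero>\<^bsub>Nabla\<^esub>"] by simp
  have step: "finite S \<Longrightarrow> S \<subseteq> mors G \<Longrightarrow>
    T (\<lambda>h. if h \<in> S then a h else 0) = (\<Sum>f\<in>S. a f * T (single 1 f))" for S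
  proof (induction S rule: finite_induct)
    case empty
    then show ?case using T0 by (simp add: algebra_ops)
  next
    case (insert f S)
    have "(\<lambda>h. if h \<in> insert f S then a h else 0) =
        single (a f) f \<oplus>\<^bsub>Nabla\<^esub> (\<lambda>h. if h \<in> S then a h else 0)"
      using insert by (auto simp: algebra_ops single_def)
    moreover have "(\<lambda>h. if h \<in> S then a h else 0) \<in> carrier Nabla"
      using insert by (auto simp: algebra_carrier simp del: split_paired_All)
    ultimately have "T (\<lambda>h. if h \<in> insert f S then a h else 0) =
        T (single (a f) f) + T (\<lambda>h. if h \<in> S then a h else 0)"
      using insert.prems by (simp only: add single_closed insert_subset)
    then show ?case using insert lin[of f "a f"] by (simp only: sum.insert[OF insert.hyps(1,2)] insert_subset)
  qed
  have "(\<lambda>h. if h \<in> mors G then a h else 0) = a"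
    using a by (auto simp: algebra_carrier simp del: split_paired_All)
  then show ?thesis using step[OF finite_mors[OF finite_carrier] order_refl] by (simp only:)
qed


subsection \<open>Morphisms from trivial sections\<close>

lemma des_mor_closed:
  assumes s: "(U, V) \<in> sections G" and X: "subgroup X G" "V \<subseteq> X" "X \<subseteq> U"
  shows "des_mor X (U, V) \<in> mors G"
proof -
  note d = sectionsD[OF s]
  have "(X, X) \<in> sections G" by (rule diag_sectionI[OF X(1)])
  moreover have "conj_sec G \<one> (X, X) = (X, X)" using X d by (simp add: conj_sec_def conj_set_one)
  moreover have "U #> \<one> = U" using d by simp
  ultimately show ?thesis using s X unfolding mors_def des_mor_def below_def
    by (auto intro!: exI[of _ "\<one>"])
qed

lemma conj_mor_closed:
  assumes "subgroup X G" "g \<in> carrier G" shows "conj_mor G g X \<in> mors G"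
  using assms conj_set_subgroup[OF assms] diag_sectionI unfolding mors_def conj_mor_def below_def conj_sec_def
  by (auto intro!: exI[of _ g])

text \<open>
  Any element \<open>g\<close> of the coset represents the morphism, not just the one it was defined with. This
  freedom is used with the identity morphism of $(U,V)$ and $g\in U$.
\<close>

lemma mor_repD:
  assumes k: "k \<in> mors G" "k = ((U, V), (M, L), C)" and g: "g \<in> C"
  shows "C = M #> g" "g \<in> carrier G" "L \<subseteq> conj_set G g V" "conj_set G g U \<subseteq> M"
    "(U, V) \<in> sections G" "(M, L) \<in> sections G"
proof -
  obtain h where h: "C = M #> h" "(U, V) \<in> sections G" "(M, L) \<in> sections G"
    "h \<in> carrier G" "L \<subseteq> conj_set G h V" "conj_set G h U \<subseteq> M"
    using k by (elim morsE) auto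
  note d = sectionsD[OF h(2)] and e = sectionsD[OF h(3)]
  show "(U, V) \<in> sections G" "(M, L) \<in> sections G" by fact+
  show "C = M #> g" using repr_independence[of g M h] g h e by simp
  obtain m where m: "m \<in> M" "g = m \<otimes> h" using g h by (auto simp: r_coset_def)
  then have mc: "m \<in> carrier G" using e by auto
  then show "g \<in> carrier G" using m h by simp
  show "L \<subseteq> conj_set G g V"
    using conj_set_mono[OF h(5), of m] e(7)[OF m(1)] mc h(4) d by (simp add: m conj_set_comp)
  show "conj_set G g U \<subseteq> M"
    using conj_set_mono[OF h(6), of m] conj_set_self[OF e(1) m(1)] mc h(4) d by (simp add: m conj_set_comp)
qed

text \<open>
  The identity on which everything rests: restricting along $k=Mg:(U,V)\to(M,L)$ and then to the
  trivial section of $X$ is the same as going to the trivial section of ${}^gX$ and then conjugating.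
\<close>

lemma mor_comp_des:
  assumes k: "k \<in> mors G" "k = ((U, V), (M, L), C)" and g: "g \<in> C"
    and X: "subgroup X G" "V \<subseteq> X" "X \<subseteq> U"
  shows "L \<subseteq> conj_set G g X" "conj_set G g X \<subseteq> M"
    "mor_comp G k (des_mor X (U, V)) = mor_comp G (des_mor (conj_set G g X) (M, L)) (conj_mor G g X)"
proof -
  note r = mor_repD[OF k g]
  note d = sectionsD[OF r(5)] and e = sectionsD[OF r(6)]
  show le: "L \<subseteq> conj_set G g X" "conj_set G g X \<subseteq> M"
    using r(3,4) conj_set_mono[OF X(2), of g] conj_set_mono[OF X(3), of g] by auto
  have "(M #> g) <#> (U #> \<one>) = M #> (g \<otimes> \<one>)"
    by (rule mor_comp_cosets) (use d e r in auto)
  moreover have "(M #> \<one>) <#> (conj_set G g X #> g) = M #> (\<one> \<otimes> g)"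
    by (rule mor_comp_cosets)
      (use conj_set_subgroup[OF X(1) r(2)] le e r conj_set_one[of "conj_set G g X"] in auto)
  ultimately show "mor_comp G k (des_mor X (U, V)) =
      mor_comp G (des_mor (conj_set G g X) (M, L)) (conj_mor G g X)"
    using d e r k by (simp add: mor_comp_def des_mor_def conj_mor_def)
qed

lemma conj_mor_comp:
  assumes X: "subgroup X G" and g: "g \<in> carrier G" and h: "h \<in> carrier G"
  shows "mor_comp G (conj_mor G g (conj_set G h X)) (conj_mor G h X) = conj_mor G (g \<otimes> h) X"
proof -
  have c: "conj_set G g (conj_set G h X) = conj_set G (g \<otimes> h) X"
    using conj_set_comp[OF _ h g] subgroup.subset[OF X] by simp
  then have "(conj_set G (g \<otimes> h) X #> g) <#> (conj_set G h X #> h) = conj_set G (g \<otimes> h) X #> (g \<otimes> h)"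
    using conj_set_subgroup X g h by (intro mor_comp_cosets) auto
  then show ?thesis by (simp add: mor_comp_def conj_mor_def c)
qed

text \<open>
  Between trivial sections the order relation forces equality, so conjugations are the only morphisms
  and $\Pi$ is spanned by them.
\<close>

lemma diag_morE:
  assumes f: "f \<in> mors G" "src f = (H, H)" "tgt f = (K, K)"
  obtains g where "g \<in> carrier G" "f = conj_mor G g H" "K = conj_set G g H" "subgroup H G"
proof -
  obtain g where g: "f = ((H, H), (K, K), K #> g)" "(H, H) \<in> sections G" "(K, K) \<in> sections G"
    "g \<in> carrier G" "K \<subseteq> conj_set G g H" "conj_set G g H \<subseteq> K"
    using f by (elim morsE) auto
  then have "K = conj_set G g H" by auto
  then show ?thesis using that g diag_sectionD by (auto simp: conj_mor_def)
qed

lemma Pi_memI: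
  "f \<in> mors G \<Longrightarrow> diag (src f) \<Longrightarrow> diag (tgt f) \<Longrightarrow> single c f \<in> carrier PiAlg"
  by (auto simp: Pi_carrier[OF finite_carrier] single_def algebra_carrier)

lemma Pi_sub: "a \<in> carrier PiAlg \<Longrightarrow> a \<in> carrier Nabla"
  by (simp add: Pi_carrier[OF finite_carrier])


subsection \<open>The actions in coordinates\<close>

lemma SC_carrier: "m \<in> carrier SC \<longleftrightarrow>
    (\<forall>s. (s \<in> sections G \<longrightarrow> m s \<in> superclass_functions (sec_quot G s)) \<and>
         (s \<notin> sections G \<longrightarrow> m s = (\<lambda>W. 0)))"
  by (simp add: superclass_module_def)

lemma SC_add: "(m \<oplus>\<^bsub>SC\<^esub> m') s W = m s W + m' s W"
  by (simp add: superclass_module_def)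

lemma SC_smult: "(a \<odot>\<^bsub>SC\<^esub> m) s W =
    (\<Sum>f\<in>mors G. if src f = s then a f * superclass_act G f (m (tgt f)) W else 0)"
  by (simp add: superclass_module_def sum_filter[OF finite_carrier])

lemma SC_single: "f \<in> mors G \<Longrightarrow> (single c f \<odot>\<^bsub>SC\<^esub> m) s W =
    (if src f = s then c * superclass_act G f (m (tgt f)) W else 0)"
  by (simp add: SC_smult sum_single)

lemma TZ_carrier: "z \<in> carrier TZ \<longleftrightarrow> (\<forall>H. \<not> subgroup H G \<longrightarrow> z H = 0)"
  by (simp add: trivial_module_def)

lemma TZ_add: "(z \<oplus>\<^bsub>TZ\<^esub> w) H = z H + w H"
  by (simp add: trivial_module_def)

lemma TZ_smult: "(a \<odot>\<^bsub>TZ\<^esub> z) H =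
    (\<Sum>f\<in>mors G. if src f = (H, H) then a f * (if diag (tgt f) then z (fst (tgt f)) else 0) else 0)"
proof -
  have "(a \<odot>\<^bsub>TZ\<^esub> z) H = (\<Sum>(f, K) | f \<in> mors G \<and> src f = (H, H) \<and> tgt f = (K, K). a f * z K)"
    by (simp add: trivial_module_def)
  also have "\<dots> = (\<Sum>f | f \<in> mors G \<and> src f = (H, H) \<and> diag (tgt f). a f * z (fst (tgt f)))"
    by (rule sum.reindex_bij_witness[of _ "\<lambda>f. (f, fst (tgt f))" fst]) (auto simp: diag_def prod_eq_iff)
  finally show ?thesis
    by (subst (asm) sum_filter[OF finite_carrier]) (auto intro!: sum.cong)
qed

lemma TZ_single: "f \<in> mors G \<Longrightarrow> (single c f \<odot>\<^bsub>TZ\<^esub> z) H =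
    (if src f = (H, H) \<and> diag (tgt f) then c * z (fst (tgt f)) else 0)"
  by (simp add: TZ_smult sum_single)

lemma SC_zero_outside:
  "m \<in> carrier SC \<Longrightarrow> s \<notin> sections G \<or> \<not> subgroup W (sec_quot G s) \<Longrightarrow> m s W = 0"
  by (cases "s \<in> sections G") (simp_all add: SC_carrier superclass_functions_def del: split_paired_All)

lemma SC_left_module: "left_module Nabla SC"
  by (rule superclass_left_module[OF finite_carrier])


section \<open>The universal property of the functor of super class functions\<close>

text \<open>
  The group $H/H$ is trivial, so a super class function on it is its value at the only subgroup,
  which as a set of cosets is \<open>coset_set G H H\<close>. Collecting these values is the counit of the
  coinduction.
\<close>

definition sc_eval :: "('a sec \<Rightarrow> 'a set set \<Rightarrow> int) \<Rightarrow> 'a set \<Rightarrow> int"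
  where "sc_eval = (\<lambda>m\<in>carrier SC. \<lambda>H. m (H, H) (coset_set G H H))"

lemma sc_eval_apply: "m \<in> carrier SC \<Longrightarrow> sc_eval m H = m (H, H) (coset_set G H H)"
  by (simp add: sc_eval_def)

lemma sc_eval_hom: "sc_eval \<in> mod_hom PiAlg SC TZ"
proof -
  interpret SC: left_module Nabla SC by (rule SC_left_module)
  show ?thesis
  proof (rule mod_homI)
    show "sc_eval \<in> extensional (carrier SC)" by (simp add: sc_eval_def)
    show "sc_eval m \<in> carrier TZ" if "m \<in> carrier SC" for m
      using that diag_sectionD by (auto simp: TZ_carrier sc_eval_apply intro!: SC_zero_outside)
    show "sc_eval (m \<oplus>\<^bsub>SC\<^esub> m') = sc_eval m \<oplus>\<^bsub>TZ\<^esub> sc_eval m'" if "m \<in> carrier SC" "m' \<in> carrier SC" for m m'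
      using that by (intro ext) (simp add: sc_eval_apply TZ_add SC_add)
    fix a m assume a: "a \<in> carrier PiAlg" and m: "m \<in> carrier SC"
    show "sc_eval (a \<odot>\<^bsub>SC\<^esub> m) = a \<odot>\<^bsub>TZ\<^esub> sc_eval m"
    proof
      fix H
      have "(if src f = (H, H) then a f * superclass_act G f (m (tgt f)) (coset_set G H H) else 0) =
            (if src f = (H, H) then a f * (if diag (tgt f) then sc_eval m (fst (tgt f)) else 0) else 0)"
        if f: "f \<in> mors G" for f
      proof (cases "src f = (H, H) \<and> a f \<noteq> 0")
        case True
        then have "diag (tgt f)" using a by (auto simp: Pi_carrier[OF finite_carrier] simp del: split_paired_All)
        then obtain K where K: "tgt f = (K, K)" by (metis diag_def prod.collapse)
        then obtain g where g: "g \<in> carrier G" "f = conj_mor G g H" "K = conj_set G g H" "subgroup H G"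
          using f True diag_morE by metis
        have "m (K, K) \<in> superclass_functions (sec_quot G (K, K))"
          using m mor_src(2)[OF f] K unfolding SC_carrier by metis
        then have "superclass_act G f (m (K, K)) (coset_set G H H) = m (K, K) (coset_set G K K)"
          using act_eq[OF f, of H H K K "K #> g" g "m (K, K)" H] g
            rcos_self[OF g(1)] conj_set_subgroup[OF g(4,1)] by (simp add: conj_mor_def)
        then show ?thesis using K m by (simp add: sc_eval_apply diag_def)
      qed auto
      then show "sc_eval (a \<odot>\<^bsub>SC\<^esub> m) H = (a \<odot>\<^bsub>TZ\<^esub> sc_eval m) H"
        using m a by (simp add: sc_eval_apply SC.smult_closed Pi_sub SC_smult TZ_smult cong: sum.cong)
    qed
  qed
qed

text \<open>
  The value of a super class function at $X/V$ can be read off at the trivial section $(X,X)$ after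
  restriction to $X/V$ and deflation to $X/X$; so elements of $B^*$ are determined by what the
  algebra sends to trivial sections.
\<close>

lemma sc_eval_des:
  assumes m: "m \<in> carrier SC" and s: "(U, V) \<in> sections G" and X: "subgroup X G" "V \<subseteq> X" "X \<subseteq> U"
  shows "sc_eval (single 1 (des_mor X (U, V)) \<odot>\<^bsub>SC\<^esub> m) X = m (U, V) (coset_set G X V)"
proof -
  interpret SC: left_module Nabla SC by (rule SC_left_module)
  note f = des_mor_closed[OF s X] and d = sectionsD[OF s]
  have "m (U, V) \<in> superclass_functions (sec_quot G (U, V))" using m s unfolding SC_carrier by blast
  then have "superclass_act G (des_mor X (U, V)) (m (U, V)) (coset_set G X X)
      = m (U, V) (coset_set G (conj_set G \<one> X) V)"
    by (intro act_eq[OF f, where U = X and M = U and C = U]) (use d X subgroup.one_closed in \<open>auto simp: des_mor_def\<close>)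
  then show ?thesis
    using f m d X by (simp add: sc_eval_apply SC.smult_closed SC_single conj_set_one)
qed

lemma sc_eval_joint_inj:
  assumes F: "left_module Nabla F"
    and p: "p \<in> mod_hom Nabla F SC" and q: "q \<in> mod_hom Nabla F SC"
    and eq: "\<And>y. y \<in> carrier F \<Longrightarrow> sc_eval (p y) = sc_eval (q y)"
  shows "y \<in> carrier F \<Longrightarrow> p y = q y"
proof (intro ext)
  interpret F: left_module Nabla F by fact
  fix s :: "'a sec" and W assume y: "y \<in> carrier F"
  note py = mod_homD(2)[OF p y] and qy = mod_homD(2)[OF q y]
  obtain U V where s: "s = (U, V)" by (cases s)
  show "p y s W = q y s W"
  proof (cases "s \<in> sections G \<and> subgroup W (sec_quot G s)")
    case True
    then have sec: "(U, V) \<in> sections G" and W: "subgroup W (sec_quot G (U, V))" using s by auto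
    note w = quot_subD[OF sec W]
    note f = des_mor_closed[OF sec w(1-3)]
    have "sc_eval (p (single 1 (des_mor (\<Union>W) (U, V)) \<odot>\<^bsub>F\<^esub> y)) = sc_eval (q (single 1 (des_mor (\<Union>W) (U, V)) \<odot>\<^bsub>F\<^esub> y))"
      by (rule eq) (use f y in \<open>simp add: F.smult_closed\<close>)
    then have "p y (U, V) (coset_set G (\<Union>W) V) = q y (U, V) (coset_set G (\<Union>W) V)"
      using sc_eval_des[OF py sec w(1-3)] sc_eval_des[OF qy sec w(1-3)] f y
      by (simp add: mod_homD(4)[OF p] mod_homD(4)[OF q])
    then show ?thesis using w(4) s by simp
  next
    case False
    then show ?thesis using SC_zero_outside[OF py] SC_zero_outside[OF qy] by metis
  qed
qed

text \<open>
  \<open>sc_eval_des\<close> leaves no choice for a homomorphism into $B^*$ that lifts a given \<open>\<theta>\<close>. Here \<open>F\<close> is a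
  module over the whole algebra while \<open>\<theta>\<close> is linear over $\Pi$ only; the idempotent $c_1^+$ of
  $\Pi$ acts as the identity on $Z$, so such a \<open>\<theta>\<close> is the same as a $\Pi$-homomorphism
  $c_1^+F\to Z$.
\<close>

definition coextend ::
  "('a mor \<Rightarrow> int, 'f, 'e) module_scheme \<Rightarrow> ('f \<Rightarrow> 'a set \<Rightarrow> int) \<Rightarrow> 'f \<Rightarrow> 'a sec \<Rightarrow> 'a set set \<Rightarrow> int"
  where "coextend F \<theta> = (\<lambda>y\<in>carrier F. \<lambda>s W.
    if s \<in> sections G \<and> subgroup W (sec_quot G s)
    then \<theta> (single 1 (des_mor (\<Union>W) s) \<odot>\<^bsub>F\<^esub> y) (\<Union>W) else 0)"

context
  fixes F :: "('a mor \<Rightarrow> int, 'f, 'e) module_scheme" and \<theta> :: "'f \<Rightarrow> 'a set \<Rightarrow> int"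
  assumes F: "left_module Nabla F" and \<theta>: "\<theta> \<in> mod_hom PiAlg F TZ"
begin

interpretation F: left_module Nabla F by (rule F)

lemma coextend_apply:
  assumes y: "y \<in> carrier F" and s: "(U, V) \<in> sections G" and X: "subgroup X G" "V \<subseteq> X" "X \<subseteq> U"
  shows "coextend F \<theta> y (U, V) (coset_set G X V) = \<theta> (single 1 (des_mor X (U, V)) \<odot>\<^bsub>F\<^esub> y) X"
  using y s quot_subI[OF s X] by (simp add: coextend_def)

lemma theta_conj:
  assumes y: "y \<in> carrier F" and X: "subgroup X G" and g: "g \<in> carrier G"
  shows "\<theta> (single c (conj_mor G g X) \<odot>\<^bsub>F\<^esub> y) X = c * \<theta> y (conj_set G g X)"
proof -
  note f = conj_mor_closed[OF X g]
  have "single c (conj_mor G g X) \<in> carrier PiAlg" by (rule Pi_memI[OF f]) (simp_all add: diag_def)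
  then show ?thesis using mod_homD(4)[OF \<theta> _ y] f by (simp add: TZ_single diag_def)
qed

text \<open>
  Conjugations act trivially on $Z$. This is the reason both for the invariance of \<open>coextend\<close>
  under conjugation inside a section and for its compatibility with morphisms.
\<close>

lemma theta_des:
  assumes y: "y \<in> carrier F" and k: "k \<in> mors G" "k = ((U, V), (M, L), C)" and g: "g \<in> C"
    and X: "subgroup X G" "V \<subseteq> X" "X \<subseteq> U"
  shows "\<theta> (single 1 (mor_comp G k (des_mor X (U, V))) \<odot>\<^bsub>F\<^esub> y) X
    = \<theta> (single 1 (des_mor (conj_set G g X) (M, L)) \<odot>\<^bsub>F\<^esub> y) (conj_set G g X)"
proof -
  note r = mor_repD[OF k g] and c = mor_comp_des[OF k g X]
  note sub = conj_set_subgroup[OF X(1) r(2)]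
  note cl = conj_mor_closed[OF X(1) r(2)] des_mor_closed[OF r(6) sub c(1,2)]
  have "single 1 (mor_comp G k (des_mor X (U, V))) =
      single 1 (conj_mor G g X) \<otimes>\<^bsub>Nabla\<^esub> single 1 (des_mor (conj_set G g X) (M, L))"
    using cl c(3) by (simp add: single_mult)
  then show ?thesis
    using cl y theta_conj[OF _ X(1) r(2), of _ 1] by (simp add: F.smult_assoc F.smult_closed)
qed

text \<open>
  Conjugation by $u\in U$ is treated by applying \<open>theta_des\<close> to the identity morphism of
  $(U,V)$, represented by $u$.
\<close>

lemma coextend_closed:
  assumes y: "y \<in> carrier F" shows "coextend F \<theta> y \<in> carrier SC"
  unfolding SC_carrier
proof (intro allI conjI impI)
  fix s
  show "coextend F \<theta> y s = (\<lambda>W. 0)" if "s \<notin> sections G" using that y by (simp add: coextend_def)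
  assume s: "s \<in> sections G"
  obtain U V where UV: "s = (U, V)" by (cases s)
  note sec = s[unfolded UV]
  note d = sectionsD[OF sec]
  show "coextend F \<theta> y s \<in> superclass_functions (sec_quot G s)"
    unfolding superclass_functions_def
  proof (safe, goal_cases)
    case (1 W)
    then show ?case using y by (simp add: coextend_def)
  next
    case (2 W x)
    note w = quot_subD[OF sec 2(1)[unfolded UV]]
    obtain u where u: "u \<in> U" "x = V #> u"
      using 2(2) by (auto simp: UV quot_carrier[OF sec] coset_set_def)
    let ?X = "\<Union>W" and ?Y = "conj_set G u (\<Union>W)"
    have idm: "mor_id (U, V) \<in> mors G" "mor_id (U, V) = ((U, V), (U, V), U)"
      using mor_id_closed[OF sec] by (simp_all add: mor_id_def)
    have cW: "conj_set (sec_quot G s) x W = coset_set G ?Y V"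
      by (subst w(4)) (simp only: UV u quot_conj[OF sec w(3) u(1)])
    have Y: "subgroup ?Y G" "V \<subseteq> ?Y" "?Y \<subseteq> U"
      using conj_set_subgroup[OF w(1)] u d mor_comp_des(1,2)[OF idm u(1) w(1-3)] by auto
    have "coextend F \<theta> y s (conj_set (sec_quot G s) x W) = \<theta> (single 1 (des_mor ?Y (U, V)) \<odot>\<^bsub>F\<^esub> y) ?Y"
      unfolding cW unfolding UV by (rule coextend_apply[OF y sec Y])
    also have "\<dots> = \<theta> (single 1 (mor_comp G (mor_id (U, V)) (des_mor ?X (U, V))) \<odot>\<^bsub>F\<^esub> y) ?X"
      by (rule theta_des[OF y idm u(1) w(1-3), symmetric])
    also have "mor_comp G (mor_id (U, V)) (des_mor ?X (U, V)) = des_mor ?X (U, V)"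
      using mor_comp_id(2)[OF des_mor_closed[OF sec w(1-3)]] by simp
    also have "\<theta> (single 1 (des_mor ?X (U, V)) \<odot>\<^bsub>F\<^esub> y) ?X = coextend F \<theta> y s W"
      using coextend_apply[OF y sec w(1-3)] w(4) by (simp add: UV)
    finally show ?case .
  qed
qed

text \<open>
  By \<open>additive_eq_sum\<close> the action of \<open>a\<close> can be compared morphism by morphism. A morphism \<open>k\<close> whose
  source is not the section considered contributes $0$ on both sides, and for the others
  \<open>theta_des\<close> moves $X$ to ${}^gX$ exactly as the action on super class functions does.
\<close>

lemma coextend_hom: "coextend F \<theta> \<in> mod_hom Nabla F SC"
proof (rule mod_homI)
  show "coextend F \<theta> \<in> extensional (carrier F)" by (simp add: coextend_def)
  show "coextend F \<theta> y \<in> carrier SC" if "y \<in> carrier F" for y by (rule coextend_closed[OF that])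
next
  fix x y assume xy: "x \<in> carrier F" "y \<in> carrier F"
  show "coextend F \<theta> (x \<oplus>\<^bsub>F\<^esub> y) = coextend F \<theta> x \<oplus>\<^bsub>SC\<^esub> coextend F \<theta> y"
  proof (intro ext)
    fix s :: "'a sec" and W
    obtain U V where s: "s = (U, V)" by (cases s)
    show "coextend F \<theta> (x \<oplus>\<^bsub>F\<^esub> y) s W = (coextend F \<theta> x \<oplus>\<^bsub>SC\<^esub> coextend F \<theta> y) s W"
    proof (cases "s \<in> sections G \<and> subgroup W (sec_quot G s)")
      case True
      then have "des_mor (\<Union>W) s \<in> mors G"
        using des_mor_closed quot_subD(1-3) unfolding s by metis
      then show ?thesis using xy True
        by (simp add: coextend_def SC_add F.smult_r_distr mod_homD(3)[OF \<theta>] F.smult_closed TZ_add)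
    qed (use xy in \<open>auto simp: coextend_def SC_add\<close>)
  qed
next
  fix a y assume a: "a \<in> carrier Nabla" and y: "y \<in> carrier F"
  have ay: "a \<odot>\<^bsub>F\<^esub> y \<in> carrier F" using a y by (rule F.smult_closed)
  interpret SC: left_module Nabla SC by (rule SC_left_module)
  show "coextend F \<theta> (a \<odot>\<^bsub>F\<^esub> y) = a \<odot>\<^bsub>SC\<^esub> coextend F \<theta> y"
  proof (intro ext)
    fix s :: "'a sec" and W
    obtain U V where UV: "s = (U, V)" by (cases s)
    show "coextend F \<theta> (a \<odot>\<^bsub>F\<^esub> y) s W = (a \<odot>\<^bsub>SC\<^esub> coextend F \<theta> y) s W"
    proof (cases "s \<in> sections G \<and> subgroup W (sec_quot G s)")
      case True
      then have sec: "(U, V) \<in> sections G" and W: "subgroup W (sec_quot G (U, V))" using UV by auto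
      note w = quot_subD[OF sec W]
      let ?X = "\<Union>W" let ?e = "des_mor ?X (U, V)"
      note e = des_mor_closed[OF sec w(1-3)]
      define T where "T = (\<lambda>b. \<theta> (single 1 ?e \<odot>\<^bsub>F\<^esub> (b \<odot>\<^bsub>F\<^esub> y)) ?X)"
      have "coextend F \<theta> (a \<odot>\<^bsub>F\<^esub> y) s W = T a"
        using coextend_apply[OF ay sec w(1-3)] w(4) by (simp add: UV T_def)
      also have "T a = (\<Sum>k\<in>mors G. a k * T (single 1 k))"
        by (rule additive_eq_sum[OF _ a])
          (use e y in \<open>simp add: T_def F.smult_l_distr F.smult_r_distr F.smult_closed mod_homD(3)[OF \<theta>] TZ_add\<close>)
      also have "\<dots> = (\<Sum>k\<in>mors G. if src k = s then a k * superclass_act G k (coextend F \<theta> y (tgt k)) W else 0)"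
      proof (rule sum.cong[OF refl])
        fix k assume k: "k \<in> mors G"
        show "a k * T (single 1 k) = (if src k = s then a k * superclass_act G k (coextend F \<theta> y (tgt k)) W else 0)"
        proof (cases "src k = s")
          case True
          obtain M L C where kk: "k = ((U, V), (M, L), C)" using True UV by (cases k) auto
          obtain g where g: "g \<in> C" using morsE[OF k] kk rcos_self sectionsD(1) by (metis prod.inject)
          note r = mor_repD[OF k kk g] and c = mor_comp_des[OF k kk g w(1-3)]
          have bc: "coextend F \<theta> y (M, L) \<in> superclass_functions (sec_quot G (M, L))"
            using coextend_closed[OF y] r(6) unfolding SC_carrier by blast
          have "T (single 1 k) = \<theta> (single 1 (mor_comp G k ?e) \<odot>\<^bsub>F\<^esub> y) ?X"
            using e k y kk by (simp add: T_def F.smult_assoc[symmetric] single_mult)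
          also have "\<dots> = \<theta> (single 1 (des_mor (conj_set G g ?X) (M, L)) \<odot>\<^bsub>F\<^esub> y) (conj_set G g ?X)"
            by (rule theta_des[OF y k kk g w(1-3)])
          also have "\<dots> = coextend F \<theta> y (M, L) (coset_set G (conj_set G g ?X) L)"
            by (rule coextend_apply[OF y r(6) conj_set_subgroup[OF w(1) r(2)] c(1,2), symmetric])
          also have "\<dots> = superclass_act G k (coextend F \<theta> y (M, L)) W"
            using act_eq[OF k kk g bc w(1-3)] w(4) by simp
          finally show ?thesis using True kk by simp
        next
          case False
          then have "T (single 1 k) = \<theta> \<zero>\<^bsub>F\<^esub> ?X"
            using e k y UV by (simp add: T_def F.smult_assoc[symmetric] single_mult)
          also have "\<dots> = 0"
            using mod_homD(3)[OF \<theta>, of "\<zero>\<^bsub>F\<^esub>" "\<zero>\<^bsub>F\<^esub>"] by (simp add: fun_eq_iff TZ_add)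
          finally show ?thesis using False by simp
        qed
      qed
      finally show ?thesis by (simp add: SC_smult)
    next
      case False
      have "(a \<odot>\<^bsub>SC\<^esub> coextend F \<theta> y) \<in> carrier SC" by (rule SC.smult_closed[OF a coextend_closed[OF y]])
      then show ?thesis using False SC_zero_outside coextend_closed[OF ay] by metis
    qed
  qed
qed

lemma sc_eval_coextend:
  assumes y: "y \<in> carrier F" shows "sc_eval (coextend F \<theta> y) = \<theta> y"
proof
  fix H
  show "sc_eval (coextend F \<theta> y) H = \<theta> y H"
  proof (cases "subgroup H G")
    case True
    have [simp]: "conj_set G \<one> H = H" using conj_set_one subgroup.subset[OF True] by blast
    have "des_mor H (H, H) = conj_mor G \<one> H"
      using subgroup.subset[OF True] by (simp add: des_mor_def conj_mor_def)
    then show ?thesis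
      using coextend_apply[OF y diag_sectionI[OF True] True] theta_conj[OF y True, of \<one> 1] y
      by (simp add: sc_eval_apply coextend_closed)
  next
    case False
    then show ?thesis
      using mod_homD(2)[OF \<theta> y] mod_homD(2)[OF sc_eval_hom coextend_closed[OF y]]
      by (simp add: TZ_carrier)
  qed
qed

end


section \<open>Super class functions are coinduced\<close>

abbreviation "CoindZ \<equiv> coind_module Nabla (c1_plus G) TZ"

lemma e_closed: "c1_plus G \<in> carrier Nabla" and e_idem: "c1_plus G \<otimes>\<^bsub>Nabla\<^esub> c1_plus G = c1_plus G"
  by (simp_all add: c1_plus_closed c1_plus_idem finite_carrier)

lemma bimodule_carrier:
  "x \<in> carrier (corner_bimodule Nabla (c1_plus G)) \<longleftrightarrow> x \<in> carrier Nabla \<and> c1_plus G \<otimes>\<^bsub>Nabla\<^esub> x = x"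
proof
  assume "x \<in> carrier (corner_bimodule Nabla (c1_plus G))"
  then obtain y where "y \<in> carrier Nabla" "x = c1_plus G \<otimes>\<^bsub>Nabla\<^esub> y" by (auto simp: corner_bimodule_def)
  then show "x \<in> carrier Nabla \<and> c1_plus G \<otimes>\<^bsub>Nabla\<^esub> x = x"
    using e_closed e_idem by (simp add: D.m_assoc[symmetric])
next
  assume "x \<in> carrier Nabla \<and> c1_plus G \<otimes>\<^bsub>Nabla\<^esub> x = x"
  then show "x \<in> carrier (corner_bimodule Nabla (c1_plus G))"
    by (simp add: corner_bimodule_def) metis
qed

lemma bimodule_ops:
  "add (corner_bimodule Nabla (c1_plus G)) = add Nabla"
  "smult (corner_bimodule Nabla (c1_plus G)) = monoid.mult Nabla"
  by (simp_all add: corner_bimodule_def)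

lemma bimodule_mult_closed:
  "x \<in> carrier (corner_bimodule Nabla (c1_plus G)) \<Longrightarrow> a \<in> carrier Nabla \<Longrightarrow>
    x \<otimes>\<^bsub>Nabla\<^esub> a \<in> carrier (corner_bimodule Nabla (c1_plus G))"
  using e_closed by (simp add: bimodule_carrier D.m_assoc[symmetric])

lemma Pi_unit:
  assumes "a \<in> carrier PiAlg"
  shows "c1_plus G \<otimes>\<^bsub>Nabla\<^esub> a = a" "a \<otimes>\<^bsub>Nabla\<^esub> c1_plus G = a"
  using assms
  by (auto simp: Pi_carrier[OF finite_carrier] fun_eq_iff e_left[OF finite_carrier] e_right[OF finite_carrier]
      simp del: split_paired_All)

lemma e_bimodule: "c1_plus G \<in> carrier (corner_bimodule Nabla (c1_plus G))"
  by (simp add: bimodule_carrier e_closed e_idem)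

lemma coind_simps:
  "carrier CoindZ = mod_hom PiAlg (corner_bimodule Nabla (c1_plus G)) TZ"
  "\<phi> \<oplus>\<^bsub>CoindZ\<^esub> \<psi> = (\<lambda>x\<in>carrier (corner_bimodule Nabla (c1_plus G)). \<phi> x \<oplus>\<^bsub>TZ\<^esub> \<psi> x)"
  "a \<odot>\<^bsub>CoindZ\<^esub> \<phi> = (\<lambda>x\<in>carrier (corner_bimodule Nabla (c1_plus G)). \<phi> (x \<otimes>\<^bsub>Nabla\<^esub> a))"
  by (simp_all add: coind_module_def)

lemma Coind_left_module: "left_module Nabla CoindZ"
  by (rule coind_left_module[OF D.ring_axioms e_closed e_idem trivial_left_module[OF finite_carrier]])

text \<open>
  Evaluation at $c_1^+$ is the counit of the coinduction on the other side of the isomorphism. It is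
  this $\Pi$-homomorphism whose lift to $B^*$ gives the inverse of \<open>sc_to_coind\<close>.
\<close>

lemma coind_eval_hom: "(\<lambda>\<phi>\<in>carrier CoindZ. \<phi> (c1_plus G)) \<in> mod_hom PiAlg CoindZ TZ"
proof -
  interpret C: left_module Nabla CoindZ by (rule Coind_left_module)
  show ?thesis
  proof (rule mod_homI)
    fix a \<phi> assume a: "a \<in> carrier PiAlg" and p: "\<phi> \<in> carrier CoindZ"
    have "\<phi> (a \<otimes>\<^bsub>Nabla\<^esub> c1_plus G) = a \<odot>\<^bsub>TZ\<^esub> \<phi> (c1_plus G)"
      using mod_homD(4)[OF p[unfolded coind_simps(1)] a e_bimodule] by (simp add: bimodule_ops)
    then show "(\<lambda>\<phi>\<in>carrier CoindZ. \<phi> (c1_plus G)) (a \<odot>\<^bsub>CoindZ\<^esub> \<phi>) =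
        a \<odot>\<^bsub>TZ\<^esub> (\<lambda>\<phi>\<in>carrier CoindZ. \<phi> (c1_plus G)) \<phi>"
      using p C.smult_closed[OF Pi_sub[OF a] p] Pi_unit[OF a] by (simp add: coind_simps(3) e_bimodule)
  next
    show "(\<lambda>\<phi>\<in>carrier CoindZ. \<phi> (c1_plus G)) \<phi> \<in> carrier TZ" if "\<phi> \<in> carrier CoindZ" for \<phi>
      using mod_homD(2)[OF that[unfolded coind_simps(1)] e_bimodule] that by simp
  qed (simp_all, simp add: coind_simps(2) e_bimodule)
qed

definition sc_to_coind :: "('a sec \<Rightarrow> 'a set set \<Rightarrow> int) \<Rightarrow> ('a mor \<Rightarrow> int) \<Rightarrow> 'a set \<Rightarrow> int"
  where "sc_to_coind = (\<lambda>m\<in>carrier SC. \<lambda>x\<in>carrier (corner_bimodule Nabla (c1_plus G)). sc_eval (x \<odot>\<^bsub>SC\<^esub> m))"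

lemma sc_to_coind_hom: "sc_to_coind \<in> mod_hom Nabla SC CoindZ"
proof -
  interpret SC: left_module Nabla SC by (rule SC_left_module)
  let ?B = "corner_bimodule Nabla (c1_plus G)"
  note ev = mod_homD[OF sc_eval_hom]
  have B: "x \<in> carrier ?B \<Longrightarrow> x \<in> carrier Nabla" for x by (simp add: bimodule_carrier)
  have cl: "(\<lambda>x\<in>carrier ?B. sc_eval (x \<odot>\<^bsub>SC\<^esub> m)) \<in> mod_hom PiAlg ?B TZ" if m: "m \<in> carrier SC" for m
  proof (rule mod_homI)
    fix x y assume xy: "x \<in> carrier ?B" "y \<in> carrier ?B"
    have "x \<oplus>\<^bsub>Nabla\<^esub> y \<in> carrier ?B" using xy e_closed by (simp add: bimodule_carrier D.r_distr)
    then show "(\<lambda>x\<in>carrier ?B. sc_eval (x \<odot>\<^bsub>SC\<^esub> m)) (x \<oplus>\<^bsub>?B\<^esub> y) =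
      (\<lambda>x\<in>carrier ?B. sc_eval (x \<odot>\<^bsub>SC\<^esub> m)) x \<oplus>\<^bsub>TZ\<^esub> (\<lambda>x\<in>carrier ?B. sc_eval (x \<odot>\<^bsub>SC\<^esub> m)) y"
      using xy m B by (simp add: bimodule_ops SC.smult_l_distr ev(3) SC.smult_closed)
  next
    fix a x assume a: "a \<in> carrier PiAlg" and x: "x \<in> carrier ?B"
    have "a \<otimes>\<^bsub>Nabla\<^esub> x \<in> carrier ?B"
      using bimodule_mult_closed[of a x] a x Pi_unit Pi_sub by (simp add: bimodule_carrier)
    then show "(\<lambda>x\<in>carrier ?B. sc_eval (x \<odot>\<^bsub>SC\<^esub> m)) (a \<odot>\<^bsub>?B\<^esub> x) =
      a \<odot>\<^bsub>TZ\<^esub> (\<lambda>x\<in>carrier ?B. sc_eval (x \<odot>\<^bsub>SC\<^esub> m)) x"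
      using a x m B Pi_sub by (simp add: bimodule_ops SC.smult_assoc ev(4) SC.smult_closed)
  qed (use m B in \<open>simp_all add: ev(2) SC.smult_closed\<close>)
  show ?thesis
  proof (rule mod_homI)
    show "sc_to_coind \<in> extensional (carrier SC)" by (simp add: sc_to_coind_def)
    show "sc_to_coind m \<in> carrier CoindZ" if "m \<in> carrier SC" for m
      using cl[OF that] that by (simp add: sc_to_coind_def coind_simps(1))
    show "sc_to_coind (m \<oplus>\<^bsub>SC\<^esub> m') = sc_to_coind m \<oplus>\<^bsub>CoindZ\<^esub> sc_to_coind m'"
      if "m \<in> carrier SC" "m' \<in> carrier SC" for m m'
      using that B unfolding coind_simps
      by (simp add: sc_to_coind_def) (intro restrict_ext, simp add: SC.smult_r_distr ev(3) SC.smult_closed)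
    show "sc_to_coind (a \<odot>\<^bsub>SC\<^esub> m) = a \<odot>\<^bsub>CoindZ\<^esub> sc_to_coind m"
      if "a \<in> carrier Nabla" "m \<in> carrier SC" for a m
      using that B unfolding coind_simps
      by (simp add: sc_to_coind_def SC.smult_closed)
        (intro restrict_ext, simp add: SC.smult_assoc bimodule_mult_closed)
  qed
qed

text \<open>
  Both modules represent $F\mapsto\mathrm{Hom}_\Pi(c_1^+F,Z)$. Concretely, \<open>sc_to_coind\<close> and the
  lift of evaluation at $c_1^+$ are mutually inverse because both composites are compatible with
  the two evaluations, and a homomorphism into either module is determined by its composite with
  the evaluation.
\<close>

theorem superclass_coinduced: "mod_isomorphic Nabla SC CoindZ"
proof -
  interpret SC: left_module Nabla SC by (rule SC_left_module)
  interpret C: left_module Nabla CoindZ by (rule Coind_left_module)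
  let ?B = "corner_bimodule Nabla (c1_plus G)"
  let ?e = "\<lambda>\<phi>\<in>carrier CoindZ. \<phi> (c1_plus G)"
  let ?\<Psi> = "coextend CoindZ ?e"
  note \<Psi> = coextend_hom[OF Coind_left_module coind_eval_hom]
    and ev\<Psi> = sc_eval_coextend[OF Coind_left_module coind_eval_hom]
  note \<Phi> = sc_to_coind_hom
  have B: "x \<in> carrier ?B \<Longrightarrow> x \<in> carrier Nabla" for x by (simp add: bimodule_carrier)
  have "sc_to_coind (?\<Psi> \<phi>) = \<phi>" if p: "\<phi> \<in> carrier CoindZ" for \<phi>
  proof (rule extensionalityI)
    have \<Psi>p: "?\<Psi> \<phi> \<in> carrier SC" by (rule mod_homD(2)[OF \<Psi> p])
    show "sc_to_coind (?\<Psi> \<phi>) \<in> extensional (carrier ?B)" using \<Psi>p by (simp add: sc_to_coind_def)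
    show "\<phi> \<in> extensional (carrier ?B)" using mod_homD(1) p coind_simps(1) by blast
    fix x assume x: "x \<in> carrier ?B"
    have "sc_to_coind (?\<Psi> \<phi>) x = sc_eval (?\<Psi> (x \<odot>\<^bsub>CoindZ\<^esub> \<phi>))"
      using x p B \<Psi>p by (simp add: sc_to_coind_def mod_homD(4)[OF \<Psi>])
    also have "\<dots> = (x \<odot>\<^bsub>CoindZ\<^esub> \<phi>) (c1_plus G)"
      using x p B by (simp add: ev\<Psi> C.smult_closed)
    also have "\<dots> = \<phi> x" using x by (simp add: coind_simps(3) e_bimodule) (simp add: bimodule_carrier)
    finally show "sc_to_coind (?\<Psi> \<phi>) x = \<phi> x" .
  qed
  moreover have "?\<Psi> (sc_to_coind m) = m" if m: "m \<in> carrier SC" for m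
  proof -
    have id: "(\<lambda>m\<in>carrier SC. m) \<in> mod_hom Nabla SC SC" by (rule mod_homI) (simp_all add: SC.smult_closed)
    have "sc_eval (compose (carrier SC) ?\<Psi> sc_to_coind m) = sc_eval ((\<lambda>m\<in>carrier SC. m) m)"
      if m: "m \<in> carrier SC" for m
    proof -
      have pm: "sc_to_coind m \<in> carrier CoindZ" by (rule mod_homD(2)[OF \<Phi> m])
      have "sc_eval (?\<Psi> (sc_to_coind m)) = sc_eval (c1_plus G \<odot>\<^bsub>SC\<^esub> m)"
        using pm m by (simp add: ev\<Psi>) (simp add: sc_to_coind_def e_bimodule)
      also have "\<dots> = c1_plus G \<odot>\<^bsub>TZ\<^esub> sc_eval m"
        using Pi_carrier[OF finite_carrier] by (intro mod_homD(4)[OF sc_eval_hom _ m])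
         (simp add: e_closed c1_plus_alt[OF finite_carrier], auto simp: diag_def mor_id_def)
      also have "\<dots> = sc_eval m"
        using left_module.smult_one[OF trivial_left_module[OF finite_carrier] mod_homD(2)[OF sc_eval_hom m]]
        by (simp add: corner_ring_def)
      finally show ?thesis using m by (simp add: compose_eq)
    qed
    from sc_eval_joint_inj[OF SC_left_module mod_hom_compose[OF \<Phi> \<Psi> SC_left_module] id this m]
    show ?thesis using m by (simp add: compose_eq)
  qed
  ultimately have "bij_betw sc_to_coind (carrier SC) (carrier CoindZ)"
    using mod_homD(2)[OF \<Phi>] mod_homD(2)[OF \<Psi>] by (intro bij_betwI[of _ _ _ ?\<Psi>]) auto
  then show ?thesis using \<Phi> by (auto simp: mod_isomorphic_def)
qed


section \<open>Extending homomorphisms from a syzygy of $J$\<close>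

lemma J_carrier: "j \<in> carrier (J_module G) \<longleftrightarrow>
    (\<forall>s. s \<notin> sections G \<or> snd s = {\<one>} \<longrightarrow> j s = 0)"
  by (auto simp: J_module_def const_module_def simp del: split_paired_All)

lemma J_zero: "\<zero>\<^bsub>J_module G\<^esub> = (\<lambda>s. 0)" and J_add: "(i \<oplus>\<^bsub>J_module G\<^esub> j) s = i s + j s"
  by (simp_all add: J_module_def const_module_def)

lemma J_single: "f \<in> mors G \<Longrightarrow> (single c f \<odot>\<^bsub>J_module G\<^esub> j) s = (if src f = s then c * j (tgt f) else 0)"
  using sum_single[of f "\<lambda>f. src f = s" c "\<lambda>f. j (tgt f)"]
  by (simp add: J_module_def const_module_def sum_filter[OF finite_carrier])

text \<open>
  This is $H^1(W,\mathbb{Z})=\mathrm{Hom}(W,\mathbb{Z})=0$ for a finite group $W$, in a version for the groupoid of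
  subgroups and conjugations that needs no choice of orbit representatives. Averaging over $G$ yields
  the rational solution $-B_H/|G|$ with $B_H=\sum_g z(g,H)$; its differences along conjugations are the integers $z$, so they
  survive when $B_H/|G|$ is rounded down.
\<close>

lemma orbit_cocycle_coboundary:
  fixes z :: "'a \<Rightarrow> 'a set \<Rightarrow> int"
  assumes cocycle: "\<And>g h H. subgroup H G \<Longrightarrow> g \<in> carrier G \<Longrightarrow> h \<in> carrier G \<Longrightarrow>
      z (g \<otimes> h) H = z h H + z g (conj_set G h H)"
  obtains \<beta> where "\<And>h H. subgroup H G \<Longrightarrow> h \<in> carrier G \<Longrightarrow> z h H = \<beta> (conj_set G h H) - \<beta> H"
proof
  define B where "B = (\<lambda>H. \<Sum>g\<in>carrier G. z g H)"
  fix h H assume H: "subgroup H G" and h: "h \<in> carrier G"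
  have "B H = (\<Sum>g\<in>carrier G. z (g \<otimes> h) H)"
    unfolding B_def
    by (rule sum.reindex_bij_witness[of _ "\<lambda>g. g \<otimes> h" "\<lambda>g. g \<otimes> inv h"])
      (use h in \<open>simp_all add: m_assoc\<close>)
  also have "\<dots> = int (order G) * z h H + B (conj_set G h H)"
    using H h by (simp add: cocycle sum.distrib B_def order_def)
  finally have "B H div int (order G) = z h H + B (conj_set G h H) div int (order G)"
    using finite_carrier order_gt_0_iff_finite by simp
  then show "z h H = - (B (conj_set G h H) div int (order G)) - - (B H div int (order G))" by simp
qed

text \<open>
  By the universal property it suffices to extend $\theta=$ \<open>sc_eval\<close> $\circ f$, which is
  $\Pi$-linear, from the kernel $A$ to $F$. Over the trivial section of $H\ne1$ the module $J$ has value
  $\mathbb{Z}$, generated by the image of $x$, so every $y$ over $(H,H)$ is $n x$ plus an element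
  of $A$ with $n$ the value of $\epsilon y$ at $(H,H)$. An additive extension is thus fixed by the number $\beta_H$ assigned to $x$
  at $H$, and it is $\Pi$-linear if and only if $\beta$ has as coboundary the cocycle
  $z(g,H)=\theta(\mathrm{c}^g x-\mathrm{c}_{H/H}x)$, the value being taken in the factor of $Z$ at $H$. Such a $\beta$ exists by
  \<open>orbit_cocycle_coboundary\<close>. At $H=1$ the value of $J$ is $0$, so there $n=0$.
\<close>

lemma extend_hom_kernel_J:
  assumes F: "left_module Nabla F"
    and \<epsilon>: "\<epsilon> \<in> mod_hom Nabla F (J_module G)"
    and x: "x \<in> carrier F" and \<epsilon>x: "\<And>s. s \<in> sections G \<Longrightarrow> snd s \<noteq> {\<one>} \<Longrightarrow> \<epsilon> x s = 1"
    and f: "f \<in> mod_hom Nabla (F\<lparr>carrier := {y \<in> carrier F. \<epsilon> y = \<zero>\<^bsub>J_module G\<^esub>}\<rparr>) SC"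
  shows "\<exists>g\<in>mod_hom Nabla F SC. \<forall>y\<in>carrier F. \<epsilon> y = \<zero>\<^bsub>J_module G\<^esub> \<longrightarrow> g y = f y"
proof -
  let ?J = "J_module G" let ?A = "F\<lparr>carrier := {y \<in> carrier F. \<epsilon> y = \<zero>\<^bsub>?J\<^esub>}\<rparr>"
  interpret F: left_module Nabla F by fact
  have J: "left_module Nabla ?J" by (rule J_left_module[OF finite_carrier])
  have A: "left_module Nabla ?A" by (rule kernel_left_module[OF F J \<epsilon>])
  interpret A: left_module Nabla ?A by (rule A)
  note \<epsilon>D = mod_homD[OF \<epsilon>] and fD = mod_homD[OF f] and evD = mod_homD[OF sc_eval_hom]
  have Amem: "y \<in> carrier ?A \<longleftrightarrow> y \<in> carrier F \<and> (\<forall>s. \<epsilon> y s = 0)" for y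
    by (auto simp: J_zero simp del: split_paired_All)
  define \<theta> where "\<theta> = (\<lambda>y. sc_eval (f y))"
  have \<theta>_add: "\<theta> (y \<oplus>\<^bsub>F\<^esub> y') H = \<theta> y H + \<theta> y' H" if "y \<in> carrier ?A" "y' \<in> carrier ?A" for y y' H
    using that fD(2,3)[of y] fD(2)[of y'] by (simp add: \<theta>_def evD(3) TZ_add)
  have \<theta>_Pi: "\<theta> (a \<odot>\<^bsub>F\<^esub> y) = a \<odot>\<^bsub>TZ\<^esub> \<theta> y" if "y \<in> carrier ?A" "a \<in> carrier PiAlg" for y a
    using that fD(2)[of y] fD(4)[of a y] Pi_sub by (simp add: \<theta>_def evD(4))
  have A_add: "y \<oplus>\<^bsub>F\<^esub> y' \<in> carrier ?A" if "y \<in> carrier ?A" "y' \<in> carrier ?A" for y y'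
    using A.M.a_closed[OF that] by simp
  have A_smult: "a \<odot>\<^bsub>F\<^esub> y \<in> carrier ?A" if "a \<in> carrier Nabla" "y \<in> carrier ?A" for a y
    using A.smult_closed[OF that] by simp
  have \<theta>_outside: "\<theta> y H = 0" if "y \<in> carrier ?A" "\<not> subgroup H G" for y H
    using evD(2)[OF fD(2)[OF that(1)]] that(2) by (simp add: \<theta>_def TZ_carrier)
  define n where "n = (\<lambda>y H. \<epsilon> y (H, H))"
  have n_one: "n y {\<one>} = 0" if "y \<in> carrier F" for y
    using \<epsilon>D(2)[OF that] by (simp add: n_def J_carrier)
  \<comment> \<open>The right factor is \<open>1\<close> unless \<open>H\<close> is trivial, in which case both sides vanish.\<close>
  have n_x: "n y H * n x H = n y H" if "y \<in> carrier F" "subgroup H G" for y H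
    using \<epsilon>x[OF diag_sectionI[OF that(2)]] n_one[OF that(1)] by (cases "H = {\<one>}") (simp_all add: n_def)
  have n_conj: "n x (conj_set G g H) = n x H" if "subgroup H G" "g \<in> carrier G" for g H
  proof -
    have "conj_set G g H = {\<one>} \<longleftrightarrow> H = {\<one>}"
    proof
      assume "conj_set G g H = {\<one>}"
      then have "conj_set G (inv g) (conj_set G g H) = {\<one>}" using that by (simp add: conj_set_def)
      then show "H = {\<one>}" using that subgroup.subset[OF that(1)] by (simp add: conj_set_comp conj_set_one)
    qed (use that in \<open>simp add: conj_set_def\<close>)
    then show ?thesis
      using n_one[OF x] \<epsilon>x diag_sectionI[OF that(1)] diag_sectionI[OF conj_set_subgroup[OF that]]
      by (cases "H = {\<one>}") (simp_all add: n_def)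
  qed
  \<comment> \<open>The idempotent of the section \<open>(H, H)\<close> occurs below as the conjugation by \<open>\<one>\<close>.\<close>
  let ?c = "\<lambda>g H. conj_mor G g H"
  have one_conj: "conj_set G \<one> H = H" if "subgroup H G" for H
    using conj_set_one subgroup.subset[OF that] by blast
  have cm: "?c g H \<in> mors G" if "subgroup H G" "g \<in> carrier G" for g H
    by (rule conj_mor_closed[OF that])
  have cPi: "single k (?c g H) \<in> carrier PiAlg" if "subgroup H G" "g \<in> carrier G" for k g H
    by (rule Pi_memI[OF cm[OF that]]) (simp_all add: diag_def)
  have \<theta>_conj: "\<theta> (single k (?c g H) \<odot>\<^bsub>F\<^esub> y) K = (if H = K then k * \<theta> y (conj_set G g H) else 0)"
    if "y \<in> carrier ?A" "subgroup H G" "g \<in> carrier G" for k y g H K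
    using \<theta>_Pi[OF that(1) cPi[OF that(2,3)]] cm[OF that(2,3)] by (simp add: TZ_single diag_def)
  have cmult: "single k (?c h H) \<otimes>\<^bsub>Nabla\<^esub> single l (?c g (conj_set G h H)) = single (k * l) (?c (g \<otimes> h) H)"
    if "subgroup H G" "g \<in> carrier G" "h \<in> carrier G" for k l g h H
    using that cm[OF that(1,3)] cm[OF conj_set_subgroup[OF that(1,3)] that(2)]
    by (simp add: single_mult conj_mor_comp)
  have cmult_one: "single k (?c \<one> H) \<otimes>\<^bsub>Nabla\<^esub> single l (?c g H) = single (k * l) (?c g H)"
      "single k (?c g H) \<otimes>\<^bsub>Nabla\<^esub> single l (?c \<one> (conj_set G g H)) = single (k * l) (?c g H)"
    if "subgroup H G" "g \<in> carrier G" for k l g H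
    using cmult[OF that one_closed, of k l] cmult[OF that(1) one_closed that(2), of k l] that
    by (simp_all add: one_conj)
  have \<epsilon>_c: "\<epsilon> (single k (?c g H) \<odot>\<^bsub>F\<^esub> y) s = (if s = (H, H) then k * n y (conj_set G g H) else 0)"
    if "y \<in> carrier F" "subgroup H G" "g \<in> carrier G" for k y g H s
    using \<epsilon>D(4)[OF single_closed[OF cm[OF that(2,3)]] that(1)] cm[OF that(2,3)]
    by (auto simp: J_single n_def)
  \<comment> \<open>\<open>w k g H\<close> is \<open>k\<close> times the failure of the lift \<open>x\<close> to be invariant under the conjugation; it lies in
    the kernel because the value of \<open>\<epsilon> x\<close> is the same at \<open>H\<close> and its conjugates.\<close>
  define w where "w = (\<lambda>k g H. single k (?c g H) \<odot>\<^bsub>F\<^esub> x \<oplus>\<^bsub>F\<^esub> single (- k) (?c \<one> H) \<odot>\<^bsub>F\<^esub> x)"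
  have wA: "w k g H \<in> carrier ?A" if "subgroup H G" "g \<in> carrier G" for k g H
    unfolding Amem w_def using that x
    by (simp add: F.smult_closed cm \<epsilon>D(3) J_add \<epsilon>_c n_conj one_conj)
  define z where "z = (\<lambda>g H. \<theta> (w 1 g H) H)"
  have "z (g \<otimes> h) H = z h H + z g (conj_set G h H)"
    if H: "subgroup H G" and g: "g \<in> carrier G" and h: "h \<in> carrier G" for g h H
  proof -
    let ?K = "conj_set G h H"
    have K: "subgroup ?K G" by (rule conj_set_subgroup[OF H h])
    have "single 1 (?c h H) \<odot>\<^bsub>F\<^esub> w 1 g ?K = single 1 (?c (g \<otimes> h) H) \<odot>\<^bsub>F\<^esub> x \<oplus>\<^bsub>F\<^esub> single (- 1) (?c h H) \<odot>\<^bsub>F\<^esub> x"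
      using H K g h x
      by (simp add: w_def F.smult_r_distr F.smult_closed cm F.smult_assoc[symmetric] cmult)
    moreover have "single (- 1) (?c h H) \<odot>\<^bsub>F\<^esub> x \<oplus>\<^bsub>F\<^esub> single 1 (?c h H) \<odot>\<^bsub>F\<^esub> x = \<zero>\<^bsub>F\<^esub>"
      using H h x cm[OF H h] by (simp add: F.smult_l_distr[symmetric] single_add[symmetric] single_0)
    ultimately have "w 1 (g \<otimes> h) H = single 1 (?c h H) \<odot>\<^bsub>F\<^esub> w 1 g ?K \<oplus>\<^bsub>F\<^esub> w 1 h H"
      using H g h x cm by (simp add: w_def F.M.a_assoc F.smult_closed F.M.a_assoc[symmetric])
    then show ?thesis
      using \<theta>_add[OF A_smult[OF single_closed[OF cm[OF H h]] wA[OF K g]] wA[OF H h]]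
        \<theta>_conj[OF wA[OF K g] H h] by (simp add: z_def)
  qed
  then obtain \<beta> where \<beta>: "\<And>h H. subgroup H G \<Longrightarrow> h \<in> carrier G \<Longrightarrow> z h H = \<beta> (conj_set G h H) - \<beta> H"
    using orbit_cocycle_coboundary by metis
  \<comment> \<open>The component of \<open>y\<close> in the kernel, after subtracting the multiple of \<open>x\<close>.\<close>
  define r where "r = (\<lambda>y H. single 1 (?c \<one> H) \<odot>\<^bsub>F\<^esub> y \<oplus>\<^bsub>F\<^esub> single (- n y H) (?c \<one> H) \<odot>\<^bsub>F\<^esub> x)"
  have rA: "r y H \<in> carrier ?A" if "y \<in> carrier F" "subgroup H G" for y H
    unfolding Amem r_def using that x
    by (simp add: F.smult_closed cm \<epsilon>D(3) J_add \<epsilon>_c one_conj n_x)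
  define \<Theta> where "\<Theta> = (\<lambda>y\<in>carrier F. \<lambda>H. if subgroup H G then \<theta> (r y H) H + n y H * \<beta> H else 0)"
  have r_add: "r (y \<oplus>\<^bsub>F\<^esub> y') H = r y H \<oplus>\<^bsub>F\<^esub> r y' H"
    if y: "y \<in> carrier F" "y' \<in> carrier F" and H: "subgroup H G" for y y' H
  proof -
    have "single (- n (y \<oplus>\<^bsub>F\<^esub> y') H) (?c \<one> H) =
        single (- n y H) (?c \<one> H) \<oplus>\<^bsub>Nabla\<^esub> single (- n y' H) (?c \<one> H)"
      using y by (simp add: n_def \<epsilon>D(3) J_add flip: single_add)
    then show ?thesis
      using y H x cm by (simp add: r_def F.smult_r_distr F.smult_l_distr F.smult_closed F.M.a_ac)
  qed
  have \<Theta>_add: "\<Theta> (y \<oplus>\<^bsub>F\<^esub> y') H = \<Theta> y H + \<Theta> y' H" if "y \<in> carrier F" "y' \<in> carrier F" for y y' H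
    using that \<theta>_add[OF rA[OF that(1)] rA[OF that(2)], of H H H]
    by (simp add: \<Theta>_def r_add n_def \<epsilon>D(3) J_add distrib_right)
  have w_scale: "\<theta> (w k g H) H = k * z g H" if H: "subgroup H G" and g: "g \<in> carrier G" for k g H
  proof -
    have "single k (?c \<one> H) \<odot>\<^bsub>F\<^esub> w 1 g H = w k g H"
      using H g x cm
      by (simp add: w_def cmult_one F.smult_r_distr F.smult_closed flip: F.smult_assoc)
    then show ?thesis using \<theta>_conj[OF wA[OF H g, of 1] H one_closed, of k H] by (simp add: z_def one_conj[OF H])
  qed
  have \<Theta>_conj: "\<Theta> (single 1 (?c g K) \<odot>\<^bsub>F\<^esub> y) H = (if K = H then \<Theta> y (conj_set G g H) else 0)"
    if y: "y \<in> carrier F" and K: "subgroup K G" and g: "g \<in> carrier G" and H: "subgroup H G" for y g K H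
  proof (cases "K = H")
    case True
    let ?L = "conj_set G g H"
    have L: "subgroup ?L G" by (rule conj_set_subgroup[OF H g])
    have gy: "single 1 (?c g H) \<odot>\<^bsub>F\<^esub> y \<in> carrier F" using y H g cm by (simp add: F.smult_closed)
    have n: "n (single 1 (?c g H) \<odot>\<^bsub>F\<^esub> y) H = n y ?L" using \<epsilon>_c[OF y H g] by (simp add: n_def)
    \<comment> \<open>Conjugating the kernel component of \<open>y\<close> differs from the kernel component of the conjugate by
      the failure of \<open>x\<close> to be invariant.\<close>
    have "single 1 (?c g H) \<odot>\<^bsub>F\<^esub> r y ?L \<oplus>\<^bsub>F\<^esub> w (n y ?L) g H =
        single 1 (?c g H) \<odot>\<^bsub>F\<^esub> y \<oplus>\<^bsub>F\<^esub> (single (- n y ?L) (?c g H) \<odot>\<^bsub>F\<^esub> x \<oplus>\<^bsub>F\<^esub> single (n y ?L) (?c g H) \<odot>\<^bsub>F\<^esub> x)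
          \<oplus>\<^bsub>F\<^esub> single (- n y ?L) (?c \<one> H) \<odot>\<^bsub>F\<^esub> x"
      using y x H L g cm
      by (simp add: r_def cmult_one w_def F.smult_r_distr F.smult_closed F.M.a_assoc flip: F.smult_assoc)
    also have "single (- n y ?L) (?c g H) \<odot>\<^bsub>F\<^esub> x \<oplus>\<^bsub>F\<^esub> single (n y ?L) (?c g H) \<odot>\<^bsub>F\<^esub> x = \<zero>\<^bsub>F\<^esub>"
      using H g x cm by (simp add: F.smult_l_distr[symmetric] single_add[symmetric] single_0)
    also have "single 1 (?c g H) \<odot>\<^bsub>F\<^esub> y \<oplus>\<^bsub>F\<^esub> \<zero>\<^bsub>F\<^esub> \<oplus>\<^bsub>F\<^esub> single (- n y ?L) (?c \<one> H) \<odot>\<^bsub>F\<^esub> x =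
        r (single 1 (?c g H) \<odot>\<^bsub>F\<^esub> y) H"
      using y x H g cm
      by (simp add: r_def n cmult_one F.smult_closed flip: F.smult_assoc)
    finally have "r (single 1 (?c g H) \<odot>\<^bsub>F\<^esub> y) H = single 1 (?c g H) \<odot>\<^bsub>F\<^esub> r y ?L \<oplus>\<^bsub>F\<^esub> w (n y ?L) g H"
      by simp
    then have "\<theta> (r (single 1 (?c g H) \<odot>\<^bsub>F\<^esub> y) H) H = \<theta> (r y ?L) ?L + n y ?L * z g H"
      using \<theta>_add[OF A_smult[OF single_closed[OF cm[OF H g]] rA[OF y L]] wA[OF H g]]
        \<theta>_conj[OF rA[OF y L] H g] w_scale[OF H g] by simp
    then show ?thesis
      using True gy y H L n by (simp add: \<Theta>_def \<beta>[OF H g] right_diff_distrib)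
  next
    case False
    have gy: "single 1 (?c g K) \<odot>\<^bsub>F\<^esub> y \<in> carrier F" using y K g cm by (simp add: F.smult_closed)
    have n: "n (single 1 (?c g K) \<odot>\<^bsub>F\<^esub> y) H = 0" using \<epsilon>_c[OF y K g] False by (simp add: n_def)
    have "r (single 1 (?c g K) \<odot>\<^bsub>F\<^esub> y) H = single 0 (?c \<one> H) \<odot>\<^bsub>F\<^esub> \<zero>\<^bsub>F\<^esub>"
      using y x K H g cm False
      by (simp add: r_def n one_conj F.smult_closed single_mult single_0 flip: F.smult_assoc)
    moreover have "\<zero>\<^bsub>F\<^esub> \<in> carrier ?A" using A.M.zero_closed by simp
    ultimately have "\<theta> (r (single 1 (?c g K) \<odot>\<^bsub>F\<^esub> y) H) H = 0"
      using \<theta>_conj[OF _ H one_closed, of "\<zero>\<^bsub>F\<^esub>" 0 H] H by simp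
    then show ?thesis using False gy n by (simp add: \<Theta>_def)
  qed
  have \<Theta>_hom: "\<Theta> \<in> mod_hom PiAlg F TZ"
  proof (rule mod_homI)
    show "\<Theta> \<in> extensional (carrier F)" by (simp add: \<Theta>_def)
    show "\<Theta> y \<in> carrier TZ" if "y \<in> carrier F" for y using that by (simp add: TZ_carrier \<Theta>_def)
    show "\<Theta> (y \<oplus>\<^bsub>F\<^esub> y') = \<Theta> y \<oplus>\<^bsub>TZ\<^esub> \<Theta> y'" if "y \<in> carrier F" "y' \<in> carrier F" for y y'
      by (rule ext) (simp add: \<Theta>_add[OF that] TZ_add)
    fix a y assume a: "a \<in> carrier PiAlg" and y: "y \<in> carrier F"
    show "\<Theta> (a \<odot>\<^bsub>F\<^esub> y) = a \<odot>\<^bsub>TZ\<^esub> \<Theta> y"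
    proof
      fix H
      show "\<Theta> (a \<odot>\<^bsub>F\<^esub> y) H = (a \<odot>\<^bsub>TZ\<^esub> \<Theta> y) H"
      proof (cases "subgroup H G")
        case H: True
        have "\<Theta> (a \<odot>\<^bsub>F\<^esub> y) H = (\<Sum>k\<in>mors G. a k * \<Theta> (single 1 k \<odot>\<^bsub>F\<^esub> y) H)"
          by (rule additive_eq_sum[OF _ Pi_sub[OF a]])
            (use y in \<open>simp add: F.smult_l_distr F.smult_closed \<Theta>_add\<close>)
        also have "\<dots> = (a \<odot>\<^bsub>TZ\<^esub> \<Theta> y) H"
          unfolding TZ_smult
        proof (rule sum.cong[OF refl])
          fix k assume k: "k \<in> mors G"
          show "a k * \<Theta> (single 1 k \<odot>\<^bsub>F\<^esub> y) H =
            (if src k = (H, H) then a k * (if diag (tgt k) then \<Theta> y (fst (tgt k)) else 0) else 0)"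
          proof (cases "a k = 0")
            case False
            then have "diag (src k)" "diag (tgt k)"
              using a by (simp_all add: Pi_carrier[OF finite_carrier] del: split_paired_All)
            then obtain K L where "src k = (K, K)" "tgt k = (L, L)" by (metis diag_def prod.collapse)
            then obtain g where "g \<in> carrier G" "k = ?c g K" "subgroup K G"
              using diag_morE[OF k] by metis
            then show ?thesis using \<Theta>_conj[OF y _ _ H] by (simp add: diag_def)
          qed simp
        qed
        finally show ?thesis .
      next
        case False
        then have "src k \<noteq> (H, H)" if "k \<in> mors G" for k using mor_src(1)[OF that] diag_sectionD by auto
        then have "(a \<odot>\<^bsub>TZ\<^esub> \<Theta> y) H = 0" by (simp add: TZ_smult)
        then show ?thesis using False y F.smult_closed[OF Pi_sub[OF a] y] by (simp add: \<Theta>_def)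
      qed
    qed
  qed
  have \<Theta>_ext: "\<Theta> y = sc_eval (f y)" if y: "y \<in> carrier ?A" for y
  proof
    fix H
    have yF: "y \<in> carrier F" and n0: "n y H = 0" using y by (simp_all add: n_def J_zero)
    show "\<Theta> y H = sc_eval (f y) H"
    proof (cases "subgroup H G")
      case True
      have "r y H = single 1 (?c \<one> H) \<odot>\<^bsub>F\<^esub> y"
        using yF x True cm by (simp add: r_def n0 single_0 F.smult_closed)
      then show ?thesis using True yF n0 \<theta>_conj[OF y True one_closed, of 1 H]
        by (simp add: \<Theta>_def one_conj \<theta>_def)
    qed (use yF \<theta>_outside[OF y] in \<open>simp add: \<Theta>_def \<theta>_def\<close>)
  qed
  let ?g = "coextend F \<Theta>"
  have g: "?g \<in> mod_hom Nabla F SC" by (rule coextend_hom[OF F \<Theta>_hom])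
  \<comment> \<open>On the kernel both homomorphisms have the same values at trivial sections, hence agree.\<close>
  have gA: "restrict ?g (carrier ?A) \<in> mod_hom Nabla ?A SC"
    using mod_homD[OF g] A.smult_closed A.M.a_closed by (intro mod_homI) auto
  have "restrict ?g (carrier ?A) y = f y" if "y \<in> carrier ?A" for y
    by (rule sc_eval_joint_inj[OF A gA f _ that])
      (simp add: sc_eval_coextend[OF F \<Theta>_hom] \<Theta>_ext)
  then show ?thesis using g by (intro bexI[of _ ?g]) auto
qed

theorem Ext1_J_superclass: "trivial_group (Ext1 Nabla (J_module G) SC)"
proof (rule Ext1_trivialI[OF J_left_module[OF finite_carrier] SC_left_module])
  interpret J: left_module Nabla "J_module G" by (rule J_left_module[OF finite_carrier])
  fix f assume f: "f \<in> mod_hom Nabla (syzygy Nabla (J_module G)) SC"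
  have "(\<lambda>s. if s \<in> sections G \<and> snd s \<noteq> {\<one>} then 1 else 0) \<in> carrier (J_module G)"
    by (auto simp: J_carrier simp del: split_paired_All)
  from J.cover_map_surj[OF this] obtain x where x: "x \<in> carrier (free_cover Nabla (J_module G))"
    "cover_map Nabla (J_module G) x = (\<lambda>s. if s \<in> sections G \<and> snd s \<noteq> {\<one>} then 1 else 0)" by blast
  show "\<exists>g\<in>mod_hom Nabla (free_cover Nabla (J_module G)) SC. \<forall>x\<in>carrier (syzygy Nabla (J_module G)). g x = f x"
    using extend_hom_kernel_J[OF J.free_cover_left_module J.cover_map_hom x(1) _ f[unfolded syzygy_def]] x(2)
    by (auto simp: syzygy_def)
qed

end

theorem lemma7p5:
  fixes G :: "('a, 'b) monoid_scheme" and p n :: nat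
  assumes "group G" and "finite (carrier G)" and "prime p" and "order G = p ^ n"
  shows "mod_isomorphic (destriction_algebra G)
           (superclass_module G)
           (coind_module (destriction_algebra G) (c1_plus G) (trivial_module G)) \<and>
         trivial_group (Ext1 (destriction_algebra G) (J_module G) (superclass_module G))"
proof -
  interpret finite_group G
    using assms(1,2) by (simp add: finite_group_def finite_group_axioms_def)
  show ?thesis using superclass_coinduced Ext1_J_superclass by blast
qed

end
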